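(* Under Assumptions A, B, C1, C2, C3 (stated in the context), the following hold. (i) When $\alpha_n=o(n)$, $$n^{1/3}\alpha_n^{2/3}|\hat\theta^n-\theta^n|+n^{1/3}\alpha_n^{1/6}|\hat\beta_l^n-\beta_l^n|+n^{1/3}\alpha_n^{1/6}|\hat\beta_u^n-\beta_u^n|=O_P(1).$$ (ii) When $\alpha_n=n$, $$n|\hat\theta^n-\theta^n|+\sqrt n|\hat\beta_l^n-\beta_l^n|+\sqrt n|\hat\beta_u^n-\beta_u^n|=O_P(1).$$ (iii) When $n=o(\alpha_n)$, $$n|\hat\theta^n-\theta^n|+\sqrt n|\hat\beta_l^n-\beta_l^n|+\sqrt n|\hat\beta_u^n-\beta_u^n|=O_P(1).$$
   Context: Setting. Fix $\theta^0\in(0,1)$ and a smooth bounded monotone (increasing) function $f:\mathbb{R}\to\mathbb{R}$; write $\beta_l^0=f(-\infty)$ and $\beta_u^0=f(\infty)$ for its limits. Let $\alpha_n>0$, $\alpha_n\to\infty$, and $f_n(x)=f(\alpha_n(x-\theta^0))$. At stage $n$ the data $(Y_i,X_i)$, $i=1,\dots,n$, are i.i.d. copies of $(Y,X)$ with $Y=f_n(X)+\epsilon$, where $X$ takes values in $[0,1]$ with distribution function $F_X$ and density $p_X$, and $\epsilon$ is independent of $X$ with $E\epsilon=0$ and finite variance $\sigma^2$. $P_n$ denotes the true distribution of $(Y,X)$ at stage $n$ and $\mathbb{P}_n$ the empirical measure of the sample; both are also used as expectation operators. For $\psi=(\theta,\beta_l,\beta_u)$ ($\theta\in[0,1]$,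 $\beta_l,\beta_u\in\mathbb{R}$) let $m_\psi(x,y)=\{y-\beta_l1(x\le\theta)-\beta_u1(x>\theta)\}^2$ and $M_n(\psi)=P_nm_\psi(X,Y)$. It is assumed that $M_n$ has a unique minimizer $\psi^n=(\theta^n,\beta_l^n,\beta_u^n)$, with $\beta_l^n\ne\beta_u^n$. The estimator $\hat\psi^n=(\hat\theta^n,\hat\beta_l^n,\hat\beta_u^n)$ is the minimizer of $\psi\mapsto\mathbb{P}_nm_\psi$; if there are several, the one with the smallest first coordinate. Put $\xi^n=\alpha_n(\theta^n-\theta^0)$ and $\xi^0=f^{-1}((\beta_l^0+\beta_u^0)/2)$. Assumptions. A. $f$ is continuously differentiable in an open neighborhood of $\xi^0$ with $f'(\xi^0)>0$. B. $p_X$ does not vanish and is continuously differentiable in a neighborhood of $\theta^0$. C1. $\inf_n\liminf_{|h_1|\to\infty}\frac1{|h_1|}\int_0^{h_1}[f(t+\xi^n)-f(\xi^n)]\,dt>0$. C2. For every constant $K>0$, $\inf_n\inf_{u\in[-K+\xi^n,K+\xi^n]}f'(u)>0$. C3. The integrals $\xi^l=\int_{-\infty}^{\xi^0}(f(t)-\beta_l^0)\,dt$ and $\xi^u=\int_{\xi^0}^{\infty}(f(t)-\beta_u^0)\,dt$ exist. *)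

theory Defs
  imports "HOL-Probability.Probability" "HOL-Library.Landau_Symbols"
begin

(* Parameters are triples (theta, beta_l, beta_u); observations are pairs (y, x). *)

definition param_space :: "(real \<times> real \<times> real) set" where
  "param_space = {0..1} \<times> UNIV \<times> UNIV"

fun m_crit :: "real \<times> real \<times> real \<Rightarrow> real \<times> real \<Rightarrow> real" where
  "m_crit (\<theta>, \<beta>l, \<beta>u) (y, x) = (y - \<beta>l * of_bool (x \<le> \<theta>) - \<beta>u * of_bool (x > \<theta>))\<^sup>2"

definition f_stage :: "(real \<Rightarrow> real) \<Rightarrow> (nat \<Rightarrow> real) \<Rightarrow> real \<Rightarrow> nat \<Rightarrow> real \<Rightarrow> real" where
  "f_stage f \<alpha> \<theta>0 n x = f (\<alpha> n * (x - \<theta>0))"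

(* The law P_n of (Y, X) with Y = f_n(X) + eps, for a generic pair (X, eps) living on B. *)
definition stage_law ::
  "'b measure \<Rightarrow> ('b \<Rightarrow> real) \<Rightarrow> ('b \<Rightarrow> real) \<Rightarrow> (real \<Rightarrow> real) \<Rightarrow> (real \<times> real) measure" where
  "stage_law B X \<epsilon> g = distr B (borel \<Otimes>\<^sub>M borel) (\<lambda>\<omega>. (g (X \<omega>) + \<epsilon> \<omega>, X \<omega>))"

definition pop_risk :: "(real \<times> real) measure \<Rightarrow> real \<times> real \<times> real \<Rightarrow> real" where
  "pop_risk P \<psi> = (\<integral>z. m_crit \<psi> z \<partial>P)"

definition emp_risk :: "nat \<Rightarrow> (nat \<Rightarrow> real \<times> real) \<Rightarrow> real \<times> real \<times> real \<Rightarrow> real" where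
  "emp_risk n z \<psi> = (\<Sum>i=1..n. m_crit \<psi> (z i)) / real n"

(* Only meaningful if each Z n is a random variable on M n: measure is 0 off the sigma-algebra. *)
definition bounded_in_prob :: "(nat \<Rightarrow> 'w measure) \<Rightarrow> (nat \<Rightarrow> 'w \<Rightarrow> real) \<Rightarrow> bool" where
  "bounded_in_prob M Z \<longleftrightarrow>
     (\<forall>e>0. \<exists>K. \<forall>\<^sub>F n in sequentially. measure (M n) {\<omega> \<in> space (M n). \<bar>Z n \<omega>\<bar> > K} < e)"

definition smooth :: "(real \<Rightarrow> real) \<Rightarrow> bool" where
  "smooth f \<longleftrightarrow> (\<forall>k x. (deriv ^^ k) f differentiable (at x))"

end

theory Submission
  imports Defs
begin

text \<open>
  Write $g$ for the regression function of stage $n$, $(\theta^*, \beta_l, \beta_u)$ for the population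
  minimiser, and $b$ for the sum of the errors of the two fitted levels.  The proof rests on
  second-moment bounds.

  The fitted step function is compared with the one that has the same two levels but is cut at
  $\theta^*$.  Only observations between the two cuts contribute to the difference of the residual sums
  of squares.  As $g(\theta^*)$ is the midpoint of the population levels (first_order_condition),
  minimality of the fit bounds the drift $\sum 2 (g(X_i) - g(\theta^*))$ over these observations by
  $\sum (b - 2 \epsilon_i)$, up to a common sign.  When the two cuts are $\delta$ apart,

  \<^item> the drift is at least of order $n \delta \min(\alpha_n \delta, 1)$, because $g$ moves away from
    $g(\theta^*)$ at slope $\alpha_n$ until it has moved by a constant (uniform_slope);
  \<^item> the noise is of order $\sqrt{n \delta}$ uniformly over all cuts at that distance, by a maximal
    inequality for sums taken in the order of the design points (maximal_inequality_prefix);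
  \<^item> the level error contributes $n \delta |b|$, where $|b|$ is of order $n^{-1/2} + \delta$ by the
    normal equations of the fit (level_error).

  So the drift dominates, except with probability of order
  $1 / (n \delta) + 1 / (n \alpha_n^2 \delta^3)$ (split_not_at_scale, whp_scale_tame).  Over
  dyadic $\delta \ge K \tau_n$ these probabilities form a geometric series, and their sum is small for large $K$
  as soon as $n \tau_n \ge 1$ and $n \alpha_n^2 \tau_n^3 \ge 1$ (local_rate, rate).
  The choice $\tau_n = n^{-1/3} \alpha_n^{-2/3}$ serves slowly growing $\alpha_n$, and
  $\tau_n = 1 / n$ the case $\alpha_n \ge n$; the levels have an error of
  order $n^{-1/2} + \tau_n$, which is at most of order $n^{-1/3} \alpha_n^{-1/6}$ in the slow case.

  Two preliminaries make this local argument applicable.  The cut of the fit is consistent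
  (fit_consistent): a fit with its cut away from the jump is compared with the limiting two-valued
  function, and it loses a fixed multiple of $n$ on the block where it has only one level
  for two plateaus.  On the population side, the growth condition on $f$ keeps $\xi^n$ in a compact set
  (separated_from_limits, bounded_if_separated), so that $\theta^n$ approaches the jump, and dominated convergence gives the limits of
  $\beta_l^n$ and $\beta_u^n$ (level_bias).
\<close>

section \<open>Events outside a small exceptional set, and first passages\<close>

text \<open>The probability bound is carried by a measurable exceptional set, so the property itself may range
over uncountably many cuts without a measurability proof.  Here $p$ bounds the
probability of failure.\<close>

definition whp :: "'w measure \<Rightarrow> real \<Rightarrow> ('w \<Rightarrow> bool) \<Rightarrow> bool" where
  "whp M p Q \<longleftrightarrow> (\<exists>N\<in>sets M. measure M N \<le> p \<and> (\<forall>\<omega>\<in>space M - N. Q \<omega>))"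

lemma whp_mono:
  assumes "whp M p Q" "p \<le> q" "\<And>\<omega>. \<omega> \<in> space M \<Longrightarrow> Q \<omega> \<Longrightarrow> R \<omega>"
  shows "whp M q R"
  using assms unfolding whp_def by (meson DiffD1 order_trans)

context prob_space
begin

lemma whp_conj:
  assumes "whp M p Q" "whp M q R"
  shows "whp M (p + q) (\<lambda>\<omega>. Q \<omega> \<and> R \<omega>)"
proof -
  obtain N1 N2 where N: "N1 \<in> sets M" "prob N1 \<le> p" "\<forall>\<omega>\<in>space M - N1. Q \<omega>"
     "N2 \<in> sets M" "prob N2 \<le> q" "\<forall>\<omega>\<in>space M - N2. R \<omega>"
    using assms unfolding whp_def by blast
  have "prob (N1 \<union> N2) \<le> p + q" using measure_Un_le[OF N(1,4)] N by linarith
  then show ?thesis unfolding whp_def using N by (intro bexI[of _ "N1 \<union> N2"]) auto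
qed

lemma whp_finite_ball:
  assumes "finite J" "\<And>j. j \<in> J \<Longrightarrow> whp M (p j) (Q j)"
  shows "whp M (\<Sum>j\<in>J. p j) (\<lambda>\<omega>. \<forall>j\<in>J. Q j \<omega>)"
  using assms
proof (induction J rule: finite_induct)
  case empty
  show ?case unfolding whp_def by (intro bexI[of _ "{}"]) auto
next
  case (insert j J)
  then have "whp M (p j + (\<Sum>j\<in>J. p j)) (\<lambda>\<omega>. Q j \<omega> \<and> (\<forall>j\<in>J. Q j \<omega>))"
    by (intro whp_conj) auto
  then show ?case using insert by (elim whp_mono) auto
qed

lemma whp_prob_le:
  assumes "whp M p Q" shows "prob {\<omega> \<in> space M. \<not> Q \<omega>} \<le> p"
proof -
  obtain N where N: "N \<in> sets M" "prob N \<le> p" "\<forall>\<omega>\<in>space M - N. Q \<omega>"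
    using assms unfolding whp_def by blast
  have "prob {\<omega> \<in> space M. \<not> Q \<omega>} \<le> prob N" using N by (intro finite_measure_mono) auto
  then show ?thesis using N by linarith
qed

lemma whp_Markov:
  assumes "integrable M T" "\<And>\<omega>. \<omega> \<in> space M \<Longrightarrow> 0 \<le> T \<omega>" "0 < c" "expectation T \<le> m"
  shows "whp M (m / c) (\<lambda>\<omega>. T \<omega> < c)"
proof -
  have "prob {\<omega>\<in>space M. c \<le> T \<omega>} \<le> expectation T / c"
    using assms by (intro integral_Markov_inequality_measure[of M T "{}"]) (auto intro!: AE_I2)
  also have "\<dots> \<le> m / c" using assms by (intro divide_right_mono) auto
  finally show ?thesis unfolding whp_def using assms(1)
    by (intro bexI[of _ "{\<omega>\<in>space M. c \<le> T \<omega>}"]) auto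
qed

lemma whp_Chebyshev:
  assumes "integrable M (\<lambda>\<omega>. (T \<omega>)\<^sup>2)" "0 < c" "expectation (\<lambda>\<omega>. (T \<omega>)\<^sup>2) \<le> v"
  shows "whp M (v / c\<^sup>2) (\<lambda>\<omega>. \<bar>T \<omega>\<bar> < c)"
proof -
  have "whp M (v / c\<^sup>2) (\<lambda>\<omega>. (T \<omega>)\<^sup>2 < c\<^sup>2)"
    using assms by (intro whp_Markov) auto
  then show ?thesis
    by (rule whp_mono) (use power2_less_imp_less[of "\<bar>_\<bar>" c] assms(2) in auto)
qed

end

text \<open>Observations are ordered by their design points, with ties broken by the index.  The tie-break
makes the order total, so that at most one observation is the first passage.\<close>

definition prec :: "(nat \<Rightarrow> real) \<Rightarrow> nat \<Rightarrow> nat \<Rightarrow> bool" where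
  "prec u j i \<longleftrightarrow> u j < u i \<or> (u j \<le> u i \<and> j < i)"

definition prefix_sum :: "(nat \<Rightarrow> real) \<Rightarrow> (nat \<Rightarrow> real) \<Rightarrow> nat set \<Rightarrow> nat \<Rightarrow> real" where
  "prefix_sum u a J i = (\<Sum>j\<in>J. if prec u j i \<or> j = i then a j else 0)"

definition first_passage :: "(nat \<Rightarrow> real) \<Rightarrow> (nat \<Rightarrow> real) \<Rightarrow> nat set \<Rightarrow> real \<Rightarrow> nat \<Rightarrow> bool" where
  "first_passage u a J c i \<longleftrightarrow> c \<le> \<bar>prefix_sum u a J i\<bar> \<and>
     (\<forall>k\<in>J. prec u k i \<longrightarrow> \<bar>prefix_sum u a J k\<bar> < c)"

text \<open>The value of the partial sum at its first passage through the level $c$, provided that the passage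
precedes $j$, and $0$ otherwise.  At most one summand is nonzero.\<close>

definition passage_value :: "(nat \<Rightarrow> real) \<Rightarrow> (nat \<Rightarrow> real) \<Rightarrow> nat set \<Rightarrow> real \<Rightarrow> nat \<Rightarrow> real" where
  "passage_value u a J c j =
     (\<Sum>i\<in>J. if prec u i j \<and> first_passage u a J c i then prefix_sum u a J i else 0)"

lemma prec_linear: "prec u j i \<or> j = i \<or> prec u i j" and prec_asym: "prec u j i \<Longrightarrow> \<not> prec u i j"
  and prec_trans: "prec u k j \<Longrightarrow> prec u j i \<Longrightarrow> prec u k i" and prec_irrefl: "\<not> prec u i i"
  unfolding prec_def by auto

lemma first_passage_exists:
  assumes "finite J" "i \<in> J" "c \<le> \<bar>prefix_sum u a J i\<bar>"
  shows "\<exists>i\<in>J. first_passage u a J c i"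
proof -
  define C where "C = {i\<in>J. c \<le> \<bar>prefix_sum u a J i\<bar>}"
  define m where "m = Min (u ` C)"
  have fC: "finite C" "C \<noteq> {}" using assms by (auto simp: C_def)
  have "m \<in> u ` C" unfolding m_def using fC by (intro Min_in) auto
  define C' where "C' = {i\<in>C. u i = m}"
  have C': "finite C'" "C' \<noteq> {}" using fC \<open>m \<in> u ` C\<close> by (auto simp: C'_def)
  define i0 where "i0 = Min C'"
  have i0: "i0 \<in> C'" unfolding i0_def using C' by (rule Min_in)
  have "\<bar>prefix_sum u a J k\<bar> < c" if "k \<in> J" "prec u k i0" for k
  proof (rule ccontr)
    assume "\<not> ?thesis"
    then have kC: "k \<in> C" using that by (auto simp: C_def)
    then have "m \<le> u k" unfolding m_def using fC by (intro Min_le) auto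
    then have "u k = m" "k < i0" using that i0 unfolding prec_def C'_def by auto
    then have "k \<in> C'" using kC by (auto simp: C'_def)
    then have "i0 \<le> k" unfolding i0_def using C' by (intro Min_le) auto
    then show False using \<open>k < i0\<close> by simp
  qed
  then show ?thesis using i0 unfolding first_passage_def C'_def C_def by blast
qed

lemma first_passage_unique:
  assumes "first_passage u a J c i" "first_passage u a J c k" "i \<in> J" "k \<in> J"
  shows "i = k"
  using assms prec_linear[of u i k] unfolding first_passage_def by fastforce

text \<open>Pathwise form of Kolmogorov's inequality: if $S$ is the sum up to the first passage and $R$ the
rest, the right-hand side is $(S + R)^2 - 2 S R \ge S^2$.  The subtracted sum is a martingale
transform, which has mean zero.\<close>

lemma maximal_pathwise:
  assumes "finite J" "0 < c"
  shows "c\<^sup>2 * of_bool (\<exists>i\<in>J. c \<le> \<bar>prefix_sum u a J i\<bar>)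
     \<le> (\<Sum>j\<in>J. a j)\<^sup>2 - 2 * (\<Sum>j\<in>J. a j * passage_value u a J c j)"
proof (cases "\<exists>i\<in>J. c \<le> \<bar>prefix_sum u a J i\<bar>")
  case False
  then have "passage_value u a J c j = 0" for j
    unfolding passage_value_def first_passage_def by (intro sum.neutral) auto
  then show ?thesis using False by simp
next
  case True
  then obtain i where i: "i \<in> J" "first_passage u a J c i" using first_passage_exists[OF assms(1)] by blast
  define S where "S = prefix_sum u a J i"
  define R where "R = (\<Sum>j\<in>J. if prec u i j then a j else 0)"
  have Phi: "passage_value u a J c j = (if prec u i j then S else 0)" for j
  proof -
    have "passage_value u a J c j = (\<Sum>k\<in>J. if k = i then (if prec u i j then S else 0) else 0)"
      unfolding passage_value_def S_def
      by (intro sum.cong) (use i first_passage_unique[of u a J c] in auto)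
    then show ?thesis using i assms by simp
  qed
  have tot: "(\<Sum>j\<in>J. a j) = S + R"
    unfolding S_def R_def prefix_sum_def sum.distrib[symmetric]
    by (intro sum.cong refl) (use prec_linear[of u _ i] prec_asym[of u] prec_irrefl in auto)
  have "(\<Sum>j\<in>J. a j * passage_value u a J c j) = S * R"
    unfolding Phi R_def sum_distrib_left by (intro sum.cong) auto
  then have "(\<Sum>j\<in>J. a j)\<^sup>2 - 2 * (\<Sum>j\<in>J. a j * passage_value u a J c j) = S\<^sup>2 + R\<^sup>2"
    unfolding tot by (simp add: power2_eq_square algebra_simps)
  moreover have "c\<^sup>2 \<le> S\<^sup>2" using i assms(2) unfolding first_passage_def S_def
    by (metis abs_le_square_iff abs_of_pos)
  moreover have "0 \<le> R\<^sup>2" by simp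
  ultimately have "c\<^sup>2 \<le> (\<Sum>j\<in>J. a j)\<^sup>2 - 2 * (\<Sum>j\<in>J. a j * passage_value u a J c j)" by linarith
  then show ?thesis using True by simp
qed

lemma prefix_sum_cong:
  assumes "\<And>k. k \<in> J \<Longrightarrow> prec u k i \<or> k = i \<Longrightarrow> a k = b k"
  shows "prefix_sum u a J i = prefix_sum u b J i"
  unfolding prefix_sum_def using assms by (intro sum.cong) auto

text \<open>Predictability: whether and where a passage occurs before $j$ is decided without the noise of $j$.\<close>

lemma passage_value_cong:
  assumes "\<And>k. k \<in> J \<Longrightarrow> k \<noteq> j \<Longrightarrow> a k = b k"
  shows "passage_value u a J c j = passage_value u b J c j"
proof -
  have *: "prefix_sum u a J i = prefix_sum u b J i" if "prec u i j" for i
    by (rule prefix_sum_cong) (use assms that prec_asym[of u] prec_irrefl in auto)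
  have **: "first_passage u a J c i = first_passage u b J c i" if "prec u i j" for i
    unfolding first_passage_def using *[OF that] that * prec_trans[of u _ i j] by auto
  show ?thesis unfolding passage_value_def using * ** by (intro sum.cong) auto
qed

lemma passage_value_cong_on:
  assumes "\<And>k. k \<in> J \<Longrightarrow> u k = v k" "\<And>k. k \<in> J \<Longrightarrow> a k = b k" "j \<in> J"
  shows "passage_value u a J c j = passage_value v b J c j"
proof -
  have p: "prec u k i = prec v k i" if "k \<in> J" "i \<in> J" for k i using assms that by (simp add: prec_def)
  have s: "prefix_sum u a J i = prefix_sum v b J i" if "i \<in> J" for i
    unfolding prefix_sum_def using that by (intro sum.cong) (auto simp: p assms(2))
  have f: "first_passage u a J c i = first_passage v b J c i" if "i \<in> J" for i
    unfolding first_passage_def using that by (auto simp: p s)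
  show ?thesis unfolding passage_value_def using assms(3) by (intro sum.cong) (auto simp: p s f)
qed

lemma passage_value_bound:
  assumes "finite J" shows "\<bar>passage_value u a J c j\<bar> \<le> (\<Sum>k\<in>J. \<bar>a k\<bar>)"
proof (cases "\<exists>i\<in>J. first_passage u a J c i")
  case False
  then have "passage_value u a J c j = 0"
    unfolding passage_value_def by (intro sum.neutral) auto
  then show ?thesis by (simp add: sum_nonneg)
next
  case True
  then obtain i where i: "i \<in> J" "first_passage u a J c i" by blast
  have "passage_value u a J c j = (\<Sum>k\<in>J. if k = i then (if prec u i j then prefix_sum u a J i else 0) else 0)"
    unfolding passage_value_def
    by (intro sum.cong) (use i first_passage_unique[of u a J c] in auto)
  then have "\<bar>passage_value u a J c j\<bar> \<le> \<bar>prefix_sum u a J i\<bar>" using i assms by simp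
  also have "\<dots> \<le> (\<Sum>k\<in>J. \<bar>a k\<bar>)"
    unfolding prefix_sum_def by (rule order_trans[OF sum_abs]) (intro sum_mono, auto)
  finally show ?thesis .
qed

lemma measurable_passage_value[measurable]:
  assumes "finite J" "j \<in> J"
  shows "(\<lambda>z. passage_value (\<lambda>i. fst (z i)) (\<lambda>i. snd (z i)) J c j)
     \<in> borel_measurable (PiM J (\<lambda>_. borel \<Otimes>\<^sub>M borel))"
proof -
  have [measurable]: "(\<lambda>z. fst (z i)) \<in> borel_measurable (PiM J (\<lambda>_. borel \<Otimes>\<^sub>M borel :: (real \<times> real) measure))"
    "(\<lambda>z. snd (z i)) \<in> borel_measurable (PiM J (\<lambda>_. borel \<Otimes>\<^sub>M borel :: (real \<times> real) measure))" if "i \<in> J" for i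
    using that by measurable
  have [measurable]: "Measurable.pred (PiM J (\<lambda>_. borel \<Otimes>\<^sub>M borel :: (real \<times> real) measure)) (\<lambda>z. prec (\<lambda>i. fst (z i)) j i)"
    if "i \<in> J" "j \<in> J" for i j
  proof (cases "j < i")
    case True
    then have eq: "(\<lambda>z. prec (\<lambda>i. fst (z i :: real \<times> real)) j i) = (\<lambda>z. fst (z j) \<le> fst (z i))" unfolding prec_def by auto
    show ?thesis unfolding eq pred_def by (rule borel_measurable_le) (use that in measurable)
  next
    case False
    then have eq: "(\<lambda>z. prec (\<lambda>i. fst (z i :: real \<times> real)) j i) = (\<lambda>z. fst (z j) < fst (z i))" unfolding prec_def by auto
    show ?thesis unfolding eq using that by measurable
  qed
  have [measurable]: "(\<lambda>z. prefix_sum (\<lambda>i. fst (z i)) (\<lambda>i. snd (z i)) J i)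
     \<in> borel_measurable (PiM J (\<lambda>_. borel \<Otimes>\<^sub>M borel))" if "i \<in> J" for i
    unfolding prefix_sum_def using that by measurable
  have [measurable]: "Measurable.pred (PiM J (\<lambda>_. borel \<Otimes>\<^sub>M borel)) (\<lambda>z. first_passage (\<lambda>i. fst (z i)) (\<lambda>i. snd (z i)) J c i)"
    if "i \<in> J" for i
    unfolding first_passage_def using that assms by measurable
  show ?thesis unfolding passage_value_def using assms by measurable
qed

section \<open>A maximal inequality for noise ordered by the design\<close>

context prob_space
begin

text \<open>By Fubini, the noise of observation $j$ is integrated first, with all other observations and its own design point
held fixed; the factor $H$ is then a bounded function of the design point alone.\<close>

lemma integral_noise_against_rest_eq_0:
  fixes U a :: "nat \<Rightarrow> 'a \<Rightarrow> real" and H :: "(nat \<Rightarrow> real \<times> real) \<Rightarrow> real"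
  assumes J: "finite J" "j \<in> J"
    and ind: "indep_vars (\<lambda>_. borel \<Otimes>\<^sub>M borel) (\<lambda>i \<omega>. (U i \<omega>, a i \<omega>)) J"
    and centred: "\<And>h C. h \<in> borel_measurable borel \<Longrightarrow> (\<And>x. \<bar>h x\<bar> \<le> C) \<Longrightarrow>
          expectation (\<lambda>\<omega>. a j \<omega> * h (U j \<omega>)) = 0"
    and H: "H \<in> borel_measurable (PiM J (\<lambda>_. borel \<Otimes>\<^sub>M borel))"
    and noself: "\<And>z z'. (\<And>k. k \<noteq> j \<Longrightarrow> z k = z' k) \<Longrightarrow> fst (z j) = fst (z' j) \<Longrightarrow> H z = H z'"
    and bnd: "\<And>z. \<bar>H z\<bar> \<le> (\<Sum>k\<in>J. \<bar>snd (z k)\<bar>)"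
    and int: "integrable M (\<lambda>\<omega>. a j \<omega> * H (\<lambda>i\<in>J. (U i \<omega>, a i \<omega>)))"
  shows "expectation (\<lambda>\<omega>. a j \<omega> * H (\<lambda>i\<in>J. (U i \<omega>, a i \<omega>))) = 0"
proof -
  let ?B = "borel \<Otimes>\<^sub>M borel :: (real \<times> real) measure"
  let ?R = "PiM (J - {j}) (\<lambda>_. ?B)"
  have rv: "random_variable ?B (\<lambda>\<omega>. (U i \<omega>, a i \<omega>))" if "i \<in> J" for i
    using ind that unfolding indep_vars_def by auto
  let ?L = "PiM {j} (\<lambda>_. ?B)"
  define V where "V = (\<lambda>\<omega>. \<lambda>i\<in>{j}. (U i \<omega>, a i \<omega>))"
  define W where "W = (\<lambda>\<omega>. \<lambda>i\<in>J - {j}. (U i \<omega>, a i \<omega>))"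
  have "indep_var ?L V ?R W"
    unfolding V_def W_def by (rule indep_var_restrict[OF ind]) (use J in auto)
  then have rvV [measurable]: "V \<in> measurable M ?L" and rvW [measurable]: "W \<in> measurable M ?R"
    and deq: "distr M ?L V \<Otimes>\<^sub>M distr M ?R W = distr M (?L \<Otimes>\<^sub>M ?R) (\<lambda>\<omega>. (V \<omega>, W \<omega>))"
    using indep_var_distribution_eq[of ?L V ?R W] by auto
  define G where "G = (\<lambda>(v, w). snd (v j) * H (w(j := (fst (v j), 0::real))))"
  have merge: "(\<lambda>p. (snd p)(j := (fst (fst p j), 0::real))) \<in> measurable (?L \<Otimes>\<^sub>M ?R) (PiM J (\<lambda>_. ?B))"
    by (rule measurable_fun_upd[of J "J - {j}" j]) (use J in auto)
  have Gm [measurable]: "G \<in> borel_measurable (?L \<Otimes>\<^sub>M ?R)"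
    unfolding G_def split_beta
    by (intro borel_measurable_times measurable_compose[OF merge H]) measurable
  have Geq: "G (V \<omega>, W \<omega>) = a j \<omega> * H (\<lambda>i\<in>J. (U i \<omega>, a i \<omega>))" for \<omega>
    unfolding G_def V_def W_def using J by (auto intro!: noself)
  interpret PV: prob_space "distr M ?L V" by (rule prob_space_distr) simp
  interpret PW: prob_space "distr M ?R W" by (rule prob_space_distr) simp
  interpret P2: pair_prob_space "distr M ?L V" "distr M ?R W" by unfold_locales
  have intG: "integrable (distr M ?L V \<Otimes>\<^sub>M distr M ?R W) G"
    unfolding deq by (subst integrable_distr_eq) (use int Geq in auto)
  have "expectation (\<lambda>\<omega>. a j \<omega> * H (\<lambda>i\<in>J. (U i \<omega>, a i \<omega>)))
      = (\<integral>p. G p \<partial>(distr M ?L V \<Otimes>\<^sub>M distr M ?R W))"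
    unfolding deq by (subst integral_distr) (use Geq in auto)
  also have "\<dots> = (\<integral>w. (\<integral>v. G (v, w) \<partial>distr M ?L V) \<partial>distr M ?R W)"
    using P2.integral_snd[of "\<lambda>v w. G (v, w)"] intG by simp
  also have "\<dots> = (\<integral>w. 0 \<partial>distr M ?R W)"
  proof (rule Bochner_Integration.integral_cong[OF refl])
    fix w assume "w \<in> space (distr M ?R W)"
    then have w: "w \<in> space ?R" by simp
    define h where "h = (\<lambda>u. H (w(j := (u, 0))))"
    have "(\<lambda>u. w(j := (u, 0::real))) \<in> measurable borel (PiM J (\<lambda>_. ?B))"
      by (rule measurable_fun_upd[of J "J - {j}" j]) (use J w in auto)
    then have hm: "h \<in> borel_measurable borel" unfolding h_def by (rule measurable_compose[OF _ H])
    have hb: "\<bar>h u\<bar> \<le> (\<Sum>k\<in>J. \<bar>if k = j then 0 else snd (w k)\<bar>)" for u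
      unfolding h_def by (rule order_trans[OF bnd]) (auto intro!: sum_mono)
    have "(\<integral>v. G (v, w) \<partial>distr M ?L V) = expectation (\<lambda>\<omega>. a j \<omega> * h (U j \<omega>))"
      using integral_distr[OF rvV measurable_Pair1[OF Gm w]] by (simp add: G_def V_def h_def)
    then show "(\<integral>v. G (v, w) \<partial>distr M ?L V) = 0" using centred[OF hm hb] by simp
  qed
  finally show ?thesis by simp
qed

text \<open>Kolmogorov's maximal inequality for a random order of summation.  The order depends on the design only,
so each noise term is still centred given everything that precedes it, and the expectation of the
martingale transform in maximal_pathwise vanishes term by term.\<close>

theorem maximal_inequality_prefix:
  fixes U a :: "nat \<Rightarrow> 'a \<Rightarrow> real"
  assumes J: "finite J"
    and ind: "indep_vars (\<lambda>_. borel \<Otimes>\<^sub>M borel) (\<lambda>i \<omega>. (U i \<omega>, a i \<omega>)) J"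
    and centred: "\<And>j h C. j \<in> J \<Longrightarrow> h \<in> borel_measurable borel \<Longrightarrow> (\<And>x. \<bar>h x\<bar> \<le> C) \<Longrightarrow>
          expectation (\<lambda>\<omega>. a j \<omega> * h (U j \<omega>)) = 0"
    and sq: "\<And>j. j \<in> J \<Longrightarrow> integrable M (\<lambda>\<omega>. (a j \<omega>)\<^sup>2)"
    and c: "0 < c" and v: "(\<Sum>j\<in>J. expectation (\<lambda>\<omega>. (a j \<omega>)\<^sup>2)) \<le> v"
  shows "whp M (v / c\<^sup>2) (\<lambda>\<omega>. \<forall>t. \<bar>\<Sum>j | j \<in> J \<and> U j \<omega> \<le> t. a j \<omega>\<bar> < c)"
proof -
  let ?B = "borel \<Otimes>\<^sub>M borel :: (real \<times> real) measure"
  have rv: "random_variable ?B (\<lambda>\<omega>. (U i \<omega>, a i \<omega>))" if "i \<in> J" for i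
    using ind that unfolding indep_vars_def by auto
  have [measurable]: "random_variable borel (a i)" "random_variable borel (U i)" if "i \<in> J" for i
    using measurable_compose[OF rv[OF that] measurable_snd] measurable_compose[OF rv[OF that] measurable_fst]
    by (simp_all add: comp_def)
  define S where "S i \<omega> = prefix_sum (\<lambda>i. U i \<omega>) (\<lambda>i. a i \<omega>) J i" for i \<omega>
  define Phi where "Phi j \<omega> = passage_value (\<lambda>i. U i \<omega>) (\<lambda>i. a i \<omega>) J c j" for j \<omega>
  define PhiH where "PhiH j z = passage_value (\<lambda>i. fst (z i)) (\<lambda>i. snd (z i)) J c j" for j and z :: "nat \<Rightarrow> real \<times> real"
  have passage_restrict: "PhiH j (\<lambda>i\<in>J. (U i \<omega>, a i \<omega>)) = Phi j \<omega>" if "j \<in> J" for j \<omega>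
    unfolding Phi_def PhiH_def by (rule passage_value_cong_on) (use that in auto)
  have prod_int: "integrable M (\<lambda>\<omega>. \<bar>a j \<omega> * a k \<omega>\<bar>)" if "j \<in> J" "k \<in> J" for j k
  proof (rule Bochner_Integration.integrable_bound)
    show "integrable M (\<lambda>\<omega>. (a j \<omega>)\<^sup>2 + (a k \<omega>)\<^sup>2)" using sq that by auto
    have "\<bar>x * y\<bar> \<le> x\<^sup>2 + y\<^sup>2" for x y :: real
    proof -
      have "2 * (\<bar>x\<bar> * \<bar>y\<bar>) \<le> x\<^sup>2 + y\<^sup>2" using sum_squares_bound[of "\<bar>x\<bar>" "\<bar>y\<bar>"] by simp
      moreover have "0 \<le> \<bar>x\<bar> * \<bar>y\<bar>" by simp
      ultimately show ?thesis unfolding abs_mult by linarith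
    qed
    then show "AE \<omega> in M. norm \<bar>a j \<omega> * a k \<omega>\<bar> \<le> norm ((a j \<omega>)\<^sup>2 + (a k \<omega>)\<^sup>2)" by auto
  qed (use that in auto)
  have prod_int': "integrable M (\<lambda>\<omega>. a j \<omega> * a k \<omega>)" if "j \<in> J" "k \<in> J" for j k
    using prod_int[OF that] that by (subst (asm) integrable_abs_iff) auto
  have Phim: "PhiH j \<in> borel_measurable (PiM J (\<lambda>_. ?B))" if "j \<in> J" for j
    using measurable_passage_value[OF J that] unfolding PhiH_def .
  have Zm: "(\<lambda>\<omega>. \<lambda>i\<in>J. (U i \<omega>, a i \<omega>)) \<in> measurable M (PiM J (\<lambda>_. ?B))"
    using rv by (intro measurable_restrict) auto
  have [measurable]: "Phi j \<in> borel_measurable M" if "j \<in> J" for j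
    using measurable_compose[OF Zm Phim[OF that]] passage_restrict[OF that] by simp
  have cross_int: "integrable M (\<lambda>\<omega>. a j \<omega> * Phi j \<omega>)" if "j \<in> J" for j
  proof (rule Bochner_Integration.integrable_bound)
    show "integrable M (\<lambda>\<omega>. \<Sum>k\<in>J. \<bar>a j \<omega> * a k \<omega>\<bar>)" using prod_int that by auto
    show "AE \<omega> in M. norm (a j \<omega> * Phi j \<omega>) \<le> norm (\<Sum>k\<in>J. \<bar>a j \<omega> * a k \<omega>\<bar>)"
    proof (rule AE_I2)
      fix \<omega>
      have "\<bar>Phi j \<omega>\<bar> \<le> (\<Sum>k\<in>J. \<bar>a k \<omega>\<bar>)"
        unfolding Phi_def by (rule passage_value_bound[OF J])
      then have "\<bar>a j \<omega>\<bar> * \<bar>Phi j \<omega>\<bar> \<le> \<bar>a j \<omega>\<bar> * (\<Sum>k\<in>J. \<bar>a k \<omega>\<bar>)" by (intro mult_left_mono) auto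
      then show "norm (a j \<omega> * Phi j \<omega>) \<le> norm (\<Sum>k\<in>J. \<bar>a j \<omega> * a k \<omega>\<bar>)"
        by (simp add: abs_mult sum_distrib_left sum_nonneg)
    qed
  qed (use that in auto)
  have cross0: "expectation (\<lambda>\<omega>. a j \<omega> * Phi j \<omega>) = 0" if j: "j \<in> J" for j
  proof -
    have "expectation (\<lambda>\<omega>. a j \<omega> * PhiH j (\<lambda>i\<in>J. (U i \<omega>, a i \<omega>))) = 0"
    proof (rule integral_noise_against_rest_eq_0[OF J j ind centred[OF j] Phim[OF j]])
      show "PhiH j z = PhiH j z'" if "\<And>k. k \<noteq> j \<Longrightarrow> z k = z' k" "fst (z j) = fst (z' j)" for z z'
      proof -
        have "(\<lambda>i. fst (z i)) = (\<lambda>i. fst (z' i))" using that by metis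
        then show ?thesis unfolding PhiH_def using passage_value_cong[of J j "\<lambda>i. snd (z i)" "\<lambda>i. snd (z' i)"] that
          by metis
      qed
      show "\<bar>PhiH j z\<bar> \<le> (\<Sum>k\<in>J. \<bar>snd (z k)\<bar>)" for z
        unfolding PhiH_def by (rule passage_value_bound[OF J])
    qed (use cross_int[OF j] in \<open>auto simp: passage_restrict[OF j]\<close>)
    then show ?thesis by (simp add: passage_restrict[OF j])
  qed
  have pair0: "expectation (\<lambda>\<omega>. a j \<omega> * a k \<omega>) = (if j = k then expectation (\<lambda>\<omega>. (a j \<omega>)\<^sup>2) else 0)"
    if jk: "j \<in> J" "k \<in> J" for j k
  proof (cases "j = k")
    case False
    let ?H = "\<lambda>z :: nat \<Rightarrow> real \<times> real. snd (z k)"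
    have "expectation (\<lambda>\<omega>. a j \<omega> * ?H (\<lambda>i\<in>J. (U i \<omega>, a i \<omega>))) = 0"
    proof (rule integral_noise_against_rest_eq_0[OF J jk(1) ind centred[OF jk(1)]])
      show "\<bar>snd (z k)\<bar> \<le> (\<Sum>k\<in>J. \<bar>snd (z k)\<bar>)" for z :: "nat \<Rightarrow> real \<times> real"
        using jk J by (intro member_le_sum) auto
      show "integrable M (\<lambda>\<omega>. a j \<omega> * snd ((\<lambda>i\<in>J. (U i \<omega>, a i \<omega>)) k))"
        using prod_int'[OF jk] jk by simp
    qed (use False jk in auto)
    then show ?thesis using False jk by simp
  qed (simp add: power2_eq_square)
  have totint: "integrable M (\<lambda>\<omega>. (\<Sum>j\<in>J. a j \<omega>)\<^sup>2)"
    unfolding power2_eq_square sum_product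
    by (intro Bochner_Integration.integrable_sum) (rule prod_int')
  have "expectation (\<lambda>\<omega>. (\<Sum>j\<in>J. a j \<omega>)\<^sup>2) = (\<Sum>j\<in>J. \<Sum>k\<in>J. expectation (\<lambda>\<omega>. a j \<omega> * a k \<omega>))"
    unfolding power2_eq_square sum_product
    by (simp add: prod_int' Bochner_Integration.integral_sum Bochner_Integration.integrable_sum)
  also have "\<dots> = (\<Sum>j\<in>J. expectation (\<lambda>\<omega>. (a j \<omega>)\<^sup>2))"
    using J by (intro sum.cong refl) (simp add: pair0)
  finally have tot: "expectation (\<lambda>\<omega>. (\<Sum>j\<in>J. a j \<omega>)\<^sup>2) \<le> v" using v by simp
  define Bad where "Bad = {\<omega>\<in>space M. \<exists>i\<in>J. c \<le> \<bar>S i \<omega>\<bar>}"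
  have [measurable]: "S i \<in> borel_measurable M" if "i \<in> J" for i
    unfolding S_def prefix_sum_def prec_def using that by measurable
  have Bad [measurable]: "Bad \<in> sets M" unfolding Bad_def using J by measurable
  define D where "D \<omega> = (\<Sum>j\<in>J. a j \<omega>)\<^sup>2 - 2 * (\<Sum>j\<in>J. a j \<omega> * Phi j \<omega>)" for \<omega>
  have Dint: "integrable M D" unfolding D_def using totint cross_int by auto
  have ED: "expectation D \<le> v"
    unfolding D_def using totint cross_int cross0 tot by simp
  have "c\<^sup>2 * prob Bad = expectation (\<lambda>\<omega>. c\<^sup>2 * indicator Bad \<omega>)" by simp
  also have "\<dots> \<le> expectation D"
  proof (rule integral_mono[OF _ Dint])
    fix \<omega> assume "\<omega> \<in> space M"
    then have "indicator Bad \<omega> = (of_bool (\<exists>i\<in>J. c \<le> \<bar>S i \<omega>\<bar>) :: real)"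
      unfolding Bad_def by (auto simp: indicator_def)
    then show "c\<^sup>2 * indicator Bad \<omega> \<le> D \<omega>"
      using maximal_pathwise[OF J c, of "\<lambda>i. U i \<omega>" "\<lambda>i. a i \<omega>"] unfolding D_def Phi_def S_def by simp
  qed (use Bad in \<open>auto intro!: integrable_mult_right integrable_real_indicator simp: emeasure_eq_measure\<close>)
  finally have "prob Bad \<le> v / c\<^sup>2" using ED c by (simp add: field_simps)
  moreover have "\<bar>\<Sum>j | j \<in> J \<and> U j \<omega> \<le> t. a j \<omega>\<bar> < c" if "\<omega> \<in> space M - Bad" for \<omega> t
  proof (cases "{j\<in>J. U j \<omega> \<le> t} = {}")
    case True
    then show ?thesis using c by (simp only: True) simp
  next
    case False
    define T where "T = {j\<in>J. U j \<omega> \<le> t}"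
    have T: "finite T" "T \<noteq> {}" using False J by (auto simp: T_def)
    \<comment> \<open>The last index of the cut in the order \<open>prec\<close>.\<close>
    obtain i where i: "i \<in> T" "\<forall>j\<in>T. prec (\<lambda>i. U i \<omega>) j i \<or> j = i"
    proof -
      define m where "m = Max ((\<lambda>i. U i \<omega>) ` T)"
      define T' where "T' = {j\<in>T. U j \<omega> = m}"
      have "m \<in> (\<lambda>i. U i \<omega>) ` T" unfolding m_def using T by (intro Max_in) auto
      then have T': "finite T'" "T' \<noteq> {}" using T by (auto simp: T'_def)
      have 1: "Max T' \<in> T'" using T' by (rule Max_in)
      have "prec (\<lambda>i. U i \<omega>) j (Max T') \<or> j = Max T'" if "j \<in> T" for j
      proof -
        have "U j \<omega> \<le> m" unfolding m_def using T that by (intro Max_ge) auto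
        moreover have "j \<le> Max T'" if "U j \<omega> = m" using that \<open>j \<in> T\<close> T' by (intro Max_ge) (auto simp: T'_def)
        ultimately show ?thesis using 1 unfolding prec_def T'_def by force
      qed
      then show ?thesis using that[of "Max T'"] 1 by (auto simp: T'_def)
    qed
    have "S i \<omega> = (\<Sum>j\<in>T. a j \<omega>)"
      unfolding S_def prefix_sum_def
    proof (rule sum.mono_neutral_cong_right[OF J])
      show "T \<subseteq> J" by (auto simp: T_def)
      show "\<forall>j\<in>J - T. (if prec (\<lambda>i. U i \<omega>) j i \<or> j = i then a j \<omega> else 0) = 0"
        using i(1) unfolding T_def prec_def by auto
    qed (use i in auto)
    moreover have "\<bar>S i \<omega>\<bar> < c" using that i(1) unfolding Bad_def T_def by force
    ultimately show ?thesis unfolding T_def by simp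
  qed
  ultimately show ?thesis unfolding whp_def using Bad by blast
qed

end

section \<open>Counts and noise sums of a random design sample\<close>

lemma (in pair_prob_space) product_integral:
  fixes f :: "'a \<Rightarrow> real" and g :: "'b \<Rightarrow> real"
  assumes f: "integrable M1 f" and g: "integrable M2 g"
  shows "integrable (M1 \<Otimes>\<^sub>M M2) (\<lambda>p. f (fst p) * g (snd p))"
    and "(\<integral>p. f (fst p) * g (snd p) \<partial>(M1 \<Otimes>\<^sub>M M2)) = (\<integral>x. f x \<partial>M1) * (\<integral>y. g y \<partial>M2)"
proof -
  have [measurable]: "f \<in> borel_measurable M1" "g \<in> borel_measurable M2" using f g by auto
  have "integrable (M1 \<Otimes>\<^sub>M M2) (\<lambda>(x, y). f x * g y)"
    by (rule Fubini_integrable) (use f g in \<open>auto simp: abs_mult\<close>)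
  then show int: "integrable (M1 \<Otimes>\<^sub>M M2) (\<lambda>p. f (fst p) * g (snd p))" by (simp add: split_beta')
  show "(\<integral>p. f (fst p) * g (snd p) \<partial>(M1 \<Otimes>\<^sub>M M2)) = (\<integral>x. f x \<partial>M1) * (\<integral>y. g y \<partial>M2)"
    using integral_fst'[OF int] by simp
qed

text \<open>Errors enter as a sample from a law of their own, independent of the design, so that neither law
depends on the regression function.\<close>

locale regression_sample = prob_space M for M :: "'w measure" +
  fixes n :: nat and X e :: "nat \<Rightarrow> 'w \<Rightarrow> real" and \<mu> \<nu> :: "real measure" and s2 :: real
  assumes n: "1 \<le> n"
    and indep: "indep_vars (\<lambda>_. borel \<Otimes>\<^sub>M borel) (\<lambda>i \<omega>. (X i \<omega>, e i \<omega>)) {1..n}"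
    and law: "\<And>i. i \<in> {1..n} \<Longrightarrow> distr M (borel \<Otimes>\<^sub>M borel) (\<lambda>\<omega>. (X i \<omega>, e i \<omega>)) = \<mu> \<Otimes>\<^sub>M \<nu>"
    and mu: "prob_space \<mu>" "sets \<mu> = sets borel" and nu: "prob_space \<nu>" "sets \<nu> = sets borel"
    and nu_sq: "integrable \<nu> (\<lambda>y. y\<^sup>2)" and nu_mean: "(\<integral>y. y \<partial>\<nu>) = 0" and nu_var: "(\<integral>y. y\<^sup>2 \<partial>\<nu>) = s2"
begin

sublocale pp: pair_prob_space \<mu> \<nu>
  using mu nu by (simp add: pair_prob_space_def pair_sigma_finite_def prob_space_imp_sigma_finite)

lemmas [measurable_cong] = mu(2) nu(2)

lemma space_mu [simp]: "space \<mu> = UNIV" and space_nu [simp]: "space \<nu> = UNIV"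
  using mu(2) nu(2) sets_eq_imp_space_eq space_borel by blast+

lemma rv_pair: "i \<in> {1..n} \<Longrightarrow> random_variable (borel \<Otimes>\<^sub>M borel) (\<lambda>\<omega>. (X i \<omega>, e i \<omega>))"
  using indep unfolding indep_vars_def by auto

lemma nu_int: "integrable \<nu> (\<lambda>y. y)"
proof (rule Bochner_Integration.integrable_bound)
  show "integrable \<nu> (\<lambda>y. 1 + y\<^sup>2)" using nu_sq nu by (auto intro!: finite_measure.integrable_const prob_space.finite_measure)
  have "\<bar>y\<bar> \<le> 1 + y\<^sup>2" for y :: real
    using sum_squares_bound[of 1 "\<bar>y\<bar>"] by (simp add: power2_eq_square)
  then show "AE y in \<nu>. norm y \<le> norm (1 + y\<^sup>2)" by auto
qed simp

lemma s2_nonneg: "0 \<le> s2" unfolding nu_var[symmetric] by simp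

lemma integral_fst_mu:
  fixes h :: "real \<Rightarrow> real"
  assumes "integrable \<mu> h"
  shows "integrable (\<mu> \<Otimes>\<^sub>M \<nu>) (\<lambda>p. h (fst p))" "(\<integral>p. h (fst p) \<partial>(\<mu> \<Otimes>\<^sub>M \<nu>)) = (\<integral>x. h x \<partial>\<mu>)"
proof -
  have "integrable \<nu> (\<lambda>_. 1 :: real)" "measure \<nu> UNIV = 1" using pp.M2.prob_space by simp_all
  then show "integrable (\<mu> \<Otimes>\<^sub>M \<nu>) (\<lambda>p. h (fst p))" "(\<integral>p. h (fst p) \<partial>(\<mu> \<Otimes>\<^sub>M \<nu>)) = (\<integral>x. h x \<partial>\<mu>)"
    using pp.product_integral[OF assms, of "\<lambda>_. 1"] by simp_all
qed

lemma integral_snd_nu: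
  fixes h :: "real \<Rightarrow> real"
  assumes "integrable \<nu> h"
  shows "integrable (\<mu> \<Otimes>\<^sub>M \<nu>) (\<lambda>p. h (snd p))" "(\<integral>p. h (snd p) \<partial>(\<mu> \<Otimes>\<^sub>M \<nu>)) = (\<integral>x. h x \<partial>\<nu>)"
proof -
  have "integrable \<mu> (\<lambda>_. 1 :: real)" "measure \<mu> UNIV = 1" using pp.M1.prob_space by simp_all
  then show "integrable (\<mu> \<Otimes>\<^sub>M \<nu>) (\<lambda>p. h (snd p))" "(\<integral>p. h (snd p) \<partial>(\<mu> \<Otimes>\<^sub>M \<nu>)) = (\<integral>x. h x \<partial>\<nu>)"
    using pp.product_integral[OF _ assms, of "\<lambda>_. 1"] by simp_all
qed

lemma law_integral:
  fixes h :: "real \<times> real \<Rightarrow> real"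
  assumes i: "i \<in> {1..n}" and h: "h \<in> borel_measurable (borel \<Otimes>\<^sub>M borel)"
  shows "expectation (\<lambda>\<omega>. h (X i \<omega>, e i \<omega>)) = (\<integral>p. h p \<partial>(\<mu> \<Otimes>\<^sub>M \<nu>))"
    and "integrable (\<mu> \<Otimes>\<^sub>M \<nu>) h \<Longrightarrow> integrable M (\<lambda>\<omega>. h (X i \<omega>, e i \<omega>))"
  unfolding law[OF i, symmetric] using integral_distr[OF rv_pair[OF i] h] integrable_distr_eq[OF rv_pair[OF i] h]
  by auto

lemma whp_sum_Markov:
  fixes h :: "real \<times> real \<Rightarrow> real"
  assumes h: "h \<in> borel_measurable (borel \<Otimes>\<^sub>M borel)" "integrable (\<mu> \<Otimes>\<^sub>M \<nu>) h" "\<And>p. 0 \<le> h p"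
    and m: "real n * (\<integral>p. h p \<partial>(\<mu> \<Otimes>\<^sub>M \<nu>)) \<le> m" and c: "0 < c"
  shows "whp M (m / c) (\<lambda>\<omega>. (\<Sum>i=1..n. h (X i \<omega>, e i \<omega>)) < c)"
  by (rule whp_Markov) (use h m c in \<open>auto simp: law_integral sum_nonneg Bochner_Integration.integral_sum\<close>)

text \<open>This is the maximal inequality with all design points collapsed to one, so that there is a single cut.\<close>

lemma whp_sum_Chebyshev:
  fixes h :: "real \<times> real \<Rightarrow> real"
  assumes h: "h \<in> borel_measurable (borel \<Otimes>\<^sub>M borel)" "integrable (\<mu> \<Otimes>\<^sub>M \<nu>) (\<lambda>p. (h p)\<^sup>2)"
    and mean: "(\<integral>p. h p \<partial>(\<mu> \<Otimes>\<^sub>M \<nu>)) = 0"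
    and v: "real n * (\<integral>p. (h p)\<^sup>2 \<partial>(\<mu> \<Otimes>\<^sub>M \<nu>)) \<le> v" and c: "0 < c"
  shows "whp M (v / c\<^sup>2) (\<lambda>\<omega>. \<bar>\<Sum>i=1..n. h (X i \<omega>, e i \<omega>)\<bar> < c)"
proof -
  have "indep_vars (\<lambda>_. borel \<Otimes>\<^sub>M borel) (\<lambda>i \<omega>. (\<lambda>p. (0::real, h p)) (X i \<omega>, e i \<omega>)) {1..n}"
    by (rule indep_vars_compose2[OF indep]) (use h in auto)
  then have iv: "indep_vars (\<lambda>_. borel \<Otimes>\<^sub>M borel) (\<lambda>i \<omega>. (0::real, h (X i \<omega>, e i \<omega>))) {1..n}" by simp
  have "whp M (v / c\<^sup>2) (\<lambda>\<omega>. \<forall>t::real. \<bar>\<Sum>j | j \<in> {1..n} \<and> 0 \<le> t. h (X j \<omega>, e j \<omega>)\<bar> < c)"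
  proof (rule maximal_inequality_prefix[where U = "\<lambda>_ _. 0", OF _ iv])
    fix j and g :: "real \<Rightarrow> real" and C assume "j \<in> {1..n}"
    then show "expectation (\<lambda>\<omega>. h (X j \<omega>, e j \<omega>) * g 0) = 0"
      using law_integral(1)[of j h] h mean by simp
  next
    fix j assume "j \<in> {1..n}"
    then show "integrable M (\<lambda>\<omega>. (h (X j \<omega>, e j \<omega>))\<^sup>2)" using law_integral(2)[of j "\<lambda>p. (h p)\<^sup>2"] h by auto
  next
    have "expectation (\<lambda>\<omega>. (h (X j \<omega>, e j \<omega>))\<^sup>2) = (\<integral>p. (h p)\<^sup>2 \<partial>(\<mu> \<Otimes>\<^sub>M \<nu>))" if "j \<in> {1..n}" for j
      using law_integral(1)[OF that, of "\<lambda>p. (h p)\<^sup>2"] h by simp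
    then show "(\<Sum>j=1..n. expectation (\<lambda>\<omega>. (h (X j \<omega>, e j \<omega>))\<^sup>2)) \<le> v" using v by simp
  qed (use c in auto)
  then show ?thesis
  proof (rule whp_mono)
    fix \<omega> assume "\<forall>t::real. \<bar>\<Sum>j | j \<in> {1..n} \<and> 0 \<le> t. h (X j \<omega>, e j \<omega>)\<bar> < c"
    then have "\<bar>\<Sum>j | j \<in> {1..n} \<and> (0::real) \<le> 0. h (X j \<omega>, e j \<omega>)\<bar> < c" by blast
    moreover have "{j. j \<in> {1..n} \<and> (0::real) \<le> 0} = {1..n}" by auto
    ultimately show "\<bar>\<Sum>i=1..n. h (X i \<omega>, e i \<omega>)\<bar> < c" by metis
  qed simp
qed

definition hit :: "real set \<Rightarrow> 'w \<Rightarrow> nat set" where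
  "hit A \<omega> = {i\<in>{1..n}. X i \<omega> \<in> A}"

abbreviation count :: "real set \<Rightarrow> 'w \<Rightarrow> real" where
  "count A \<omega> \<equiv> real (card (hit A \<omega>))"

abbreviation noise :: "real set \<Rightarrow> 'w \<Rightarrow> real" where
  "noise A \<omega> \<equiv> (\<Sum>i\<in>hit A \<omega>. e i \<omega>)"

lemma finite_hit [simp]: "finite (hit A \<omega>)" and hit_mono: "A \<subseteq> B \<Longrightarrow> hit A \<omega> \<subseteq> hit B \<omega>"
  and hit_sub: "hit A \<omega> \<subseteq> {1..n}"
  unfolding hit_def by auto

lemma sum_hit: "(\<Sum>i\<in>hit A \<omega>. (f i :: real)) = (\<Sum>i=1..n. indicator A (X i \<omega>) * f i)"
  unfolding hit_def by (rule sum.mono_neutral_cong_left) auto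

lemma sum_hit_Un: "A \<inter> B = {} \<Longrightarrow> (\<Sum>i\<in>hit (A \<union> B) \<omega>. (f i :: real)) = (\<Sum>i\<in>hit A \<omega>. f i) + (\<Sum>i\<in>hit B \<omega>. f i)"
  unfolding sum_hit sum.distrib[symmetric] by (intro sum.cong) (auto simp: indicator_def)

lemma whp_hit_card:
  assumes A: "A \<in> sets borel" and p: "0 < measure \<mu> A"
  shows "whp M (4 / (real n * measure \<mu> A))
    (\<lambda>\<omega>. real n * measure \<mu> A / 2 \<le> count A \<omega> \<and> count A \<omega> \<le> 2 * (real n * measure \<mu> A))"
proof -
  let ?p = "measure \<mu> A"
  have [measurable]: "A \<in> sets borel" by fact
  have intA: "integrable (\<mu> \<Otimes>\<^sub>M \<nu>) (\<lambda>q. indicator A (fst q) :: real)"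
    and EA: "(\<integral>q. indicator A (fst q) \<partial>(\<mu> \<Otimes>\<^sub>M \<nu>)) = ?p"
  proof -
    have 1: "integrable \<mu> (indicator A :: real \<Rightarrow> real)" using A mu by (auto simp: pp.M1.emeasure_eq_measure)
    have 2: "integrable \<nu> (\<lambda>_. 1 :: real)" by simp
    have 3: "measure \<nu> UNIV = 1" using pp.M2.prob_space by simp
    show "integrable (\<mu> \<Otimes>\<^sub>M \<nu>) (\<lambda>q. indicator A (fst q) :: real)" "(\<integral>q. indicator A (fst q) \<partial>(\<mu> \<Otimes>\<^sub>M \<nu>)) = ?p"
      using pp.product_integral[OF 1 2] A mu 3 by auto
  qed
  have sq: "(indicator A x - ?p)\<^sup>2 = (1 - 2 * ?p) * indicator A x + ?p\<^sup>2" for x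
    by (auto simp: indicator_def power2_eq_square algebra_simps)
  have "whp M (real n * ?p / (real n * ?p / 2)\<^sup>2) (\<lambda>\<omega>. \<bar>\<Sum>i=1..n. (\<lambda>q. indicator A (fst q) - ?p) (X i \<omega>, e i \<omega>)\<bar> < real n * ?p / 2)"
  proof (rule whp_sum_Chebyshev)
    show "(\<integral>q. (indicator A (fst q) - ?p) \<partial>(\<mu> \<Otimes>\<^sub>M \<nu>)) = 0"
      using intA EA pp.P.prob_space by simp
    show "real n * (\<integral>q. (indicator A (fst q) - ?p)\<^sup>2 \<partial>(\<mu> \<Otimes>\<^sub>M \<nu>)) \<le> real n * ?p"
      unfolding sq using intA EA pp.P.prob_space by (intro mult_left_mono) (auto simp: power2_eq_square algebra_simps)
    show "integrable (\<mu> \<Otimes>\<^sub>M \<nu>) (\<lambda>q. (indicator A (fst q) - ?p)\<^sup>2)"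
      unfolding sq using intA by auto
    show "0 < real n * ?p / 2" using p n by simp
  qed measurable
  then show ?thesis
  proof (rule whp_mono)
    show "real n * ?p / (real n * ?p / 2)\<^sup>2 \<le> 4 / (real n * ?p)" using p n by (simp add: power2_eq_square field_simps)
    fix \<omega> assume "\<bar>\<Sum>i=1..n. (\<lambda>q. indicator A (fst q) - ?p) (X i \<omega>, e i \<omega>)\<bar> < real n * ?p / 2"
    moreover have "(\<Sum>i=1..n. indicator A (X i \<omega>)) = count A \<omega>"
      using sum_hit[of "\<lambda>_. 1" A \<omega>] by simp
    ultimately have "\<bar>count A \<omega> - real n * ?p\<bar> < real n * ?p / 2" by (simp add: sum_subtractf)
    then show "real n * measure \<mu> A / 2 \<le> count A \<omega> \<and> count A \<omega> \<le> 2 * (real n * measure \<mu> A)"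
      by linarith
  qed
qed

text \<open>The constant $2$ pays for writing a sum over a middle or an upper block as a difference of two
initial ones.  The bound scales with the mass of $A$; this is what makes noise near the cut small.\<close>

lemma whp_noise_sup:
  assumes A: "A \<in> sets borel" and c: "0 < c"
  shows "whp M (real n * s2 * measure \<mu> A / c\<^sup>2)
    (\<lambda>\<omega>. \<forall>s t. \<bar>noise (A \<inter> {s<..t}) \<omega>\<bar> < 2 * c \<and> \<bar>noise (A \<inter> {..t}) \<omega>\<bar> < 2 * c
      \<and> \<bar>noise (A \<inter> {s<..}) \<omega>\<bar> < 2 * c)"
proof -
  have [measurable]: "A \<in> sets borel" by fact
  define a where "a i \<omega> = indicator A (X i \<omega>) * e i \<omega>" for i \<omega>
  have "indep_vars (\<lambda>_. borel \<Otimes>\<^sub>M borel) (\<lambda>i \<omega>. (\<lambda>(x, y). (x, indicator A x * y)) (X i \<omega>, e i \<omega>)) {1..n}"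
    by (rule indep_vars_compose2[OF indep]) auto
  then have iv: "indep_vars (\<lambda>_. borel \<Otimes>\<^sub>M borel) (\<lambda>i \<omega>. (X i \<omega>, a i \<omega>)) {1..n}"
    by (simp add: a_def)
  have Ai: "integrable \<mu> (indicator A :: real \<Rightarrow> real)" using A mu by (auto simp: pp.M1.emeasure_eq_measure)
  have "whp M (real n * s2 * measure \<mu> A / c\<^sup>2) (\<lambda>\<omega>. \<forall>t. \<bar>\<Sum>j | j \<in> {1..n} \<and> X j \<omega> \<le> t. a j \<omega>\<bar> < c)"
  proof (rule maximal_inequality_prefix[OF _ iv _ _ c])
    fix j and h :: "real \<Rightarrow> real" and C
    assume j: "j \<in> {1..n}" and h [measurable]: "h \<in> borel_measurable borel" and C: "\<And>x. \<bar>h x\<bar> \<le> C"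
    have 1: "integrable \<mu> (\<lambda>x. indicator A x * h x)"
      by (rule pp.M1.integrable_const_bound[where B = C])
        (use C order_trans[OF abs_ge_zero C] in \<open>auto simp: indicator_def\<close>)
    show "expectation (\<lambda>\<omega>. a j \<omega> * h (X j \<omega>)) = 0"
      using law_integral(1)[OF j, of "\<lambda>q. (indicator A (fst q) * h (fst q)) * snd q"]
        pp.product_integral(2)[OF 1 nu_int] nu_mean by (simp add: a_def ac_simps)
  next
    have *: "(indicator A x * y)\<^sup>2 = indicator A x * y\<^sup>2" for x y :: real by (simp add: indicator_def)
    fix j assume j: "j \<in> {1..n}"
    show "integrable M (\<lambda>\<omega>. (a j \<omega>)\<^sup>2)" unfolding a_def *
      using law_integral(2)[OF j, of "\<lambda>q. indicator A (fst q) * (snd q)\<^sup>2"] pp.product_integral(1)[OF Ai nu_sq] by simp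
  next
    have *: "(indicator A x * y)\<^sup>2 = indicator A x * y\<^sup>2" for x y :: real by (simp add: indicator_def)
    have "expectation (\<lambda>\<omega>. (a j \<omega>)\<^sup>2) = measure \<mu> A * s2" if j: "j \<in> {1..n}" for j
      unfolding a_def *
      using law_integral(1)[OF j, of "\<lambda>q. indicator A (fst q) * (snd q)\<^sup>2"] pp.product_integral(2)[OF Ai nu_sq] nu_var by simp
    then show "(\<Sum>j=1..n. expectation (\<lambda>\<omega>. (a j \<omega>)\<^sup>2)) \<le> real n * s2 * measure \<mu> A" by simp
  qed auto
  then show ?thesis
  proof (rule whp_mono)
    fix \<omega> assume *: "\<forall>t. \<bar>\<Sum>j | j \<in> {1..n} \<and> X j \<omega> \<le> t. a j \<omega>\<bar> < c"
    have cut: "\<bar>noise (A \<inter> {..t}) \<omega>\<bar> < c" for t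
    proof -
      have "noise (A \<inter> {..t}) \<omega> = (\<Sum>j | j \<in> {1..n} \<and> X j \<omega> \<le> t. a j \<omega>)"
        unfolding a_def hit_def by (rule sum.mono_neutral_cong_left) (auto simp: indicator_def)
      then show ?thesis using * by simp
    qed
    have all: "\<bar>noise A \<omega>\<bar> < c"
    proof -
      define t where "t = Max (insert 0 ((\<lambda>i. X i \<omega>) ` {1..n}))"
      have "hit (A \<inter> {..t}) \<omega> = hit A \<omega>" unfolding hit_def t_def by (auto intro!: Max_ge)
      then show ?thesis using cut[of t] by simp
    qed
    have up: "\<bar>noise (A \<inter> {s<..}) \<omega>\<bar> < 2 * c" for s
    proof -
      have "A = (A \<inter> {..s}) \<union> (A \<inter> {s<..})" by auto
      then have "noise A \<omega> = noise (A \<inter> {..s}) \<omega> + noise (A \<inter> {s<..}) \<omega>"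
        using sum_hit_Un[of "A \<inter> {..s}" "A \<inter> {s<..}"] by fastforce
      then show ?thesis using all cut[of s] by linarith
    qed
    have mid: "\<bar>noise (A \<inter> {s<..t}) \<omega>\<bar> < 2 * c" for s t
    proof (cases "s \<le> t")
      case True
      then have "A \<inter> {..t} = (A \<inter> {..s}) \<union> (A \<inter> {s<..t})" by auto
      then have "noise (A \<inter> {..t}) \<omega> = noise (A \<inter> {..s}) \<omega> + noise (A \<inter> {s<..t}) \<omega>"
        using sum_hit_Un[of "A \<inter> {..s}" "A \<inter> {s<..t}"] by fastforce
      then show ?thesis using cut[of t] cut[of s] by linarith
    qed (use c in \<open>simp add: hit_def\<close>)
    show "\<forall>s t. \<bar>noise (A \<inter> {s<..t}) \<omega>\<bar> < 2 * c \<and> \<bar>noise (A \<inter> {..t}) \<omega>\<bar> < 2 * c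
      \<and> \<bar>noise (A \<inter> {s<..}) \<omega>\<bar> < 2 * c"
      using mid up cut c by (smt (verit))
  qed simp
qed

end

section \<open>Consistency of the fitted cut\<close>

lemma sum_sq_shift:
  fixes y :: "nat \<Rightarrow> real"
  assumes "finite J"
  shows "(\<Sum>i\<in>J. (y i - a)\<^sup>2) - (\<Sum>i\<in>J. (y i - p)\<^sup>2) = real (card J) * (a - p)\<^sup>2 - 2 * (a - p) * (\<Sum>i\<in>J. y i - p)"
proof -
  have "(y i - a)\<^sup>2 - (y i - p)\<^sup>2 = (a - p)\<^sup>2 - 2 * (a - p) * (y i - p)" for i
    by (simp add: power2_eq_square algebra_simps)
  then show ?thesis by (simp add: sum_subtractf[symmetric] sum_distrib_left) (simp add: sum_subtractf)
qed

text \<open>One constant cannot fit two blocks whose levels differ by $|p - q|$: since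
$(a - p)^2 + (a - q)^2 \ge (p - q)^2 / 2$, using it costs a multiple of the block size, from which
the linear terms take away only a part of order $r^2$.\<close>

lemma two_level_gain:
  fixes y :: "nat \<Rightarrow> real"
  assumes fin: "finite J1" "finite J2" "finite J3" and disj: "J1 \<inter> J2 = {}" "J2 \<inter> J3 = {}"
    and c: "0 < c" "0 < N" "c * N \<le> real (card J1)" "c * N \<le> real (card J2)"
    and dev: "\<bar>\<Sum>i\<in>J1. y i - p\<bar> \<le> r * N" "\<bar>\<Sum>i\<in>J2. y i - q\<bar> \<le> r * N"
    and le: "(\<Sum>i\<in>J1 \<union> J2. (y i - a)\<^sup>2) + (\<Sum>i\<in>J3. (y i - b)\<^sup>2)
           \<le> (\<Sum>i\<in>J1. (y i - p)\<^sup>2) + (\<Sum>i\<in>J2 \<union> J3. (y i - q)\<^sup>2)"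
  shows "N * (c * (p - q)\<^sup>2 / 4 - 4 * r\<^sup>2 / c) \<le> (\<Sum>i\<in>J3. (y i - q)\<^sup>2) - (\<Sum>i\<in>J3. (y i - b)\<^sup>2)"
proof -
  have part: "N * (c / 2 * v\<^sup>2 - 2 * r\<^sup>2 / c) \<le> m * v\<^sup>2 - 2 * v * s"
    if "c * N \<le> m" "\<bar>s\<bar> \<le> r * N" for v m s :: real
  proof -
    have "2 * v * s \<le> 2 * \<bar>v\<bar> * \<bar>s\<bar>" by (metis abs_ge_self abs_mult abs_numeral)
    also have "\<dots> \<le> 2 * \<bar>v\<bar> * (r * N)" using that by (intro mult_left_mono) auto
    also have "\<dots> \<le> N * (c / 2 * v\<^sup>2 + 2 * r\<^sup>2 / c)"
    proof -
      have "0 \<le> (c * \<bar>v\<bar> - 2 * r)\<^sup>2 / (2 * c)" using c by simp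
      also have "\<dots> = c / 2 * v\<^sup>2 + 2 * r\<^sup>2 / c - 2 * \<bar>v\<bar> * r"
        using c by (simp add: power2_eq_square field_simps)
      finally have "N * (2 * \<bar>v\<bar> * r) \<le> N * (c / 2 * v\<^sup>2 + 2 * r\<^sup>2 / c)" using c by (intro mult_left_mono) auto
      then show ?thesis by (simp add: ac_simps)
    qed
    finally have 1: "2 * v * s \<le> N * (c / 2 * v\<^sup>2 + 2 * r\<^sup>2 / c)" .
    have "c * N * v\<^sup>2 \<le> m * v\<^sup>2" using that by (intro mult_right_mono) auto
    then show ?thesis using 1 by (simp add: algebra_simps)
  qed
  have "N * (c / 2 * (a - p)\<^sup>2 - 2 * r\<^sup>2 / c) \<le> (\<Sum>i\<in>J1. (y i - a)\<^sup>2) - (\<Sum>i\<in>J1. (y i - p)\<^sup>2)"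
    unfolding sum_sq_shift[OF fin(1)] using part[OF c(3) dev(1)] .
  moreover have "N * (c / 2 * (a - q)\<^sup>2 - 2 * r\<^sup>2 / c) \<le> (\<Sum>i\<in>J2. (y i - a)\<^sup>2) - (\<Sum>i\<in>J2. (y i - q)\<^sup>2)"
    unfolding sum_sq_shift[OF fin(2)] using part[OF c(4) dev(2)] .
  moreover have "N * (c * (p - q)\<^sup>2 / 4 - 4 * r\<^sup>2 / c)
      \<le> N * (c / 2 * (a - p)\<^sup>2 - 2 * r\<^sup>2 / c) + N * (c / 2 * (a - q)\<^sup>2 - 2 * r\<^sup>2 / c)"
  proof -
    have "0 \<le> (2 * a - p - q)\<^sup>2" by simp
    then have "(p - q)\<^sup>2 \<le> 2 * ((a - p)\<^sup>2 + (a - q)\<^sup>2)" by (simp add: power2_eq_square algebra_simps)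
    then have "N * c / 4 * (p - q)\<^sup>2 \<le> N * c / 4 * (2 * ((a - p)\<^sup>2 + (a - q)\<^sup>2))" using c by (intro mult_left_mono) auto
    moreover have "N * (c * (p - q)\<^sup>2 / 4 - 4 * r\<^sup>2 / c) = N * c / 4 * (p - q)\<^sup>2 - 2 * (N * (2 * r\<^sup>2 / c))"
      by (simp add: algebra_simps)
    moreover have "N * (c / 2 * (a - p)\<^sup>2 - 2 * r\<^sup>2 / c) + N * (c / 2 * (a - q)\<^sup>2 - 2 * r\<^sup>2 / c)
        = N * c / 4 * (2 * ((a - p)\<^sup>2 + (a - q)\<^sup>2)) - 2 * (N * (2 * r\<^sup>2 / c))"
      by (simp add: algebra_simps)
    ultimately show ?thesis by linarith
  qed
  moreover have "(\<Sum>i\<in>J1 \<union> J2. (y i - a)\<^sup>2) = (\<Sum>i\<in>J1. (y i - a)\<^sup>2) + (\<Sum>i\<in>J2. (y i - a)\<^sup>2)"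
    "(\<Sum>i\<in>J2 \<union> J3. (y i - q)\<^sup>2) = (\<Sum>i\<in>J2. (y i - q)\<^sup>2) + (\<Sum>i\<in>J3. (y i - q)\<^sup>2)"
    using fin disj by (auto intro!: sum.union_disjoint)
  ultimately show ?thesis using le by linarith
qed

text \<open>Refitting the level of a block that is not too small gains little, because the gain is the square of
the deviation sum divided by the block size.\<close>

lemma refit_loss_large:
  fixes y :: "nat \<Rightarrow> real"
  assumes "finite J" "0 < z" "0 < N" "z * N \<le> real (card J)" "\<bar>\<Sum>i\<in>J. y i - q\<bar> \<le> r * N"
  shows "(\<Sum>i\<in>J. (y i - q)\<^sup>2) - (\<Sum>i\<in>J. (y i - b)\<^sup>2) \<le> N * (r\<^sup>2 / z)"
proof -
  define v where "v = b - q"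
  define s where "s = (\<Sum>i\<in>J. y i - q)"
  have "2 * v * s \<le> 2 * \<bar>v\<bar> * \<bar>s\<bar>" by (metis abs_ge_self abs_mult abs_numeral)
  also have "\<dots> \<le> 2 * \<bar>v\<bar> * (r * N)" using assms unfolding s_def by (intro mult_left_mono) auto
  also have "\<dots> \<le> N * (z * v\<^sup>2 + r\<^sup>2 / z)"
  proof -
    have "0 \<le> (z * \<bar>v\<bar> - r)\<^sup>2 / z" using assms by simp
    also have "\<dots> = z * v\<^sup>2 + r\<^sup>2 / z - 2 * \<bar>v\<bar> * r"
      using assms by (simp add: power2_eq_square field_simps)
    finally have "N * (2 * \<bar>v\<bar> * r) \<le> N * (z * v\<^sup>2 + r\<^sup>2 / z)" using assms by (intro mult_left_mono) auto
    then show ?thesis by (simp add: ac_simps)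
  qed
  finally have 1: "2 * v * s \<le> N * (z * v\<^sup>2 + r\<^sup>2 / z)" .
  have "z * N * v\<^sup>2 \<le> real (card J) * v\<^sup>2" using assms by (intro mult_right_mono) auto
  then show ?thesis using 1 sum_sq_shift[OF assms(1), of y b q] unfolding v_def[symmetric] s_def[symmetric]
    by (simp add: algebra_simps)
qed

context regression_sample
begin

definition rss :: "(real \<Rightarrow> real) \<Rightarrow> real \<Rightarrow> real \<Rightarrow> real \<Rightarrow> 'w \<Rightarrow> real" where
  "rss g t l u \<omega> = (\<Sum>i\<in>hit {..t} \<omega>. (g (X i \<omega>) + e i \<omega> - l)\<^sup>2)
               + (\<Sum>i\<in>hit {t<..} \<omega>. (g (X i \<omega>) + e i \<omega> - u)\<^sup>2)"

end

locale stump_fit = regression_sample M n X e \<mu> \<nu> s2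
  for M :: "'w measure" and n X e \<mu> \<nu> s2 +
  fixes g :: "real \<Rightarrow> real" and th lo up :: "'w \<Rightarrow> real"
  assumes g_mono: "mono g"
    and fit_range: "\<And>\<omega>. \<omega> \<in> space M \<Longrightarrow> th \<omega> \<in> {0..1}"
    and fit_min: "\<And>\<omega> t l u. \<omega> \<in> space M \<Longrightarrow> t \<in> {0..1} \<Longrightarrow> rss g (th \<omega>) (lo \<omega>) (up \<omega>) \<omega> \<le> rss g t l u \<omega>"
begin

lemma g_meas [measurable]: "g \<in> borel_measurable borel"
  by (rule borel_measurable_mono[OF g_mono])

text \<open>If the cut misses $\theta_0$ by more than $\eta$, say to the right, then $J_1 = (-\infty, \theta_0]$
and $J_2 = (\theta_0, \hat\theta]$ share one level, and two_level_gain applies.  The remaining block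
$J_3$ cannot make up for it.  If it has at least $\zeta n$ observations, refit_loss_large applies.
Otherwise its whole sum of squares is small: errors below $T$ contribute little because
there are few observations, and the larger ones are controlled by their second moment.\<close>

lemma fit_consistent:
  fixes th0 l0 u0 :: real
  defines "s0 \<equiv> (\<lambda>x. if x \<le> th0 then l0 else u0)"
  assumes th0: "th0 \<in> {0..1}" and G: "\<And>x. \<bar>g x - l0\<bar> \<le> G" "\<And>x. \<bar>g x - u0\<bar> \<le> G"
    and q: "0 < q" "q \<le> measure \<mu> {th0 - \<eta><..th0}" "q \<le> measure \<mu> {th0<..th0 + \<eta>}"
    and k: "(\<integral>x. \<bar>g x - s0 x\<bar> \<partial>\<mu>) \<le> \<kappa>"
    and tail: "(\<integral>y. indicator {y. T < \<bar>y\<bar>} y * y\<^sup>2 \<partial>\<nu>) \<le> \<tau>'"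
    and pos: "0 < \<rho>" "0 < \<zeta>" "0 < \<tau>" "0 \<le> T" "0 \<le> \<eta>"
    and small: "8 * (2 * \<rho>)\<^sup>2 / q + (2 * \<rho>)\<^sup>2 / \<zeta> + (2 * (G\<^sup>2 + T\<^sup>2) * \<zeta> + 2 * \<tau>) < q * (u0 - l0)\<^sup>2 / 8"
  shows "whp M (8 / (real n * q) + 4 * s2 / (\<rho>\<^sup>2 * real n) + \<kappa> / \<rho> + \<tau>' / \<tau>) (\<lambda>\<omega>. \<bar>th \<omega> - th0\<bar> \<le> \<eta>)"
proof -
  define Y where "Y i \<omega> = g (X i \<omega>) + e i \<omega>" for i \<omega>
  define N where "N = real n"
  have N: "0 < N" using n by (simp add: N_def)
  have [measurable]: "s0 \<in> borel_measurable borel" unfolding s0_def by measurable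
  have gs: "\<bar>g x - s0 x\<bar> \<le> G" for x unfolding s0_def using G by auto
  have int1: "integrable \<mu> (\<lambda>x. \<bar>g x - s0 x\<bar>)"
    by (rule pp.M1.integrable_const_bound[where B = G]) (use gs in auto)
  have W1: "whp M (N * \<kappa> / (\<rho> * N)) (\<lambda>\<omega>. (\<Sum>i=1..n. (\<lambda>p. \<bar>g (fst p) - s0 (fst p)\<bar>) (X i \<omega>, e i \<omega>)) < \<rho> * N)"
    by (rule whp_sum_Markov) (use integral_fst_mu[OF int1] k pos N in \<open>auto simp: N_def intro!: mult_left_mono\<close>)
  have int2: "integrable \<nu> (\<lambda>y. indicator {y. T < \<bar>y\<bar>} y * y\<^sup>2)"
    by (rule Bochner_Integration.integrable_bound[OF nu_sq]) (auto simp: indicator_def)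
  have W2: "whp M (N * \<tau>' / (\<tau> * N)) (\<lambda>\<omega>. (\<Sum>i=1..n. (\<lambda>p. indicator {y. T < \<bar>y\<bar>} (snd p) * (snd p)\<^sup>2) (X i \<omega>, e i \<omega>)) < \<tau> * N)"
    by (rule whp_sum_Markov) (use integral_snd_nu[OF int2] tail pos N in \<open>auto simp: N_def intro!: mult_left_mono\<close>)
  have W3: "whp M (real n * s2 * measure \<mu> UNIV / (\<rho> * N / 2)\<^sup>2)
    (\<lambda>\<omega>. \<forall>s t. \<bar>noise (UNIV \<inter> {s<..t}) \<omega>\<bar> < 2 * (\<rho> * N / 2) \<and> \<bar>noise (UNIV \<inter> {..t}) \<omega>\<bar> < 2 * (\<rho> * N / 2)
      \<and> \<bar>noise (UNIV \<inter> {s<..}) \<omega>\<bar> < 2 * (\<rho> * N / 2))"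
    by (rule whp_noise_sup) (use pos N in auto)
  have cnt: "whp M (4 / (N * q)) (\<lambda>\<omega>. q / 2 * N \<le> count A \<omega>)"
    if "A \<in> sets borel" "q \<le> measure \<mu> A" for A
  proof (rule whp_mono[OF whp_hit_card])
    show "A \<in> sets borel" "0 < measure \<mu> A" using that q by auto
    show "4 / (real n * measure \<mu> A) \<le> 4 / (N * q)" unfolding N_def using that q n
      by (intro divide_left_mono mult_left_mono mult_pos_pos) auto
    have "q / 2 * N \<le> real n * measure \<mu> A / 2" using that N by (simp add: N_def field_simps)
    then show "real n * measure \<mu> A / 2 \<le> count A \<omega> \<and> count A \<omega> \<le> 2 * (real n * measure \<mu> A)
      \<Longrightarrow> q / 2 * N \<le> count A \<omega>" for \<omega> by linarith
  qed
  define good where "good \<omega> \<longleftrightarrow> (\<Sum>i=1..n. (\<lambda>p. \<bar>g (fst p) - s0 (fst p)\<bar>) (X i \<omega>, e i \<omega>)) < \<rho> * N \<and>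
       (\<Sum>i=1..n. (\<lambda>p. indicator {y. T < \<bar>y\<bar>} (snd p) * (snd p)\<^sup>2) (X i \<omega>, e i \<omega>)) < \<tau> * N \<and>
       (\<forall>s t. \<bar>noise (UNIV \<inter> {s<..t}) \<omega>\<bar> < 2 * (\<rho> * N / 2) \<and> \<bar>noise (UNIV \<inter> {..t}) \<omega>\<bar> < 2 * (\<rho> * N / 2)
      \<and> \<bar>noise (UNIV \<inter> {s<..}) \<omega>\<bar> < 2 * (\<rho> * N / 2)) \<and>
      q / 2 * N \<le> count {th0 - \<eta><..th0} \<omega> \<and> q / 2 * N \<le> count {th0<..th0 + \<eta>} \<omega>" for \<omega>
  have all: "whp M (N * \<kappa> / (\<rho> * N) + (N * \<tau>' / (\<tau> * N) + (real n * s2 * measure \<mu> UNIV / (\<rho> * N / 2)\<^sup>2 + (4 / (N * q) + 4 / (N * q)))))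
     good"
    unfolding good_def using q by (intro whp_conj W1 W2 W3 cnt) auto
  then show ?thesis
  proof (rule whp_mono)
    have "measure \<mu> UNIV = 1" using pp.M1.prob_space by simp
    then show "N * \<kappa> / (\<rho> * N) + (N * \<tau>' / (\<tau> * N) + (real n * s2 * measure \<mu> UNIV / (\<rho> * N / 2)\<^sup>2 + (4 / (N * q) + 4 / (N * q))))
      \<le> 8 / (real n * q) + 4 * s2 / (\<rho>\<^sup>2 * real n) + \<kappa> / \<rho> + \<tau>' / \<tau>"
      using N pos q unfolding N_def by (simp add: field_simps power2_eq_square)
  next
    fix \<omega> assume \<omega>: "\<omega> \<in> space M"
    assume "good \<omega>"
    then have bias: "(\<Sum>i=1..n. \<bar>g (X i \<omega>) - s0 (X i \<omega>)\<bar>) < \<rho> * N"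
      and tails: "(\<Sum>i=1..n. indicator {y. T < \<bar>y\<bar>} (e i \<omega>) * (e i \<omega>)\<^sup>2) < \<tau> * N"
      and noise: "\<And>s t. \<bar>noise {s<..t} \<omega>\<bar> < \<rho> * N" "\<And>t. \<bar>noise {..t} \<omega>\<bar> < \<rho> * N"
         "\<And>s. \<bar>noise {s<..} \<omega>\<bar> < \<rho> * N"
      and c1: "q / 2 * N \<le> count {th0 - \<eta><..th0} \<omega>" and c2: "q / 2 * N \<le> count {th0<..th0 + \<eta>} \<omega>"
      unfolding good_def by simp_all
    have dev: "\<bar>\<Sum>i\<in>hit A \<omega>. Y i \<omega> - p\<bar> \<le> 2 * \<rho> * N"
      if "\<bar>noise A \<omega>\<bar> < \<rho> * N" "\<And>x. x \<in> A \<Longrightarrow> s0 x = p" for A p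
    proof -
      have "(\<Sum>i\<in>hit A \<omega>. Y i \<omega> - p) = noise A \<omega> + (\<Sum>i\<in>hit A \<omega>. g (X i \<omega>) - s0 (X i \<omega>))"
        unfolding sum.distrib[symmetric] Y_def using that(2) by (intro sum.cong) (auto simp: hit_def)
      moreover have "\<bar>\<Sum>i\<in>hit A \<omega>. g (X i \<omega>) - s0 (X i \<omega>)\<bar> \<le> (\<Sum>i=1..n. \<bar>g (X i \<omega>) - s0 (X i \<omega>)\<bar>)"
        by (rule order_trans[OF sum_abs]) (intro sum_mono2, use hit_sub in auto)
      ultimately show ?thesis using that(1) bias by linarith
    qed
    \<comment> \<open>Cuts on the right and on the left of the jump differ only in the roles of the blocks.\<close>
    have contra: False
      if disj: "J1 \<inter> J2 = {}" "J2 \<inter> J3 = {}" and J: "J1 = hit A1 \<omega>" "J2 = hit A2 \<omega>" "J3 = hit A3 \<omega>"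
        and card: "q / 2 * N \<le> real (card J1)" "q / 2 * N \<le> real (card J2)"
        and noi: "\<bar>\<Sum>i\<in>J1. e i \<omega>\<bar> < \<rho> * N" "\<bar>\<Sum>i\<in>J2. e i \<omega>\<bar> < \<rho> * N" "\<bar>\<Sum>i\<in>J3. e i \<omega>\<bar> < \<rho> * N"
        and s0: "\<And>x. x \<in> A1 \<Longrightarrow> s0 x = p" "\<And>x. x \<in> A2 \<union> A3 \<Longrightarrow> s0 x = p'"
        and pp': "(p - p')\<^sup>2 = (u0 - l0)\<^sup>2" and Gp: "\<And>x. \<bar>g x - p'\<bar> \<le> G"
        and le: "(\<Sum>i\<in>J1 \<union> J2. (Y i \<omega> - a)\<^sup>2) + (\<Sum>i\<in>J3. (Y i \<omega> - b)\<^sup>2)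
           \<le> (\<Sum>i\<in>J1. (Y i \<omega> - p)\<^sup>2) + (\<Sum>i\<in>J2 \<union> J3. (Y i \<omega> - p')\<^sup>2)" for J1 J2 J3 A1 A2 A3 p p' a b
    proof -
      have fin: "finite J1" "finite J2" "finite J3" using J by auto
      have d: "\<bar>\<Sum>i\<in>J1. Y i \<omega> - p\<bar> \<le> 2 * \<rho> * N" "\<bar>\<Sum>i\<in>J2. Y i \<omega> - p'\<bar> \<le> 2 * \<rho> * N" "\<bar>\<Sum>i\<in>J3. Y i \<omega> - p'\<bar> \<le> 2 * \<rho> * N"
        unfolding J by (rule dev; use J noi s0 in auto)+
      have "N * (q / 2 * (p - p')\<^sup>2 / 4 - 4 * (2 * \<rho>)\<^sup>2 / (q / 2)) \<le> (\<Sum>i\<in>J3. (Y i \<omega> - p')\<^sup>2) - (\<Sum>i\<in>J3. (Y i \<omega> - b)\<^sup>2)"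
        by (rule two_level_gain[OF fin disj _ N card d(1,2) le]) (use q in auto)
      then have gain: "N * (q * (u0 - l0)\<^sup>2 / 8 - 8 * (2 * \<rho>)\<^sup>2 / q) \<le> (\<Sum>i\<in>J3. (Y i \<omega> - p')\<^sup>2) - (\<Sum>i\<in>J3. (Y i \<omega> - b)\<^sup>2)"
        unfolding pp' by (simp add: mult.assoc)
      have "(\<Sum>i\<in>J3. (Y i \<omega> - p')\<^sup>2) - (\<Sum>i\<in>J3. (Y i \<omega> - b)\<^sup>2)
          \<le> N * ((2 * \<rho>)\<^sup>2 / \<zeta> + (2 * (G\<^sup>2 + T\<^sup>2) * \<zeta> + 2 * \<tau>))"
      proof (cases "\<zeta> * N \<le> real (card J3)")
        case True
        have "(\<Sum>i\<in>J3. (Y i \<omega> - p')\<^sup>2) - (\<Sum>i\<in>J3. (Y i \<omega> - b)\<^sup>2) \<le> N * ((2 * \<rho>)\<^sup>2 / \<zeta>)"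
          by (rule refit_loss_large[OF fin(3) pos(2) N True d(3)])
        also have "\<dots> \<le> N * ((2 * \<rho>)\<^sup>2 / \<zeta> + (2 * (G\<^sup>2 + T\<^sup>2) * \<zeta> + 2 * \<tau>))"
          using N pos by (intro mult_left_mono) auto
        finally show ?thesis .
      next
        case False
        have one: "(Y i \<omega> - p')\<^sup>2 \<le> 2 * (G\<^sup>2 + T\<^sup>2) + 2 * (indicator {y. T < \<bar>y\<bar>} (e i \<omega>) * (e i \<omega>)\<^sup>2)" for i
        proof -
          have "0 \<le> (g (X i \<omega>) - p' - e i \<omega>)\<^sup>2" by simp
          then have "(Y i \<omega> - p')\<^sup>2 \<le> 2 * (g (X i \<omega>) - p')\<^sup>2 + 2 * (e i \<omega>)\<^sup>2"
            unfolding Y_def by (simp add: power2_eq_square algebra_simps)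
          moreover have "(g (X i \<omega>) - p')\<^sup>2 \<le> G\<^sup>2" using Gp by (rule abs_le_square_iff[THEN iffD1, OF order_trans, OF _ abs_ge_self])
          moreover have "(e i \<omega>)\<^sup>2 \<le> T\<^sup>2 + indicator {y. T < \<bar>y\<bar>} (e i \<omega>) * (e i \<omega>)\<^sup>2"
          proof (cases "T < \<bar>e i \<omega>\<bar>")
            case False
            then have "(e i \<omega>)\<^sup>2 \<le> T\<^sup>2" using pos by (metis abs_le_square_iff abs_of_nonneg not_le)
            then show ?thesis using False by simp
          qed simp
          moreover have "x \<le> 2 * (B + D) + 2 * I" if "x \<le> 2 * b + 2 * d" "b \<le> B" "d \<le> D + I" for x b d B D I :: real
            using that by simp
          ultimately show ?thesis by blast
        qed
        have "(\<Sum>i\<in>J3. (Y i \<omega> - p')\<^sup>2) \<le> (\<Sum>i\<in>J3. 2 * (G\<^sup>2 + T\<^sup>2) + 2 * (indicator {y. T < \<bar>y\<bar>} (e i \<omega>) * (e i \<omega>)\<^sup>2))"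
          by (intro sum_mono one)
        also have "\<dots> = real (card J3) * (2 * (G\<^sup>2 + T\<^sup>2)) + 2 * (\<Sum>i\<in>J3. indicator {y. T < \<bar>y\<bar>} (e i \<omega>) * (e i \<omega>)\<^sup>2)"
          by (simp add: sum.distrib sum_distrib_left)
        also have "\<dots> \<le> \<zeta> * N * (2 * (G\<^sup>2 + T\<^sup>2)) + 2 * (\<tau> * N)"
        proof (intro add_mono mult_mono)
          show "real (card J3) \<le> \<zeta> * N" using False by simp
          have "(\<Sum>i\<in>J3. indicator {y. T < \<bar>y\<bar>} (e i \<omega>) * (e i \<omega>)\<^sup>2) \<le> (\<Sum>i=1..n. indicator {y. T < \<bar>y\<bar>} (e i \<omega>) * (e i \<omega>)\<^sup>2)"
            by (intro sum_mono2) (use J hit_sub in auto)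
          then show "(\<Sum>i\<in>J3. indicator {y. T < \<bar>y\<bar>} (e i \<omega>) * (e i \<omega>)\<^sup>2) \<le> \<tau> * N" using tails by simp
        qed (use pos N in \<open>auto simp: sum_nonneg\<close>)
        also have "\<dots> \<le> N * ((2 * \<rho>)\<^sup>2 / \<zeta> + (2 * (G\<^sup>2 + T\<^sup>2) * \<zeta> + 2 * \<tau>))"
          using N pos by (simp add: algebra_simps)
        finally show ?thesis using sum_nonneg[of J3 "\<lambda>i. (Y i \<omega> - b)\<^sup>2"] by simp
      qed
      then have "N * (q * (u0 - l0)\<^sup>2 / 8 - 8 * (2 * \<rho>)\<^sup>2 / q) \<le> N * ((2 * \<rho>)\<^sup>2 / \<zeta> + (2 * (G\<^sup>2 + T\<^sup>2) * \<zeta> + 2 * \<tau>))"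
        using gain by linarith
      then show False using N small by (subst (asm) mult_le_cancel_left_pos) auto
    qed
    have min: "(\<Sum>i\<in>hit {..th \<omega>} \<omega>. (Y i \<omega> - lo \<omega>)\<^sup>2) + (\<Sum>i\<in>hit {th \<omega><..} \<omega>. (Y i \<omega> - up \<omega>)\<^sup>2)
      \<le> (\<Sum>i\<in>hit {..th0} \<omega>. (Y i \<omega> - l0)\<^sup>2) + (\<Sum>i\<in>hit {th0<..} \<omega>. (Y i \<omega> - u0)\<^sup>2)"
      using fit_min[OF \<omega> th0, of l0 u0] unfolding rss_def Y_def .
    show "\<bar>th \<omega> - th0\<bar> \<le> \<eta>"
    proof (rule ccontr)
      assume "\<not> \<bar>th \<omega> - th0\<bar> \<le> \<eta>"
      then consider "th0 + \<eta> < th \<omega>" | "th \<omega> < th0 - \<eta>" by linarith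
      then show False
      proof cases
        case 1
        then have t: "th0 \<le> th \<omega>" using pos by linarith
        have u1: "hit {..th \<omega>} \<omega> = hit {..th0} \<omega> \<union> hit {th0<..th \<omega>} \<omega>" and u2: "hit {th0<..} \<omega> = hit {th0<..th \<omega>} \<omega> \<union> hit {th \<omega><..} \<omega>"
          using t unfolding hit_def by auto
        show False
        proof (rule contra[of "hit {..th0} \<omega>" "hit {th0<..th \<omega>} \<omega>" "hit {th \<omega><..} \<omega>" "{..th0}" "{th0<..th \<omega>}" "{th \<omega><..}" l0 u0 "lo \<omega>" "up \<omega>", OF _ _ refl refl refl])
          have "card (hit {th0 - \<eta><..th0} \<omega>) \<le> card (hit {..th0} \<omega>)" by (intro card_mono finite_hit hit_mono) auto
          then show "q / 2 * N \<le> count {..th0} \<omega>" using c1 by linarith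
          have "card (hit {th0<..th0 + \<eta>} \<omega>) \<le> card (hit {th0<..th \<omega>} \<omega>)" using 1 by (intro card_mono finite_hit hit_mono) auto
          then show "q / 2 * N \<le> count {th0<..th \<omega>} \<omega>" using c2 by linarith
        qed (use noise min[unfolded u1 u2] G t in \<open>auto simp: s0_def hit_def power2_commute\<close>)
      next
        case 2
        then have t: "th \<omega> \<le> th0" using pos by linarith
        have u1: "hit {..th0} \<omega> = hit {th \<omega><..th0} \<omega> \<union> hit {..th \<omega>} \<omega>" and u2: "hit {th \<omega><..} \<omega> = hit {th0<..} \<omega> \<union> hit {th \<omega><..th0} \<omega>"
          using t unfolding hit_def by auto
        show False
        proof (rule contra[of "hit {th0<..} \<omega>" "hit {th \<omega><..th0} \<omega>" "hit {..th \<omega>} \<omega>" "{th0<..}" "{th \<omega><..th0}" "{..th \<omega>}" u0 l0 "up \<omega>" "lo \<omega>", OF _ _ refl refl refl])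
          have "card (hit {th0 - \<eta><..th0} \<omega>) \<le> card (hit {th \<omega><..th0} \<omega>)" using 2 by (intro card_mono finite_hit hit_mono) auto
          then show "q / 2 * N \<le> count {th \<omega><..th0} \<omega>" using c1 by linarith
          have "card (hit {th0<..th0 + \<eta>} \<omega>) \<le> card (hit {th0<..} \<omega>)" by (intro card_mono finite_hit hit_mono) auto
          then show "q / 2 * N \<le> count {th0<..} \<omega>" using c2 by linarith
        qed (use noise min[unfolded u1 u2] G t in \<open>auto simp: s0_def hit_def power2_commute\<close>)
      qed
    qed
  qed
qed

end

section \<open>Local rates by dyadic peeling\<close>

text \<open>Normal equations from minimality: a quadratic without constant term that never becomes negative has no
linear term.\<close>

lemma quadratic_min_at_0:
  fixes A s :: real
  assumes "\<And>h. 0 \<le> A * h\<^sup>2 - 2 * h * s"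
  shows "s = 0"
proof (rule ccontr)
  assume s: "s \<noteq> 0"
  define k where "k = 1 / (\<bar>A\<bar> + 1)"
  have k: "0 < k" "\<bar>A\<bar> * k < 1" by (auto simp: k_def field_simps)
  have "A * (k * s)\<^sup>2 - 2 * (k * s) * s = k * s\<^sup>2 * (A * k - 2)" by (simp add: power2_eq_square algebra_simps)
  moreover have "k * s\<^sup>2 * (A * k - 2) < 0"
  proof (rule mult_pos_neg)
    have "A * k \<le> \<bar>A\<bar> * k" using k by (intro mult_right_mono) auto
    then show "A * k - 2 < 0" using k by linarith
  qed (use k s in simp)
  ultimately have "A * (k * s)\<^sup>2 - 2 * (k * s) * s < 0" by linarith
  then show False using assms[of "k * s"] by simp
qed

text \<open>The local situation at one stage, with \<open>ths\<close>, \<open>bl\<close>, \<open>bu\<close> the population minimiser.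
It is described by constants that will be the same for all large stages, and by \<open>a\<close>, which is
$\alpha_n$.  The last assumption says that $g$ moves away from its value at \<open>ths\<close> at slope
$c a$ until it has moved by $c$.\<close>

locale stump_local = stump_fit M n X e \<mu> \<nu> s2 g th lo up
  for M :: "'w measure" and n X e \<mu> \<nu> s2 g th lo up +
  fixes ths bl bu r pm pM C D c a :: real
  assumes ths: "ths \<in> {0..1}"
    and pos: "0 < r" "0 < pm" "0 < pM" "0 < D" "0 < c" "0 < a"
    and mass: "\<And>x y. ths - r \<le> x \<Longrightarrow> x \<le> y \<Longrightarrow> y \<le> ths + r \<Longrightarrow>
        pm * (y - x) \<le> measure \<mu> {x<..y} \<and> measure \<mu> {x<..y} \<le> pM * (y - x)"
    and gap: "D \<le> bu - bl"
    and Cb: "\<And>x. \<bar>g x - bl\<bar> \<le> C" "\<And>x. \<bar>g x - bu\<bar> \<le> C"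
    and centre: "g ths = (bl + bu) / 2"
    and mean_l: "(\<integral>x. indicator {..ths} x * (g x - bl) \<partial>\<mu>) = 0"
    and mean_u: "(\<integral>x. indicator {ths<..} x * (g x - bu) \<partial>\<mu>) = 0"
    and slope: "\<And>v. 0 \<le> v \<Longrightarrow> c * min (a * v) 1 \<le> g (ths + v) - g ths"
      "\<And>v. 0 \<le> v \<Longrightarrow> c * min (a * v) 1 \<le> g ths - g (ths - v)"
begin

abbreviation "N \<equiv> real n"

lemma N_pos: "0 < N" using n by simp

lemma C_nonneg: "0 \<le> C" using Cb(1)[of 0] by linarith

lemma fit_normal_equations:
  assumes \<omega>: "\<omega> \<in> space M"
  shows "(\<Sum>i\<in>hit {..th \<omega>} \<omega>. g (X i \<omega>) + e i \<omega> - lo \<omega>) = 0"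
    and "(\<Sum>i\<in>hit {th \<omega><..} \<omega>. g (X i \<omega>) + e i \<omega> - up \<omega>) = 0"
proof -
  show "(\<Sum>i\<in>hit {..th \<omega>} \<omega>. g (X i \<omega>) + e i \<omega> - lo \<omega>) = 0"
  proof (rule quadratic_min_at_0)
    fix h
    have "rss g (th \<omega>) (lo \<omega>) (up \<omega>) \<omega> \<le> rss g (th \<omega>) (lo \<omega> + h) (up \<omega>) \<omega>" by (rule fit_min[OF \<omega> fit_range[OF \<omega>]])
    then show "0 \<le> count {..th \<omega>} \<omega> * h\<^sup>2 - 2 * h * (\<Sum>i\<in>hit {..th \<omega>} \<omega>. g (X i \<omega>) + e i \<omega> - lo \<omega>)"
      using sum_sq_shift[of "hit {..th \<omega>} \<omega>" "\<lambda>i. g (X i \<omega>) + e i \<omega>" "lo \<omega> + h" "lo \<omega>"]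
      unfolding rss_def by simp
  qed
  show "(\<Sum>i\<in>hit {th \<omega><..} \<omega>. g (X i \<omega>) + e i \<omega> - up \<omega>) = 0"
  proof (rule quadratic_min_at_0)
    fix h
    have "rss g (th \<omega>) (lo \<omega>) (up \<omega>) \<omega> \<le> rss g (th \<omega>) (lo \<omega>) (up \<omega> + h) \<omega>" by (rule fit_min[OF \<omega> fit_range[OF \<omega>]])
    then show "0 \<le> count {th \<omega><..} \<omega> * h\<^sup>2 - 2 * h * (\<Sum>i\<in>hit {th \<omega><..} \<omega>. g (X i \<omega>) + e i \<omega> - up \<omega>)"
      using sum_sq_shift[of "hit {th \<omega><..} \<omega>" "\<lambda>i. g (X i \<omega>) + e i \<omega>" "up \<omega> + h" "up \<omega>"]
      unfolding rss_def by simp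
  qed
qed

lemma whp_count:
  assumes "ths - r \<le> x" "x < y" "y \<le> ths + r"
  shows "whp M (4 / (N * (pm * (y - x)))) (\<lambda>\<omega>. N * pm * (y - x) / 2 \<le> count {x<..y} \<omega> \<and>
     count {x<..y} \<omega> \<le> 2 * N * pM * (y - x))"
proof (rule whp_mono[OF whp_hit_card])
  have m: "pm * (y - x) \<le> measure \<mu> {x<..y}" "measure \<mu> {x<..y} \<le> pM * (y - x)" using mass[of x y] assms by auto
  have p: "0 < pm * (y - x)" using pos assms by simp
  show "{x<..y} \<in> sets borel" by simp
  show q: "0 < measure \<mu> {x<..y}" using p m by linarith
  show "4 / (N * measure \<mu> {x<..y}) \<le> 4 / (N * (pm * (y - x)))"
    using m q N_pos pos assms by (intro divide_left_mono mult_left_mono mult_pos_pos) auto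
  have "N * (pm * (y - x)) \<le> N * measure \<mu> {x<..y}" "N * measure \<mu> {x<..y} \<le> N * (pM * (y - x))"
    using m N_pos by (auto intro!: mult_left_mono)
  then show "N * measure \<mu> {x<..y} / 2 \<le> count {x<..y} \<omega> \<and> count {x<..y} \<omega> \<le> 2 * (N * measure \<mu> {x<..y})
      \<Longrightarrow> N * pm * (y - x) / 2 \<le> count {x<..y} \<omega> \<and>
     count {x<..y} \<omega> \<le> 2 * N * pM * (y - x)" for \<omega> by (simp add: mult.assoc)
qed

lemma whp_centred_block:
  assumes A: "A \<in> sets borel" and C': "\<And>x. \<bar>g x - b\<bar> \<le> C" and z: "(\<integral>x. indicator A x * (g x - b) \<partial>\<mu>) = 0"
    and k: "0 < k"
  shows "whp M ((2 * C\<^sup>2 + 2 * s2) / k\<^sup>2) (\<lambda>\<omega>. \<bar>\<Sum>i\<in>hit A \<omega>. g (X i \<omega>) + e i \<omega> - b\<bar> < k * sqrt N)"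
proof -
  have [measurable]: "A \<in> sets borel" by fact
  define h where "h = (\<lambda>p. indicator A (fst p) * (g (fst p) - b) + indicator A (fst p) * snd p)"
  have [measurable]: "h \<in> borel_measurable (borel \<Otimes>\<^sub>M borel)" unfolding h_def by measurable
  have Ai: "integrable \<mu> (indicator A :: real \<Rightarrow> real)" using A mu by (auto simp: pp.M1.emeasure_eq_measure)
  have i1: "integrable \<mu> (\<lambda>x. indicator A x * (g x - b))"
    by (rule pp.M1.integrable_const_bound[where B = C]) (use C' C_nonneg in \<open>auto simp: indicator_def\<close>)
  have hsq: "(h p)\<^sup>2 \<le> 2 * C\<^sup>2 + 2 * (snd p)\<^sup>2" for p
  proof -
    have "(h p)\<^sup>2 \<le> (g (fst p) - b + snd p)\<^sup>2" unfolding h_def by (auto simp: indicator_def)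
    also have "\<dots> \<le> 2 * (g (fst p) - b)\<^sup>2 + 2 * (snd p)\<^sup>2"
      using zero_le_power2[of "g (fst p) - b - snd p"] by (simp add: power2_eq_square algebra_simps)
    also have "(g (fst p) - b)\<^sup>2 \<le> C\<^sup>2" using C'[of "fst p"] C_nonneg by (metis abs_le_square_iff abs_of_nonneg)
    finally show ?thesis by simp
  qed
  have i2: "integrable (\<mu> \<Otimes>\<^sub>M \<nu>) (\<lambda>p. 2 * C\<^sup>2 + 2 * (snd p)\<^sup>2)"
    using integral_snd_nu(1)[OF nu_sq] by auto
  have hi: "integrable (\<mu> \<Otimes>\<^sub>M \<nu>) (\<lambda>p. (h p)\<^sup>2)"
    by (rule Bochner_Integration.integrable_bound[OF i2]) (use hsq in auto)
  have Eh: "(\<integral>p. (h p)\<^sup>2 \<partial>(\<mu> \<Otimes>\<^sub>M \<nu>)) \<le> 2 * C\<^sup>2 + 2 * s2"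
  proof -
    have "(\<integral>p. (h p)\<^sup>2 \<partial>(\<mu> \<Otimes>\<^sub>M \<nu>)) \<le> (\<integral>p. 2 * C\<^sup>2 + 2 * (snd p)\<^sup>2 \<partial>(\<mu> \<Otimes>\<^sub>M \<nu>))"
      by (rule integral_mono[OF hi i2 hsq])
    also have "\<dots> = 2 * C\<^sup>2 + 2 * s2"
      using integral_snd_nu[OF nu_sq] nu_var pp.P.prob_space by simp
    finally show ?thesis .
  qed
  have "whp M (N * (2 * C\<^sup>2 + 2 * s2) / (k * sqrt N)\<^sup>2) (\<lambda>\<omega>. \<bar>\<Sum>i=1..n. h (X i \<omega>, e i \<omega>)\<bar> < k * sqrt N)"
  proof (rule whp_sum_Chebyshev)
    have "integrable (\<mu> \<Otimes>\<^sub>M \<nu>) (\<lambda>p. indicator A (fst p) * snd p)" "(\<integral>p. indicator A (fst p) * snd p \<partial>(\<mu> \<Otimes>\<^sub>M \<nu>)) = 0"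
      using pp.product_integral[OF Ai nu_int] nu_mean by auto
    then show "(\<integral>p. h p \<partial>(\<mu> \<Otimes>\<^sub>M \<nu>)) = 0"
      unfolding h_def using integral_fst_mu[OF i1] z by simp
    show "N * (\<integral>p. (h p)\<^sup>2 \<partial>(\<mu> \<Otimes>\<^sub>M \<nu>)) \<le> N * (2 * C\<^sup>2 + 2 * s2)" using Eh N_pos by simp
    show "0 < k * sqrt N" using k N_pos by simp
  qed (use hi in auto)
  then show ?thesis
  proof (rule whp_mono)
    show "N * (2 * C\<^sup>2 + 2 * s2) / (k * sqrt N)\<^sup>2 \<le> (2 * C\<^sup>2 + 2 * s2) / k\<^sup>2"
      using N_pos by (simp add: power_mult_distrib)
    fix \<omega> assume "\<bar>\<Sum>i=1..n. h (X i \<omega>, e i \<omega>)\<bar> < k * sqrt N"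
    moreover have "(\<Sum>i=1..n. h (X i \<omega>, e i \<omega>)) = (\<Sum>i\<in>hit A \<omega>. g (X i \<omega>) + e i \<omega> - b)"
      unfolding sum_hit h_def by (intro sum.cong) (auto simp: algebra_simps)
    ultimately show "\<bar>\<Sum>i\<in>hit A \<omega>. g (X i \<omega>) + e i \<omega> - b\<bar> < k * sqrt N" by simp
  qed
qed

text \<open>The part of the good event that does not depend on the scale.  It controls the level errors up to the
observations between the two cuts.\<close>

definition globally_tame :: "real \<Rightarrow> 'w \<Rightarrow> bool" where
  "globally_tame k \<omega> \<longleftrightarrow>
     \<bar>\<Sum>i\<in>hit {..ths} \<omega>. g (X i \<omega>) + e i \<omega> - bl\<bar> < k * sqrt N \<and>
     \<bar>\<Sum>i\<in>hit {ths<..} \<omega>. g (X i \<omega>) + e i \<omega> - bu\<bar> < k * sqrt N \<and>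
     (\<forall>s t. \<bar>noise {s<..t} \<omega>\<bar> < k * sqrt N) \<and>
     N * pm * r / 4 \<le> count {ths - r<..ths - r / 2} \<omega> \<and>
     N * pm * r / 4 \<le> count {ths + r / 2<..ths + r} \<omega>"

lemma whp_globally_tame:
  assumes k: "0 < k"
  shows "whp M ((4 * C\<^sup>2 + 8 * s2) / k\<^sup>2 + 16 / (N * pm * r)) (globally_tame k)"
proof -
  have 1: "whp M ((2 * C\<^sup>2 + 2 * s2) / k\<^sup>2) (\<lambda>\<omega>. \<bar>\<Sum>i\<in>hit {..ths} \<omega>. g (X i \<omega>) + e i \<omega> - bl\<bar> < k * sqrt N)"
    by (rule whp_centred_block[OF _ Cb(1) mean_l k]) simp
  have 2: "whp M ((2 * C\<^sup>2 + 2 * s2) / k\<^sup>2) (\<lambda>\<omega>. \<bar>\<Sum>i\<in>hit {ths<..} \<omega>. g (X i \<omega>) + e i \<omega> - bu\<bar> < k * sqrt N)"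
    by (rule whp_centred_block[OF _ Cb(2) mean_u k]) simp
  have 3: "whp M (4 * s2 / k\<^sup>2) (\<lambda>\<omega>. \<forall>s t. \<bar>noise {s<..t} \<omega>\<bar> < k * sqrt N)"
  proof (rule whp_mono[OF whp_noise_sup[of UNIV "k * sqrt N / 2"]])
    have "measure \<mu> UNIV = 1" using pp.M1.prob_space by simp
    then show "N * s2 * measure \<mu> UNIV / (k * sqrt N / 2)\<^sup>2 \<le> 4 * s2 / k\<^sup>2"
      using N_pos by (simp add: power_mult_distrib power_divide mult.commute)
  qed (use k N_pos in auto)
  have 4: "whp M (8 / (N * pm * r)) (\<lambda>\<omega>. N * pm * r / 4 \<le> count {ths - r<..ths - r / 2} \<omega>)"
    by (rule whp_mono[OF whp_count[of "ths - r" "ths - r / 2"]]) (use pos N_pos in \<open>auto simp: field_simps\<close>)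
  have 5: "whp M (8 / (N * pm * r)) (\<lambda>\<omega>. N * pm * r / 4 \<le> count {ths + r / 2<..ths + r} \<omega>)"
    by (rule whp_mono[OF whp_count[of "ths + r / 2" "ths + r"]]) (use pos N_pos in \<open>auto simp: field_simps\<close>)
  show ?thesis unfolding globally_tame_def
    by (rule whp_mono[OF whp_conj[OF 1 whp_conj[OF 2 whp_conj[OF 3 whp_conj[OF 4 5]]]]])
      (auto simp: add_divide_distrib ac_simps)
qed

text \<open>The fitted level is the mean over its block.  Passing to the population block exchanges only the
observations between the two cuts, each of which costs at most $C$ plus its noise.\<close>

lemma level_error:
  assumes \<omega>: "\<omega> \<in> space M" and tame: "globally_tame k \<omega>" and near: "\<bar>th \<omega> - ths\<bar> \<le> r / 2"
    and B: "count {th \<omega><..ths} \<omega> \<le> B" "count {ths<..th \<omega>} \<omega> \<le> B"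
  shows "\<bar>lo \<omega> - bl\<bar> \<le> (2 * k * sqrt N + C * B) / (N * pm * r / 4)"
    and "\<bar>up \<omega> - bu\<bar> \<le> (2 * k * sqrt N + C * B) / (N * pm * r / 4)"
proof -
  define K where "K = 2 * k * sqrt N + C * B"
  define Y where "Y i = g (X i \<omega>) + e i \<omega>" for i
  have t: "\<bar>\<Sum>i\<in>hit {..ths} \<omega>. Y i - bl\<bar> < k * sqrt N" "\<bar>\<Sum>i\<in>hit {ths<..} \<omega>. Y i - bu\<bar> < k * sqrt N"
    "\<And>s t. \<bar>noise {s<..t} \<omega>\<bar> < k * sqrt N"
    "N * pm * r / 4 \<le> count {ths - r<..ths - r / 2} \<omega>"
    "N * pm * r / 4 \<le> count {ths + r / 2<..ths + r} \<omega>"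
    using tame unfolding globally_tame_def Y_def by auto
  have side: "ths - r / 2 \<le> th \<omega>" "th \<omega> \<le> ths + r / 2" using near by linarith+
  have den: "0 < N * pm * r / 4" using N_pos pos by simp
  have btw: "\<bar>\<Sum>i\<in>hit {x<..y} \<omega>. Y i - b\<bar> < k * sqrt N + C * B"
    if "count {x<..y} \<omega> \<le> B" "\<And>x. \<bar>g x - b\<bar> \<le> C" for x y b
  proof -
    have "(\<Sum>i\<in>hit {x<..y} \<omega>. Y i - b) = noise {x<..y} \<omega> + (\<Sum>i\<in>hit {x<..y} \<omega>. g (X i \<omega>) - b)"
      unfolding sum.distrib[symmetric] Y_def by (simp add: algebra_simps)
    moreover have "\<bar>\<Sum>i\<in>hit {x<..y} \<omega>. g (X i \<omega>) - b\<bar> \<le> (\<Sum>i\<in>hit {x<..y} \<omega>. C)"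
      by (rule order_trans[OF sum_abs]) (intro sum_mono that(2))
    moreover have "(\<Sum>i\<in>hit {x<..y} \<omega>. C) \<le> C * B" using that(1) C_nonneg by (simp add: mult.commute[of _ C] mult_left_mono)
    ultimately show ?thesis using t(3)[of x y] by linarith
  qed
  have fin: "\<bar>v - b\<bar> \<le> K / (N * pm * r / 4)"
    if "(\<Sum>i\<in>J. Y i - v) = 0" "\<bar>\<Sum>i\<in>J. Y i - b\<bar> \<le> K" "N * pm * r / 4 \<le> real (card J)" for J v b
  proof -
    have "(\<Sum>i\<in>J. Y i - b) = (\<Sum>i\<in>J. Y i - v) + real (card J) * (v - b)"
      by (simp add: sum_subtractf algebra_simps)
    then have "real (card J) * \<bar>v - b\<bar> \<le> K" using that by (simp add: abs_mult)
    moreover have "N * pm * r / 4 * \<bar>v - b\<bar> \<le> real (card J) * \<bar>v - b\<bar>" using that by (intro mult_right_mono) auto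
    ultimately show ?thesis using den by (subst pos_le_divide_eq) (auto simp: mult.commute)
  qed
  have low: "\<bar>\<Sum>i\<in>hit {..th \<omega>} \<omega>. Y i - bl\<bar> \<le> K"
  proof (cases "ths \<le> th \<omega>")
    case True
    then have "hit {..th \<omega>} \<omega> = hit ({..ths} \<union> {ths<..th \<omega>}) \<omega>" unfolding hit_def by auto
    then have "(\<Sum>i\<in>hit {..th \<omega>} \<omega>. Y i - bl) = (\<Sum>i\<in>hit {..ths} \<omega>. Y i - bl) + (\<Sum>i\<in>hit {ths<..th \<omega>} \<omega>. Y i - bl)"
      by (simp only:) (rule sum_hit_Un, auto)
    then show ?thesis using t(1) btw[OF B(2) Cb(1)] unfolding K_def by linarith
  next
    case False
    then have "hit {..ths} \<omega> = hit ({..th \<omega>} \<union> {th \<omega><..ths}) \<omega>" unfolding hit_def by auto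
    then have "(\<Sum>i\<in>hit {..ths} \<omega>. Y i - bl) = (\<Sum>i\<in>hit {..th \<omega>} \<omega>. Y i - bl) + (\<Sum>i\<in>hit {th \<omega><..ths} \<omega>. Y i - bl)"
      by (simp only:) (rule sum_hit_Un, auto)
    then show ?thesis using t(1) btw[OF B(1) Cb(1)] unfolding K_def by linarith
  qed
  have upp: "\<bar>\<Sum>i\<in>hit {th \<omega><..} \<omega>. Y i - bu\<bar> \<le> K"
  proof (cases "ths \<le> th \<omega>")
    case True
    then have "hit {ths<..} \<omega> = hit ({ths<..th \<omega>} \<union> {th \<omega><..}) \<omega>" unfolding hit_def by auto
    then have "(\<Sum>i\<in>hit {ths<..} \<omega>. Y i - bu) = (\<Sum>i\<in>hit {ths<..th \<omega>} \<omega>. Y i - bu) + (\<Sum>i\<in>hit {th \<omega><..} \<omega>. Y i - bu)"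
      by (simp only:) (rule sum_hit_Un, auto)
    then show ?thesis using t(2) btw[OF B(2) Cb(2)] unfolding K_def by linarith
  next
    case False
    then have "hit {th \<omega><..} \<omega> = hit ({th \<omega><..ths} \<union> {ths<..}) \<omega>" unfolding hit_def by auto
    then have "(\<Sum>i\<in>hit {th \<omega><..} \<omega>. Y i - bu) = (\<Sum>i\<in>hit {th \<omega><..ths} \<omega>. Y i - bu) + (\<Sum>i\<in>hit {ths<..} \<omega>. Y i - bu)"
      by (simp only:) (rule sum_hit_Un, auto)
    then show ?thesis using t(2) btw[OF B(1) Cb(2)] unfolding K_def by linarith
  qed
  have "card (hit {ths - r<..ths - r / 2} \<omega>) \<le> card (hit {..th \<omega>} \<omega>)"
    using side by (intro card_mono finite_hit hit_mono) auto
  then show "\<bar>lo \<omega> - bl\<bar> \<le> (2 * k * sqrt N + C * B) / (N * pm * r / 4)"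
    using fin[OF _ low, of "lo \<omega>"] fit_normal_equations(1)[OF \<omega>] t(4) unfolding K_def Y_def by simp
  have "card (hit {ths + r / 2<..ths + r} \<omega>) \<le> card (hit {th \<omega><..} \<omega>)"
    using side by (intro card_mono finite_hit hit_mono) auto
  then show "\<bar>up \<omega> - bu\<bar> \<le> (2 * k * sqrt N + C * B) / (N * pm * r / 4)"
    using fin[OF _ upp, of "up \<omega>"] fit_normal_equations(2)[OF \<omega>] t(5) unfolding K_def Y_def by simp
qed

text \<open>One quarter of the lower bound $c p_m n \delta \min(a \delta, 1) / 4$ for twice the drift in
drift_beats_noise.\<close>

definition noise_level :: "real \<Rightarrow> real" where
  "noise_level \<delta> = c * pm * N * \<delta> * min (a * \<delta>) 1 / 16"

text \<open>The lower counts concern the outer half of the block, where $g$ has already moved by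
$c \min(a \delta / 2, 1)$.  The upper counts and the noise concern distance $2 \delta$, since
the cut is only known to lie between $\delta$ and $2 \delta$.\<close>

definition scale_tame :: "real \<Rightarrow> 'w \<Rightarrow> bool" where
  "scale_tame \<delta> \<omega> \<longleftrightarrow>
     N * pm * \<delta> / 4 \<le> count {ths + \<delta> / 2<..ths + \<delta>} \<omega> \<and>
     N * pm * \<delta> / 4 \<le> count {ths - \<delta><..ths - \<delta> / 2} \<omega> \<and>
     count {ths<..ths + 2 * \<delta>} \<omega> \<le> 4 * N * pM * \<delta> \<and>
     count {ths - 2 * \<delta><..ths} \<omega> \<le> 4 * N * pM * \<delta> \<and>
     (\<forall>t. \<bar>noise ({ths<..ths + 2 * \<delta>} \<inter> {..t}) \<omega>\<bar> < noise_level \<delta>) \<and>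
     (\<forall>t. \<bar>noise ({ths - 2 * \<delta><..ths} \<inter> {t<..}) \<omega>\<bar> < noise_level \<delta>)"

text \<open>The sum of the failure probabilities at scale $\delta$: Chebyshev for the four counts and
the maximal inequality for the two noise sums, after $1 / \min(a \delta, 1)^2 \le 1 + 1 / (a \delta)^2$.\<close>

definition fail_bound :: "real \<Rightarrow> real" where
  "fail_bound \<delta> = (20 / pm + 4096 * s2 * pM / (c * pm)\<^sup>2) / (N * \<delta>)
      + 4096 * s2 * pM / (c * pm)\<^sup>2 / (N * a\<^sup>2 * \<delta> ^ 3)"

lemma noise_level_pos: "0 < \<delta> \<Longrightarrow> 0 < noise_level \<delta>"
  unfolding noise_level_def using pos N_pos by simp

lemma whp_scale_tame:
  assumes d: "0 < \<delta>" "2 * \<delta> \<le> r"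
  shows "whp M (fail_bound \<delta>) (scale_tame \<delta>)"
proof -
  define Q where "Q = 2048 * s2 * pM / (c * pm)\<^sup>2 / (N * \<delta>) * (1 + 1 / (a * \<delta>)\<^sup>2)"
  have 1: "whp M (8 / (N * pm * \<delta>)) (\<lambda>\<omega>. N * pm * \<delta> / 4 \<le> count {ths + \<delta> / 2<..ths + \<delta>} \<omega>)"
    by (rule whp_mono[OF whp_count[of "ths + \<delta> / 2" "ths + \<delta>"]]) (use d pos N_pos in \<open>auto simp: field_simps\<close>)
  have 2: "whp M (8 / (N * pm * \<delta>)) (\<lambda>\<omega>. N * pm * \<delta> / 4 \<le> count {ths - \<delta><..ths - \<delta> / 2} \<omega>)"
    by (rule whp_mono[OF whp_count[of "ths - \<delta>" "ths - \<delta> / 2"]]) (use d pos N_pos in \<open>auto simp: field_simps\<close>)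
  have 3: "whp M (2 / (N * pm * \<delta>)) (\<lambda>\<omega>. count {ths<..ths + 2 * \<delta>} \<omega> \<le> 4 * N * pM * \<delta>)"
    by (rule whp_mono[OF whp_count[of "ths" "ths + 2 * \<delta>"]]) (use d pos N_pos in \<open>auto simp: field_simps\<close>)
  have 4: "whp M (2 / (N * pm * \<delta>)) (\<lambda>\<omega>. count {ths - 2 * \<delta><..ths} \<omega> \<le> 4 * N * pM * \<delta>)"
    by (rule whp_mono[OF whp_count[of "ths - 2 * \<delta>" "ths"]]) (use d pos N_pos in \<open>auto simp: field_simps\<close>)
  have lam: "0 < noise_level \<delta> / 2" using noise_level_pos d by simp
  have Q: "N * s2 * measure \<mu> A / (noise_level \<delta> / 2)\<^sup>2 \<le> Q" if "measure \<mu> A \<le> pM * (2 * \<delta>)" for A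
  proof -
    define m where "m = min (a * \<delta>) 1"
    have ad: "0 < a * \<delta>" using pos d by simp
    then have m: "0 < m" by (simp add: m_def)
    have mi: "1 / m\<^sup>2 \<le> 1 + 1 / (a * \<delta>)\<^sup>2"
      using ad unfolding m_def by (cases "a * \<delta> \<le> 1") (auto simp: min_def)
    have "N * s2 * measure \<mu> A / (noise_level \<delta> / 2)\<^sup>2 \<le> N * s2 * (pM * (2 * \<delta>)) / (noise_level \<delta> / 2)\<^sup>2"
      using that s2_nonneg N_pos by (intro divide_right_mono mult_left_mono) auto
    also have "\<dots> = 2048 * s2 * pM / (c * pm)\<^sup>2 / (N * \<delta>) * (1 / m\<^sup>2)"
      unfolding noise_level_def m_def[symmetric] using pos d N_pos m by (simp add: power2_eq_square field_simps)
    also have "\<dots> \<le> Q" unfolding Q_def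
      using mi s2_nonneg pos d N_pos by (intro mult_left_mono) auto
    finally show ?thesis .
  qed
  have 5: "whp M Q (\<lambda>\<omega>. \<forall>t. \<bar>noise ({ths<..ths + 2 * \<delta>} \<inter> {..t}) \<omega>\<bar> < noise_level \<delta>)"
    by (rule whp_mono[OF whp_noise_sup[of "{ths<..ths + 2 * \<delta>}", OF _ lam]])
      (use mass[of ths "ths + 2 * \<delta>"] d in \<open>auto intro!: Q\<close>)
  have 6: "whp M Q (\<lambda>\<omega>. \<forall>t. \<bar>noise ({ths - 2 * \<delta><..ths} \<inter> {t<..}) \<omega>\<bar> < noise_level \<delta>)"
    by (rule whp_mono[OF whp_noise_sup[of "{ths - 2 * \<delta><..ths}", OF _ lam]])
      (use mass[of "ths - 2 * \<delta>" ths] d in \<open>auto intro!: Q\<close>)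
  have eq: "8 / (N * pm * \<delta>) + (8 / (N * pm * \<delta>) + (2 / (N * pm * \<delta>) + (2 / (N * pm * \<delta>) + (Q + Q)))) = fail_bound \<delta>"
  proof -
    define P where "P = 2048 * s2 * pM / (c * pm)\<^sup>2"
    have P2: "4096 * s2 * pM / (c * pm)\<^sup>2 = 2 * P" unfolding P_def by simp
    show ?thesis unfolding Q_def fail_bound_def P2 P_def[symmetric]
      using pos d N_pos by (simp add: power2_eq_square power3_eq_cube field_simps)
  qed
  show ?thesis unfolding scale_tame_def eq[symmetric]
    by (rule whp_conj[OF 1 whp_conj[OF 2 whp_conj[OF 3 whp_conj[OF 4 whp_conj[OF 5 6]]]]])
qed

text \<open>Twice the drift is at least $c p_m n \delta \min(a \delta, 1) / 4$.  Noise and level error each stay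
below half of that, by the choice of noise_level and of the bound on $b$.\<close>

lemma drift_beats_noise:
  fixes h :: "nat \<Rightarrow> real"
  assumes J: "finite J" "J' \<subseteq> J" and d: "0 < \<delta>"
    and h: "\<And>i. i \<in> J \<Longrightarrow> 0 \<le> h i" "\<And>i. i \<in> J' \<Longrightarrow> c * min (a * (\<delta> / 2)) 1 \<le> h i"
    and card: "N * pm * \<delta> / 4 \<le> real (card J')" "real (card J) \<le> 4 * N * pM * \<delta>"
    and S: "\<bar>S\<bar> < noise_level \<delta>" and b: "\<bar>b\<bar> < c * pm / (32 * pM) * min (a * \<delta>) 1"
  shows "2 * S + b * real (card J) < 2 * (\<Sum>i\<in>J. h i)"
proof -
  define m where "m = min (a * \<delta>) 1"
  have m: "0 < m" using pos d by (simp add: m_def)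
  have m2: "m / 2 \<le> min (a * (\<delta> / 2)) 1" unfolding m_def by (auto simp: min_def)
  have "N * pm * \<delta> / 4 * (c * (m / 2)) \<le> real (card J') * (c * min (a * (\<delta> / 2)) 1)"
    using card m2 m pos N_pos d by (intro mult_mono) auto
  also have "\<dots> = (\<Sum>i\<in>J'. c * min (a * (\<delta> / 2)) 1)" by simp
  also have "\<dots> \<le> (\<Sum>i\<in>J'. h i)" by (intro sum_mono h)
  also have "\<dots> \<le> (\<Sum>i\<in>J. h i)" using J h by (intro sum_mono2) auto
  finally have 1: "c * pm * N * \<delta> * m / 8 \<le> (\<Sum>i\<in>J. h i)" by (simp add: ac_simps)
  have "b * real (card J) \<le> \<bar>b\<bar> * real (card J)" by (intro mult_right_mono) auto
  also have "\<dots> \<le> c * pm / (32 * pM) * m * (4 * N * pM * \<delta>)"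
    using b card unfolding m_def by (intro mult_mono) auto
  also have "\<dots> = c * pm * N * \<delta> * m / 8" using pos by (simp add: field_simps)
  finally have 2: "b * real (card J) \<le> c * pm * N * \<delta> * m / 8" .
  show ?thesis using 1 2 S unfolding noise_level_def m_def[symmetric] by linarith
qed

text \<open>The fit is compared with the step function that has the same levels but the cut \<open>ths\<close>.  With
$g(\theta^*)$ at the midpoint of the population levels, the difference of the squares at one
observation is $(u - l) (2 (g(X) - g(\theta^*)) + 2 \epsilon - \beta)$, and the sign of its
sum over the block contradicts drift_beats_noise.\<close>

lemma split_not_at_scale:
  assumes \<omega>: "\<omega> \<in> space M" and tame: "scale_tame \<delta> \<omega>" and d: "0 < \<delta>"
    and t: "\<delta> < \<bar>th \<omega> - ths\<bar>" "\<bar>th \<omega> - ths\<bar> \<le> 2 * \<delta>"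
    and b: "\<bar>lo \<omega> - bl\<bar> + \<bar>up \<omega> - bu\<bar> < D" "\<bar>lo \<omega> - bl\<bar> + \<bar>up \<omega> - bu\<bar> < c * pm / (32 * pM) * min (a * \<delta>) 1"
  shows False
proof -
  define Y where "Y i = g (X i \<omega>) + e i \<omega>" for i
  define l where "l = lo \<omega>"
  define u where "u = up \<omega>"
  define \<beta> where "\<beta> = (l - bl) + (u - bu)"
  have ul: "0 < u - l" using b(1) gap unfolding l_def u_def by linarith
  have b\<beta>: "\<bar>\<beta>\<bar> < c * pm / (32 * pM) * min (a * \<delta>) 1" "\<bar>- \<beta>\<bar> < c * pm / (32 * pM) * min (a * \<delta>) 1"
    using b(2) unfolding \<beta>_def l_def u_def by linarith+
  have diff: "(\<Sum>i\<in>J. (Y i - l)\<^sup>2) - (\<Sum>i\<in>J. (Y i - u)\<^sup>2)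
     = (u - l) * (2 * (\<Sum>i\<in>J. g (X i \<omega>) - g ths) + 2 * (\<Sum>i\<in>J. e i \<omega>) - \<beta> * real (card J))" for J
  proof -
    have "(Y i - l)\<^sup>2 - (Y i - u)\<^sup>2 = (u - l) * (2 * (g (X i \<omega>) - g ths) + 2 * e i \<omega> - \<beta>)" for i
      unfolding Y_def \<beta>_def centre by (simp add: power2_eq_square field_simps)
    then show ?thesis
      by (simp only: sum_subtractf[symmetric] sum_distrib_left[symmetric]) (simp add: sum_subtractf sum.distrib sum_distrib_left)
  qed
  have min: "(\<Sum>i\<in>hit {..th \<omega>} \<omega>. (Y i - l)\<^sup>2) + (\<Sum>i\<in>hit {th \<omega><..} \<omega>. (Y i - u)\<^sup>2)
     \<le> (\<Sum>i\<in>hit {..ths} \<omega>. (Y i - l)\<^sup>2) + (\<Sum>i\<in>hit {ths<..} \<omega>. (Y i - u)\<^sup>2)"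
    using fit_min[OF \<omega> ths, of l u] unfolding rss_def Y_def l_def u_def .
  note tm = tame[unfolded scale_tame_def]
  consider "ths + \<delta> < th \<omega>" "th \<omega> \<le> ths + 2 * \<delta>" | "th \<omega> < ths - \<delta>" "ths - 2 * \<delta> \<le> th \<omega>" using t by linarith
  then show False
  proof cases
    case 1
    let ?J = "hit {ths<..th \<omega>} \<omega>"
    have "hit {..th \<omega>} \<omega> = hit ({..ths} \<union> {ths<..th \<omega>}) \<omega>" "hit {ths<..} \<omega> = hit ({ths<..th \<omega>} \<union> {th \<omega><..}) \<omega>"
      unfolding hit_def using 1 d by auto
    then have "(\<Sum>i\<in>hit {..th \<omega>} \<omega>. (Y i - l)\<^sup>2) = (\<Sum>i\<in>hit {..ths} \<omega>. (Y i - l)\<^sup>2) + (\<Sum>i\<in>?J. (Y i - l)\<^sup>2)"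
       "(\<Sum>i\<in>hit {ths<..} \<omega>. (Y i - u)\<^sup>2) = (\<Sum>i\<in>?J. (Y i - u)\<^sup>2) + (\<Sum>i\<in>hit {th \<omega><..} \<omega>. (Y i - u)\<^sup>2)"
      by (simp_all only:) (rule sum_hit_Un, force)+
    then have "(u - l) * (2 * (\<Sum>i\<in>?J. g (X i \<omega>) - g ths) + 2 * (\<Sum>i\<in>?J. e i \<omega>) - \<beta> * real (card ?J)) \<le> 0"
      using min diff[of ?J] by linarith
    then have le: "2 * (\<Sum>i\<in>?J. g (X i \<omega>) - g ths) + 2 * (\<Sum>i\<in>?J. e i \<omega>) - \<beta> * real (card ?J) \<le> 0"
      using ul by (simp add: mult_le_0_iff)
    have "2 * (- (\<Sum>i\<in>?J. e i \<omega>)) + \<beta> * real (card ?J) < 2 * (\<Sum>i\<in>?J. g (X i \<omega>) - g ths)"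
    proof (rule drift_beats_noise[OF _ _ d, where J' = "hit {ths + \<delta> / 2<..ths + \<delta>} \<omega>"])
      show "hit {ths + \<delta> / 2<..ths + \<delta>} \<omega> \<subseteq> ?J" using 1 d by (intro hit_mono) auto
      show "0 \<le> g (X i \<omega>) - g ths" if "i \<in> ?J" for i
        using that monoD[OF g_mono, of ths "X i \<omega>"] by (simp add: hit_def)
      show "c * min (a * (\<delta> / 2)) 1 \<le> g (X i \<omega>) - g ths" if "i \<in> hit {ths + \<delta> / 2<..ths + \<delta>} \<omega>" for i
        using that monoD[OF g_mono, of "ths + \<delta> / 2" "X i \<omega>"] slope(1)[of "\<delta> / 2"] d by (simp add: hit_def)
      show "N * pm * \<delta> / 4 \<le> count {ths + \<delta> / 2<..ths + \<delta>} \<omega>" using tm by blast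
      have "card ?J \<le> card (hit {ths<..ths + 2 * \<delta>} \<omega>)" using 1 by (intro card_mono finite_hit hit_mono) auto
      then show "real (card ?J) \<le> 4 * N * pM * \<delta>" using tm by linarith
      have "{ths<..th \<omega>} = {ths<..ths + 2 * \<delta>} \<inter> {..th \<omega>}" using 1 by auto
      then show "\<bar>- (\<Sum>i\<in>?J. e i \<omega>)\<bar> < noise_level \<delta>" using tm by (simp only: abs_minus_cancel)
    qed (use b\<beta> in auto)
    then show False using le by linarith
  next
    case 2
    let ?J = "hit {th \<omega><..ths} \<omega>"
    have "hit {..ths} \<omega> = hit ({..th \<omega>} \<union> {th \<omega><..ths}) \<omega>" "hit {th \<omega><..} \<omega> = hit ({th \<omega><..ths} \<union> {ths<..}) \<omega>"
      unfolding hit_def using 2 d by auto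
    then have "(\<Sum>i\<in>hit {..ths} \<omega>. (Y i - l)\<^sup>2) = (\<Sum>i\<in>hit {..th \<omega>} \<omega>. (Y i - l)\<^sup>2) + (\<Sum>i\<in>?J. (Y i - l)\<^sup>2)"
       "(\<Sum>i\<in>hit {th \<omega><..} \<omega>. (Y i - u)\<^sup>2) = (\<Sum>i\<in>?J. (Y i - u)\<^sup>2) + (\<Sum>i\<in>hit {ths<..} \<omega>. (Y i - u)\<^sup>2)"
      by (simp_all only:) (rule sum_hit_Un, force)+
    then have "0 \<le> (u - l) * (2 * (\<Sum>i\<in>?J. g (X i \<omega>) - g ths) + 2 * (\<Sum>i\<in>?J. e i \<omega>) - \<beta> * real (card ?J))"
      using min diff[of ?J] by linarith
    then have le: "0 \<le> 2 * (\<Sum>i\<in>?J. g (X i \<omega>) - g ths) + 2 * (\<Sum>i\<in>?J. e i \<omega>) - \<beta> * real (card ?J)"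
      using ul by (simp add: zero_le_mult_iff)
    have "2 * (\<Sum>i\<in>?J. e i \<omega>) + (- \<beta>) * real (card ?J) < 2 * (\<Sum>i\<in>?J. g ths - g (X i \<omega>))"
    proof (rule drift_beats_noise[OF _ _ d, where J' = "hit {ths - \<delta><..ths - \<delta> / 2} \<omega>"])
      show "hit {ths - \<delta><..ths - \<delta> / 2} \<omega> \<subseteq> ?J" using 2 d by (intro hit_mono) auto
      show "0 \<le> g ths - g (X i \<omega>)" if "i \<in> ?J" for i
        using that monoD[OF g_mono, of "X i \<omega>" ths] by (simp add: hit_def)
      show "c * min (a * (\<delta> / 2)) 1 \<le> g ths - g (X i \<omega>)" if "i \<in> hit {ths - \<delta><..ths - \<delta> / 2} \<omega>" for i
        using that monoD[OF g_mono, of "X i \<omega>" "ths - \<delta> / 2"] slope(2)[of "\<delta> / 2"] d by (simp add: hit_def)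
      show "N * pm * \<delta> / 4 \<le> count {ths - \<delta><..ths - \<delta> / 2} \<omega>" using tm by blast
      have "card ?J \<le> card (hit {ths - 2 * \<delta><..ths} \<omega>)" using 2 by (intro card_mono finite_hit hit_mono) auto
      then show "real (card ?J) \<le> 4 * N * pM * \<delta>" using tm by linarith
      have "{th \<omega><..ths} = {ths - 2 * \<delta><..ths} \<inter> {th \<omega><..}" using 2 by auto
      then show "\<bar>\<Sum>i\<in>?J. e i \<omega>\<bar> < noise_level \<delta>" using tm by (simp only:)
    qed (use b\<beta> in auto)
    moreover have "(\<Sum>i\<in>?J. g ths - g (X i \<omega>)) = - (\<Sum>i\<in>?J. g (X i \<omega>) - g ths)"
      by (simp add: sum_negf[symmetric])
    ultimately show False using le by linarith
  qed
qed

lemma fail_bound_dyadic: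
  assumes "0 < \<delta>" shows "fail_bound (2 ^ j * \<delta>) \<le> fail_bound \<delta> * (1 / 2) ^ j"
proof -
  define P Q where "P = (20 / pm + 4096 * s2 * pM / (c * pm)\<^sup>2) / (N * \<delta>)"
    and "Q = 4096 * s2 * pM / (c * pm)\<^sup>2 / (N * a\<^sup>2 * \<delta> ^ 3)"
  have PQ: "0 \<le> P" "0 \<le> Q" unfolding P_def Q_def using pos N_pos s2_nonneg assms by auto
  have "fail_bound (2 ^ j * \<delta>) = P * (1 / 2) ^ j + Q * ((1 / 2) ^ j) ^ 3"
    unfolding fail_bound_def P_def Q_def by (simp add: power_mult_distrib power_divide ac_simps)
  also have "((1 / 2 :: real) ^ j) ^ 3 \<le> (1 / 2) ^ j"
    by (simp add: power_mult[symmetric] power_decreasing)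
  then have "P * (1 / 2) ^ j + Q * ((1 / 2) ^ j) ^ 3 \<le> P * (1 / 2) ^ j + Q * (1 / 2) ^ j"
    using PQ by (intro add_left_mono mult_left_mono) auto
  also have "\<dots> = fail_bound \<delta> * (1 / 2) ^ j" unfolding fail_bound_def P_def Q_def by (simp add: algebra_simps)
  finally show ?thesis .
qed

text \<open>Peeling: if the cut is farther than $d$ from \<open>ths\<close>, it lies between $\delta$ and $2 \delta$ for some
$\delta = 2^j d$, which split_not_at_scale excludes.  Only scales up to $\eta$ occur, by consistency,
and the failure probabilities are summable because they at least halve from one scale to the next.
Once the cut is within $d$, the levels follow from level_error.\<close>

theorem local_rate:
  assumes cons: "whp M p0 (\<lambda>\<omega>. \<bar>th \<omega> - ths\<bar> \<le> \<eta>)" and \<eta>: "\<eta> \<le> r / 2"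
    and d: "0 < d" "d \<le> r / 2" and k: "0 < k"
    and small: "\<And>\<delta>. d \<le> \<delta> \<Longrightarrow> \<delta> \<le> \<eta> \<Longrightarrow>
        16 * k / (pm * r) / sqrt N + 32 * C * pM / (pm * r) * \<delta> < min D (c * pm / (32 * pM) * min (a * \<delta>) 1)"
  shows "whp M (p0 + ((4 * C\<^sup>2 + 8 * s2) / k\<^sup>2 + 16 / (N * pm * r)) + 2 * fail_bound d + 2 / (N * pm * d))
    (\<lambda>\<omega>. \<bar>th \<omega> - ths\<bar> \<le> d
       \<and> \<bar>lo \<omega> - bl\<bar> \<le> 8 * k / (pm * r) / sqrt N + 16 * C * pM / (pm * r) * d
       \<and> \<bar>up \<omega> - bu\<bar> \<le> 8 * k / (pm * r) / sqrt N + 16 * C * pM / (pm * r) * d)"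
proof -
  define J where "J = {j::nat. 2 ^ j * d \<le> \<eta>}"
  obtain m :: nat where m: "\<eta> / d < 2 ^ m" using real_arch_pow[of 2 "\<eta> / d"] by auto
  have Jm: "J \<subseteq> {..<m}"
  proof
    fix j assume "j \<in> J"
    then have "2 ^ j \<le> \<eta> / d" using d by (simp add: J_def field_simps)
    then have "(2::real) ^ j < 2 ^ m" using m by linarith
    then show "j \<in> {..<m}" by simp
  qed
  then have finJ: "finite J" using finite_subset by blast
  have "0 \<le> fail_bound d" unfolding fail_bound_def using pos N_pos s2_nonneg d by auto
  then have sumJ: "(\<Sum>j\<in>J. fail_bound (2 ^ j * d)) \<le> 2 * fail_bound d"
  proof -
    have "(\<Sum>j\<in>J. fail_bound (2 ^ j * d)) \<le> (\<Sum>j\<in>J. fail_bound d * (1 / 2) ^ j)"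
      by (intro sum_mono fail_bound_dyadic d)
    also have "\<dots> \<le> (\<Sum>j<m. fail_bound d * (1 / 2) ^ j)"
      using Jm \<open>0 \<le> fail_bound d\<close> by (intro sum_mono2) auto
    also have "\<dots> = fail_bound d * (\<Sum>j<m. (1 / 2) ^ j)" by (simp add: sum_distrib_left)
    also have "\<dots> \<le> fail_bound d * 2"
      using \<open>0 \<le> fail_bound d\<close> by (intro mult_left_mono) (auto simp: geometric_sum)
    finally show ?thesis by simp
  qed
  have ball: "whp M (\<Sum>j\<in>J. fail_bound (2 ^ j * d)) (\<lambda>\<omega>. \<forall>j\<in>J. scale_tame (2 ^ j * d) \<omega>)"
    by (rule whp_finite_ball[OF finJ], rule whp_scale_tame) (use d \<eta> in \<open>auto simp: J_def\<close>)
  have cnt: "whp M (2 / (N * pm * d)) (\<lambda>\<omega>. count {ths - d<..ths + d} \<omega> \<le> 4 * N * pM * d)"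
    by (rule whp_mono[OF whp_count[of "ths - d" "ths + d"]]) (use d pos N_pos in \<open>auto simp: field_simps\<close>)
  have bnd: "(2 * k * sqrt N + C * (4 * N * pM * \<delta>)) / (N * pm * r / 4)
      = 8 * k / (pm * r) / sqrt N + 16 * C * pM / (pm * r) * \<delta>" for \<delta>
  proof -
    have "sqrt N / N = 1 / sqrt N" using N_pos real_sqrt_pow2[of N] by (simp add: field_simps power2_eq_square)
    then have "8 * k / (pm * r) * (sqrt N / N) = 8 * k / (pm * r) / sqrt N" by simp
    moreover have "2 * k * sqrt N / (N * pm * r / 4) = 8 * k / (pm * r) * (sqrt N / N)" by (simp add: ac_simps)
    moreover have "C * (4 * N * pM * \<delta>) / (N * pm * r / 4) = 16 * C * pM / (pm * r) * \<delta>"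
      using N_pos by simp
    ultimately show ?thesis by (simp only: add_divide_distrib)
  qed
  show ?thesis
  proof (rule whp_mono[OF whp_conj[OF whp_conj[OF whp_conj[OF cons whp_globally_tame[OF k]] ball] cnt]])
    show "p0 + ((4 * C\<^sup>2 + 8 * s2) / k\<^sup>2 + 16 / (N * pm * r)) + (\<Sum>j\<in>J. fail_bound (2 ^ j * d)) + 2 / (N * pm * d)
      \<le> p0 + ((4 * C\<^sup>2 + 8 * s2) / k\<^sup>2 + 16 / (N * pm * r)) + 2 * fail_bound d + 2 / (N * pm * d)"
      using sumJ by simp
    fix \<omega> assume \<omega>: "\<omega> \<in> space M" and "((\<bar>th \<omega> - ths\<bar> \<le> \<eta> \<and> globally_tame k \<omega>) \<and> (\<forall>j\<in>J. scale_tame (2 ^ j * d) \<omega>)) \<and>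
         count {ths - d<..ths + d} \<omega> \<le> 4 * N * pM * d"
    then have near: "\<bar>th \<omega> - ths\<bar> \<le> \<eta>" and tame: "globally_tame k \<omega>"
      and sc: "\<And>j. j \<in> J \<Longrightarrow> scale_tame (2 ^ j * d) \<omega>"
      and cd: "count {ths - d<..ths + d} \<omega> \<le> 4 * N * pM * d" by auto
    have near2: "\<bar>th \<omega> - ths\<bar> \<le> r / 2" using near \<eta> by linarith
    have thd: "\<bar>th \<omega> - ths\<bar> \<le> d"
    proof (rule ccontr)
      assume neg: "\<not> ?thesis"
      define t where "t = \<bar>th \<omega> - ths\<bar>"
      obtain m :: nat where m: "t / d < 2 ^ m" using real_arch_pow[of 2 "t / d"] by auto
      then have ex: "t \<le> 2 ^ m * d" using d by (simp add: field_simps)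
      define i where "i = (LEAST i. t \<le> 2 ^ i * d)"
      have i: "t \<le> 2 ^ i * d" unfolding i_def using ex by (rule LeastI)
      have "i \<noteq> 0" using i neg unfolding t_def by (auto intro!: gr0I)
      then obtain j where j: "i = Suc j" using not0_implies_Suc by blast
      have "\<not> t \<le> 2 ^ j * d" using not_less_Least[of j "\<lambda>i. t \<le> 2 ^ i * d"] j unfolding i_def by simp
      define \<delta> where "\<delta> = 2 ^ j * d"
      have dt: "\<delta> < t" "t \<le> 2 * \<delta>" using \<open>\<not> t \<le> 2 ^ j * d\<close> i j unfolding \<delta>_def by auto
      have d\<delta>: "d \<le> \<delta>" "0 < \<delta>" "\<delta> \<le> \<eta>"
        using d dt near unfolding \<delta>_def t_def by auto
      have jJ: "j \<in> J" using d\<delta>(3) unfolding J_def \<delta>_def by simp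
      have st: "scale_tame \<delta> \<omega>" using sc[OF jJ] unfolding \<delta>_def .
      have "card (hit {th \<omega><..ths} \<omega>) \<le> card (hit {ths - 2 * \<delta><..ths} \<omega>)"
        "card (hit {ths<..th \<omega>} \<omega>) \<le> card (hit {ths<..ths + 2 * \<delta>} \<omega>)"
        using dt unfolding t_def by (intro card_mono finite_hit hit_mono; auto)+
      then have B: "count {th \<omega><..ths} \<omega> \<le> 4 * N * pM * \<delta>" "count {ths<..th \<omega>} \<omega> \<le> 4 * N * pM * \<delta>"
        using st unfolding scale_tame_def by linarith+
      define E where "E = 8 * k / (pm * r) / sqrt N + 16 * C * pM / (pm * r) * \<delta>"
      have "\<bar>lo \<omega> - bl\<bar> \<le> E" "\<bar>up \<omega> - bu\<bar> \<le> E"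
        using level_error[OF \<omega> tame near2 B] unfolding bnd E_def by blast+
      then have "\<bar>lo \<omega> - bl\<bar> + \<bar>up \<omega> - bu\<bar> \<le> 2 * E" by linarith
      also have "2 * E = 16 * k / (pm * r) / sqrt N + 32 * C * pM / (pm * r) * \<delta>" unfolding E_def by simp
      also have "\<dots> < min D (c * pm / (32 * pM) * min (a * \<delta>) 1)" by (rule small[OF d\<delta>(1,3)])
      finally have "\<bar>lo \<omega> - bl\<bar> + \<bar>up \<omega> - bu\<bar> < D" "\<bar>lo \<omega> - bl\<bar> + \<bar>up \<omega> - bu\<bar> < c * pm / (32 * pM) * min (a * \<delta>) 1"
        by linarith+
      then show False using split_not_at_scale[OF \<omega> st d\<delta>(2)] dt unfolding t_def by blast
    qed
    have "card (hit {th \<omega><..ths} \<omega>) \<le> card (hit {ths - d<..ths + d} \<omega>)"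
        "card (hit {ths<..th \<omega>} \<omega>) \<le> card (hit {ths - d<..ths + d} \<omega>)"
      using thd d by (intro card_mono finite_hit hit_mono; auto)+
    then have B: "count {th \<omega><..ths} \<omega> \<le> 4 * N * pM * d" "count {ths<..th \<omega>} \<omega> \<le> 4 * N * pM * d"
      using cd by linarith+
    show "\<bar>th \<omega> - ths\<bar> \<le> d
       \<and> \<bar>lo \<omega> - bl\<bar> \<le> 8 * k / (pm * r) / sqrt N + 16 * C * pM / (pm * r) * d
       \<and> \<bar>up \<omega> - bu\<bar> \<le> 8 * k / (pm * r) / sqrt N + 16 * C * pM / (pm * r) * d"
      using thd level_error[OF \<omega> tame near2 B] unfolding bnd by blast
  qed
qed

end

section \<open>Consequences of the assumptions on the link and on the density\<close>

lemma mono_limits_bound: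
  fixes f :: "real \<Rightarrow> real"
  assumes "mono f" "(f \<longlongrightarrow> l) at_bot" "(f \<longlongrightarrow> u) at_top"
  shows "l \<le> f x" "f x \<le> u"
proof -
  have "eventually (\<lambda>y. f y \<le> f x) at_bot"
    unfolding eventually_at_bot_linorder using monoD[OF assms(1)] by blast
  then show "l \<le> f x" using tendsto_upperbound[OF assms(2)] by simp
  have "eventually (\<lambda>y. f x \<le> f y) at_top"
    unfolding eventually_at_top_linorder using monoD[OF assms(1)] by blast
  then show "f x \<le> u" using tendsto_lowerbound[OF assms(3)] by simp
qed

lemma average_increment_bounds:
  fixes f :: "real \<Rightarrow> real"
  assumes cont: "continuous_on UNIV f" and bnd: "\<And>x. l \<le> f x" "\<And>x. f x \<le> u"
  shows "0 < h \<Longrightarrow> 1 / \<bar>h\<bar> * (LBINT t=ereal 0..ereal h. f (t + z) - f z) \<le> u - f z"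
    and "h < 0 \<Longrightarrow> 1 / \<bar>h\<bar> * (LBINT t=ereal 0..ereal h. f (t + z) - f z) \<le> f z - l"
proof -
  have ct: "continuous_on S (\<lambda>t. f (t + z) - f z)" for S
    by (intro continuous_intros continuous_on_compose2[OF cont]) auto
  have int: "set_integrable lborel {x..y} (\<lambda>t. f (t + z) - f z)" for x y :: real
    by (rule borel_integrable_atLeastAtMost') (rule ct)
  have const: "set_integrable lborel {x..y} (\<lambda>_. k)" for x y k :: real
    by (rule borel_integrable_atLeastAtMost') (rule continuous_on_const)
  have cval: "(LBINT t:{x..y}. k) = (y - x) * k" if "x \<le> y" for x y k :: real
    using that by (subst set_integral_const) auto
  show "1 / \<bar>h\<bar> * (LBINT t=ereal 0..ereal h. f (t + z) - f z) \<le> u - f z" if h: "0 < h"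
  proof -
    have "(LBINT t=ereal 0..ereal h. f (t + z) - f z) = (LBINT t:{0..h}. f (t + z) - f z)"
      using h by (subst interval_integral_Icc) auto
    also have "\<dots> \<le> (LBINT t:{0..h}. u - f z)"
      by (rule set_integral_mono[OF int const]) (use bnd in auto)
    also have "\<dots> = h * (u - f z)" using cval[of 0 h] h by simp
    finally show ?thesis using h by (simp add: field_simps)
  qed
  show "1 / \<bar>h\<bar> * (LBINT t=ereal 0..ereal h. f (t + z) - f z) \<le> f z - l" if h: "h < 0"
  proof -
    have "(LBINT t=ereal 0..ereal h. f (t + z) - f z) = - (LBINT t=ereal h..ereal 0. f (t + z) - f z)"
      by (rule interval_integral_endpoints_reverse)
    also have "(LBINT t=ereal h..ereal 0. f (t + z) - f z) = (LBINT t:{h..0}. f (t + z) - f z)"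
      using h by (subst interval_integral_Icc) auto
    also have "(LBINT t:{h..0}. l - f z) \<le> (LBINT t:{h..0}. f (t + z) - f z)"
      by (rule set_integral_mono[OF const int]) (use bnd in auto)
    then have "- (LBINT t:{h..0}. f (t + z) - f z) \<le> - (LBINT t:{h..0}. l - f z)" by simp
    also have "\<dots> = - h * (f z - l)" using cval[of h 0] h by (simp add: algebra_simps)
    finally show ?thesis using h by (simp add: field_simps)
  qed
qed

text \<open>Averages of $f(t + \xi) - f(\xi)$ over $[0, h]$ are at most $u - f(\xi)$ for $h > 0$ and
at most $f(\xi) - l$ for $h < 0$.  A uniform lower bound on their limits inferior therefore separates
$f(\xi_n)$ from both limits of $f$.\<close>

lemma separated_from_limits:
  fixes f :: "real \<Rightarrow> real" and \<xi> :: "nat \<Rightarrow> real"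
  assumes cont: "continuous_on UNIV f" and bnd: "\<And>x. l \<le> f x" "\<And>x. f x \<le> u"
    and C1: "(INF n\<in>{1..}. Liminf at_infinity (\<lambda>h1::real.
               ereal (1 / \<bar>h1\<bar> * (LBINT t=ereal 0..ereal h1. f (t + \<xi> n) - f (\<xi> n))))) > 0"
  shows "\<exists>c>0. \<forall>n\<ge>1. f (\<xi> n) + c \<le> u \<and> l + c \<le> f (\<xi> n)"
proof -
  let ?A = "\<lambda>n h. 1 / \<bar>h\<bar> * (LBINT t=ereal 0..ereal h. f (t + \<xi> n) - f (\<xi> n))"
  obtain c :: real where c: "0 < c" "ereal c < (INF n\<in>{1..}. Liminf at_infinity (\<lambda>h1::real. ereal (?A n h1)))"
    using ereal_dense2[OF C1] by (auto simp: zero_ereal_def)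
  have "f (\<xi> n) + c \<le> u \<and> l + c \<le> f (\<xi> n)" if n: "1 \<le> n" for n
  proof -
    have "(INF n\<in>{1..}. Liminf at_infinity (\<lambda>h1::real. ereal (?A n h1))) \<le> Liminf at_infinity (\<lambda>h1::real. ereal (?A n h1))"
      using n by (intro INF_lower) auto
    then have "ereal c < Liminf at_infinity (\<lambda>h1::real. ereal (?A n h1))" using c by simp
    then have "eventually (\<lambda>h. ereal c < ereal (?A n h)) at_infinity" by (rule less_LiminfD)
    then obtain b where b: "\<And>h. b \<le> norm h \<Longrightarrow> c < ?A n h" unfolding eventually_at_infinity by auto
    have "c < ?A n (\<bar>b\<bar> + 1)" "c < ?A n (- \<bar>b\<bar> - 1)" by (rule b; simp)+
    moreover have "?A n (\<bar>b\<bar> + 1) \<le> u - f (\<xi> n)" by (rule average_increment_bounds(1)[OF cont bnd]) simp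
    moreover have "?A n (- \<bar>b\<bar> - 1) \<le> f (\<xi> n) - l" by (rule average_increment_bounds(2)[OF cont bnd]) simp
    ultimately show ?thesis by linarith
  qed
  then show ?thesis using c(1) by blast
qed

lemma bounded_if_separated:
  fixes f :: "real \<Rightarrow> real" and \<xi> :: "nat \<Rightarrow> real"
  assumes mono: "mono f" and lim: "(f \<longlongrightarrow> l) at_bot" "(f \<longlongrightarrow> u) at_top"
    and c: "0 < c" "\<And>n. 1 \<le> n \<Longrightarrow> f (\<xi> n) + c \<le> u \<and> l + c \<le> f (\<xi> n)"
  shows "\<exists>K>0. \<forall>n\<ge>1. \<bar>\<xi> n\<bar> \<le> K"
proof -
  have "eventually (\<lambda>x. f x < l + c) at_bot" using order_tendstoD(2)[OF lim(1)] c by simp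
  then obtain a where a: "\<And>x. x \<le> a \<Longrightarrow> f x < l + c" unfolding eventually_at_bot_linorder by blast
  have "eventually (\<lambda>x. u - c < f x) at_top" using order_tendstoD(1)[OF lim(2)] c by simp
  then obtain b where b: "\<And>x. b \<le> x \<Longrightarrow> u - c < f x" unfolding eventually_at_top_linorder by blast
  have "\<bar>\<xi> n\<bar> \<le> \<bar>a\<bar> + \<bar>b\<bar> + 1" if "1 \<le> n" for n
    using c(2)[OF that] a[of "\<xi> n"] b[of "\<xi> n"] by linarith
  then show ?thesis by (intro exI[of _ "\<bar>a\<bar> + \<bar>b\<bar> + 1"]) auto
qed

text \<open>The mean value theorem gives slope $c$ within distance $1$ of $\xi_n$; farther out, monotonicity keeps the
increment that has already been reached.\<close>

lemma uniform_slope: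
  fixes f :: "real \<Rightarrow> real" and \<xi> :: "nat \<Rightarrow> real"
  assumes diff: "\<And>x. f differentiable (at x)" and mono: "mono f"
    and C2: "(INF n\<in>{1..}. INF u\<in>{- 1 + \<xi> n..1 + \<xi> n}. ereal (deriv f u)) > 0"
  shows "\<exists>c>0. \<forall>n\<ge>1. \<forall>v\<ge>0. c * min v 1 \<le> f (\<xi> n + v) - f (\<xi> n) \<and> c * min v 1 \<le> f (\<xi> n) - f (\<xi> n - v)"
proof -
  obtain c :: real where c: "0 < c" "ereal c < (INF n\<in>{1..}. INF u\<in>{- 1 + \<xi> n..1 + \<xi> n}. ereal (deriv f u))"
    using ereal_dense2[OF C2] by (auto simp: zero_ereal_def)
  have dc: "c \<le> deriv f u" if "1 \<le> n" "\<xi> n - 1 \<le> u" "u \<le> \<xi> n + 1" for n u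
  proof -
    have "(INF n\<in>{1..}. INF u\<in>{- 1 + \<xi> n..1 + \<xi> n}. ereal (deriv f u)) \<le> (INF u\<in>{- 1 + \<xi> n..1 + \<xi> n}. ereal (deriv f u))"
      using that by (intro INF_lower) auto
    also have "\<dots> \<le> ereal (deriv f u)" using that by (intro INF_lower) auto
    finally have "ereal c < ereal (deriv f u)" by (rule less_le_trans[OF c(2)])
    then show ?thesis by simp
  qed
  have D: "(f has_real_derivative deriv f x) (at x)" for x
    using diff[of x] by (simp add: DERIV_deriv_iff_real_differentiable)
  have mvt: "c * (y - x) \<le> f y - f x" if "1 \<le> n" "\<xi> n - 1 \<le> x" "x \<le> y" "y \<le> \<xi> n + 1" for n x y
  proof (cases "x = y")
    case False
    then have "x < y" using that by simp
    then obtain z where z: "x < z" "z < y" "f y - f x = (y - x) * deriv f z"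
      using MVT2[of x y f "deriv f"] D by blast
    have "c * (y - x) \<le> deriv f z * (y - x)" using that z by (intro mult_right_mono dc[of n]) auto
    then show ?thesis using z by (simp add: mult.commute)
  qed simp
  have "c * min v 1 \<le> f (\<xi> n + v) - f (\<xi> n)" "c * min v 1 \<le> f (\<xi> n) - f (\<xi> n - v)" if "1 \<le> n" "0 \<le> v" for n v
  proof -
    have "c * (\<xi> n + min v 1 - \<xi> n) \<le> f (\<xi> n + min v 1) - f (\<xi> n)" using that by (intro mvt[of n]) auto
    also have "\<dots> \<le> f (\<xi> n + v) - f (\<xi> n)" using monoD[OF mono, of "\<xi> n + min v 1" "\<xi> n + v"] by simp
    finally show "c * min v 1 \<le> f (\<xi> n + v) - f (\<xi> n)" by simp
    have "c * (\<xi> n - (\<xi> n - min v 1)) \<le> f (\<xi> n) - f (\<xi> n - min v 1)" using that by (intro mvt[of n]) auto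
    also have "\<dots> \<le> f (\<xi> n) - f (\<xi> n - v)" using monoD[OF mono, of "\<xi> n - v" "\<xi> n - min v 1"] by simp
    finally show "c * min v 1 \<le> f (\<xi> n) - f (\<xi> n - v)" by simp
  qed
  then show ?thesis using c(1) by blast
qed

lemma density_interval_mass:
  fixes pX :: "real \<Rightarrow> real"
  assumes B: "prob_space B" and X0: "distributed B lborel X0 (\<lambda>x. ennreal (pX x))" "\<And>x. pX x \<ge> 0"
    and V: "open V" "\<theta> \<in> V" "pX \<theta> \<noteq> 0" "continuous_on V pX"
  shows "\<exists>r>0. \<exists>pm>0. \<exists>pM>0. \<forall>x y. \<theta> - r \<le> x \<longrightarrow> x \<le> y \<longrightarrow> y \<le> \<theta> + r \<longrightarrow>
     pm * (y - x) \<le> measure (distr B borel X0) {x<..y} \<and> measure (distr B borel X0) {x<..y} \<le> pM * (y - x)"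
proof -
  interpret prob_space B by fact
  have rv [measurable]: "random_variable borel X0" using distributed_measurable[OF X0(1)] by simp
  define p where "p = pX \<theta>"
  have p: "0 < p" using X0(2)[of \<theta>] V(3) by (simp add: p_def)
  have "isCont pX \<theta>" using V continuous_on_eq_continuous_at by blast
  then obtain d where d: "0 < d" "\<And>x. dist x \<theta> < d \<Longrightarrow> dist (pX x) p < p / 2"
    using p half_gt_zero unfolding p_def continuous_at_eps_delta by metis
  define r where "r = d / 2"
  have r: "0 < r" using d by (simp add: r_def)
  have px: "p / 2 \<le> pX x \<and> pX x \<le> 2 * p" if "\<theta> - r \<le> x" "x \<le> \<theta> + r" for x
    using d(2)[of x] that r unfolding r_def dist_real_def abs_less_iff by (auto simp: abs_if split: if_splits)
  have "p / 2 * (y - x) \<le> measure (distr B borel X0) {x<..y} \<and> measure (distr B borel X0) {x<..y} \<le> 2 * p * (y - x)"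
    if "\<theta> - r \<le> x" "x \<le> y" "y \<le> \<theta> + r" for x y
  proof -
    let ?m = "measure (distr B borel X0) {x<..y}"
    have "emeasure (distr B borel X0) {x<..y} = emeasure B (X0 -` {x<..y} \<inter> space B)"
      by (rule emeasure_distr) auto
    also have "\<dots> = (\<integral>\<^sup>+z. ennreal (pX z) * indicator {x<..y} z \<partial>lborel)"
      by (rule distributed_emeasure[OF X0(1)]) simp
    finally have e: "ennreal ?m = (\<integral>\<^sup>+z. ennreal (pX z) * indicator {x<..y} z \<partial>lborel)"
      by (metis emeasure_eq_measure finite_measure.emeasure_eq_measure prob_space.finite_measure prob_space_distr rv)
    have c: "(\<integral>\<^sup>+z. ennreal k * indicator {x<..y} z \<partial>lborel) = ennreal (k * (y - x))" if "0 \<le> k" for k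
      using \<open>x \<le> y\<close> that by (simp add: nn_integral_cmult_indicator ennreal_mult)
    have "(\<integral>\<^sup>+z. ennreal (p / 2) * indicator {x<..y} z \<partial>lborel) \<le> ennreal ?m" unfolding e
      using px that by (intro nn_integral_mono) (auto simp: indicator_def intro!: ennreal_leI)
    then have 1: "ennreal (p / 2 * (y - x)) \<le> ennreal ?m" using c[of "p / 2"] p by simp
    have "ennreal ?m \<le> (\<integral>\<^sup>+z. ennreal (2 * p) * indicator {x<..y} z \<partial>lborel)" unfolding e
      using px that by (intro nn_integral_mono) (auto simp: indicator_def intro!: ennreal_leI)
    then have 2: "ennreal ?m \<le> ennreal (2 * p * (y - x))" using c[of "2 * p"] p by simp
    show ?thesis using 1 2 p that by (simp add: ennreal_le_iff)
  qed
  then show ?thesis using r p by (intro exI[of _ r] conjI exI[of _ "p / 2"] exI[of _ "2 * p"]) auto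
qed

section \<open>The population minimiser\<close>

text \<open>The model along all stages, with the analytic assumptions replaced by their quantitative consequences:
a bound for $\xi_n$, a uniform slope of $f$ around $\xi_n$, and two-sided bounds for the
mass of intervals near $\theta_0$.\<close>

locale growing_jump =
  fixes f :: "real \<Rightarrow> real" and \<theta>0 \<beta>l0 \<beta>u0 \<sigma> :: real and \<alpha> :: "nat \<Rightarrow> real"
    and B :: "'b measure" and X0 \<epsilon>0 :: "'b \<Rightarrow> real"
    and P :: "nat \<Rightarrow> (real \<times> real) measure"
    and M :: "nat \<Rightarrow> 'w measure" and Y X :: "nat \<Rightarrow> nat \<Rightarrow> 'w \<Rightarrow> real"
    and \<theta>n \<beta>ln \<beta>un \<xi> :: "nat \<Rightarrow> real"
    and \<theta>hat \<beta>lhat \<beta>uhat :: "nat \<Rightarrow> 'w \<Rightarrow> real"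
    and r pm pM K0 c :: real
  assumes \<theta>0: "0 < \<theta>0" "\<theta>0 < 1"
    and f_mono: "mono f" and f_cont: "continuous_on UNIV f"
    and f_limits: "(f \<longlongrightarrow> \<beta>l0) at_bot" "(f \<longlongrightarrow> \<beta>u0) at_top" and jump: "\<beta>l0 < \<beta>u0"
    and \<alpha>: "\<And>n. n \<ge> 1 \<Longrightarrow> \<alpha> n > 0" "filterlim \<alpha> at_top sequentially"
    and B: "prob_space B" and X0: "X0 \<in> borel_measurable B"
    and \<epsilon>0: "\<epsilon>0 \<in> borel_measurable B" "integrable B (\<lambda>\<omega>. (\<epsilon>0 \<omega>)\<^sup>2)"
            "prob_space.expectation B \<epsilon>0 = 0" "prob_space.variance B \<epsilon>0 = \<sigma>\<^sup>2"
    and indep: "prob_space.indep_var B borel X0 borel \<epsilon>0"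
    and P: "\<And>n. P n = stage_law B X0 \<epsilon>0 (f_stage f \<alpha> \<theta>0 n)"
    and M: "\<And>n. n \<ge> 1 \<Longrightarrow> prob_space (M n)"
    and iid_indep: "\<And>n. n \<ge> 1 \<Longrightarrow> prob_space.indep_vars (M n) (\<lambda>_. borel \<Otimes>\<^sub>M borel)
                      (\<lambda>i \<omega>. (Y n i \<omega>, X n i \<omega>)) {1..n}"
    and iid_law: "\<And>n i. i \<in> {1..n} \<Longrightarrow>
                      distr (M n) (borel \<Otimes>\<^sub>M borel) (\<lambda>\<omega>. (Y n i \<omega>, X n i \<omega>)) = P n"
    and pop_range: "\<And>n. n \<ge> 1 \<Longrightarrow> \<theta>n n \<in> {0..1}"
    and pop_min: "\<And>n t l u. n \<ge> 1 \<Longrightarrow> t \<in> {0..1} \<Longrightarrow>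
         pop_risk (P n) (\<theta>n n, \<beta>ln n, \<beta>un n) \<le> pop_risk (P n) (t, l, u)"
    and est_range: "\<And>n \<omega>. n \<ge> 1 \<Longrightarrow> \<omega> \<in> space (M n) \<Longrightarrow> \<theta>hat n \<omega> \<in> {0..1}"
    and est_min: "\<And>n \<omega> t l u. n \<ge> 1 \<Longrightarrow> \<omega> \<in> space (M n) \<Longrightarrow> t \<in> {0..1} \<Longrightarrow>
        emp_risk n (\<lambda>i. (Y n i \<omega>, X n i \<omega>)) (\<theta>hat n \<omega>, \<beta>lhat n \<omega>, \<beta>uhat n \<omega>)
          \<le> emp_risk n (\<lambda>i. (Y n i \<omega>, X n i \<omega>)) (t, l, u)"
    and \<xi>: "\<And>n. \<xi> n = \<alpha> n * (\<theta>n n - \<theta>0)"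
    and pos: "0 < r" "0 < pm" "0 < pM" "0 < c" "0 < K0"
    and \<xi>_bounded: "\<And>n. n \<ge> 1 \<Longrightarrow> \<bar>\<xi> n\<bar> \<le> K0"
    and \<xi>_slope: "\<And>n v. n \<ge> 1 \<Longrightarrow> 0 \<le> v \<Longrightarrow> c * min v 1 \<le> f (\<xi> n + v) - f (\<xi> n)"
      "\<And>n v. n \<ge> 1 \<Longrightarrow> 0 \<le> v \<Longrightarrow> c * min v 1 \<le> f (\<xi> n) - f (\<xi> n - v)"
    and mass: "\<And>x y. \<theta>0 - r \<le> x \<Longrightarrow> x \<le> y \<Longrightarrow> y \<le> \<theta>0 + r \<Longrightarrow>
     pm * (y - x) \<le> measure (distr B borel X0) {x<..y} \<and> measure (distr B borel X0) {x<..y} \<le> pM * (y - x)"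
begin

definition "\<mu> = distr B borel X0"
definition "\<nu> = distr B borel \<epsilon>0"
definition g :: "nat \<Rightarrow> real \<Rightarrow> real" where "g n = f_stage f \<alpha> \<theta>0 n"
definition e :: "nat \<Rightarrow> nat \<Rightarrow> 'w \<Rightarrow> real" where "e n i \<omega> = Y n i \<omega> - g n (X n i \<omega>)"

lemma mu_prob: "prob_space \<mu>" and mu_sets: "sets \<mu> = sets borel"
  and nu_prob: "prob_space \<nu>" and nu_sets: "sets \<nu> = sets borel"
  unfolding \<mu>_def \<nu>_def using prob_space.prob_space_distr[OF B] X0 \<epsilon>0 by auto

sublocale mu: prob_space \<mu> by (rule mu_prob)
sublocale nu: prob_space \<nu> by (rule nu_prob)
sublocale BB: prob_space B by (rule B)
sublocale pp: pair_prob_space \<mu> \<nu> by unfold_locales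

lemmas [measurable_cong] = mu_sets nu_sets

lemma space_mu [simp]: "space \<mu> = UNIV" and space_nu [simp]: "space \<nu> = UNIV"
  unfolding \<mu>_def \<nu>_def by auto

lemma g_mono: "n \<ge> 1 \<Longrightarrow> mono (g n)"
  unfolding g_def f_stage_def mono_def using \<alpha>(1)[of n] monoD[OF f_mono] by (auto intro!: monoD[OF f_mono])

lemma f_meas [measurable]: "f \<in> borel_measurable borel"
  by (rule borel_measurable_mono[OF f_mono])

lemma g_meas [measurable]: "g n \<in> borel_measurable borel"
  unfolding g_def f_stage_def by measurable

lemma f_between: "\<beta>l0 \<le> f x" "f x \<le> \<beta>u0"
  using mono_limits_bound[OF f_mono f_limits] by auto

lemma g_between: "\<beta>l0 \<le> g n x" "g n x \<le> \<beta>u0"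
  unfolding g_def f_stage_def by (rule f_between)+

lemma nu_sq: "integrable \<nu> (\<lambda>y. y\<^sup>2)" and nu_mean: "(\<integral>y. y \<partial>\<nu>) = 0" and nu_var: "(\<integral>y. y\<^sup>2 \<partial>\<nu>) = \<sigma>\<^sup>2"
  unfolding \<nu>_def using \<epsilon>0 by (simp_all add: integrable_distr_eq integral_distr)

lemma nu_int: "integrable \<nu> (\<lambda>y. y)"
  by (rule nu.square_integrable_imp_integrable[OF _ nu_sq]) simp

lemma joint_law: "distr B (borel \<Otimes>\<^sub>M borel) (\<lambda>\<omega>. (X0 \<omega>, \<epsilon>0 \<omega>)) = \<mu> \<Otimes>\<^sub>M \<nu>"
  using BB.indep_var_distribution_eq[of borel X0 borel \<epsilon>0] indep unfolding \<mu>_def \<nu>_def by simp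

lemma P_law: "P n = distr (\<mu> \<Otimes>\<^sub>M \<nu>) (borel \<Otimes>\<^sub>M borel) (\<lambda>p. (g n (fst p) + snd p, fst p))"
  unfolding joint_law[symmetric] P stage_law_def g_def[symmetric] using X0 \<epsilon>0(1)
  by (subst distr_distr) (auto simp: comp_def)

text \<open>The map $(y, x) \mapsto (x, y - g(x))$ recovers design and error from an observation.\<close>

lemma sample:
  assumes n: "n \<ge> 1"
  shows "regression_sample (M n) n (X n) (e n) \<mu> \<nu> (\<sigma>\<^sup>2)"
proof -
  interpret Mn: prob_space "M n" by (rule M[OF n])
  have T [measurable]: "(\<lambda>p. (snd p, fst p - g n (snd p))) \<in> measurable (borel \<Otimes>\<^sub>M borel) (borel \<Otimes>\<^sub>M borel)" by measurable
  show ?thesis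
  proof (intro regression_sample.intro regression_sample_axioms.intro n Mn.prob_space_axioms mu_prob mu_sets nu_prob nu_sets nu_sq nu_mean nu_var)
    have "Mn.indep_vars (\<lambda>_. borel \<Otimes>\<^sub>M borel) (\<lambda>i \<omega>. (\<lambda>p. (snd p, fst p - g n (snd p))) (Y n i \<omega>, X n i \<omega>)) {1..n}"
      by (rule Mn.indep_vars_compose2[OF iid_indep[OF n]]) simp
    then show "Mn.indep_vars (\<lambda>_. borel \<Otimes>\<^sub>M borel) (\<lambda>i \<omega>. (X n i \<omega>, e n i \<omega>)) {1..n}" by (simp add: e_def)
    fix i assume i: "i \<in> {1..n}"
    have rv: "(\<lambda>\<omega>. (Y n i \<omega>, X n i \<omega>)) \<in> measurable (M n) (borel \<Otimes>\<^sub>M borel)"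
      using iid_indep[OF n] i unfolding Mn.indep_vars_def by auto
    have "distr (M n) (borel \<Otimes>\<^sub>M borel) (\<lambda>\<omega>. (X n i \<omega>, e n i \<omega>))
        = distr (P n) (borel \<Otimes>\<^sub>M borel) (\<lambda>p. (snd p, fst p - g n (snd p)))"
      unfolding iid_law[OF i, symmetric] by (subst distr_distr[OF T rv]) (simp add: comp_def e_def)
    also have "\<dots> = distr (\<mu> \<Otimes>\<^sub>M \<nu>) (borel \<Otimes>\<^sub>M borel) (\<lambda>p. p)"
      unfolding P_law by (subst distr_distr[OF T]) (auto simp: comp_def)
    also have "\<dots> = \<mu> \<Otimes>\<^sub>M \<nu>"
      by (rule distr_id2) (simp add: sets_pair_measure_cong[OF mu_sets nu_sets])
    finally show "distr (M n) (borel \<Otimes>\<^sub>M borel) (\<lambda>\<omega>. (X n i \<omega>, e n i \<omega>)) = \<mu> \<Otimes>\<^sub>M \<nu>" .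
  qed
qed

lemma fit:
  assumes n: "n \<ge> 1"
  shows "stump_fit (M n) n (X n) (e n) \<mu> \<nu> (\<sigma>\<^sup>2) (g n) (\<theta>hat n) (\<beta>lhat n) (\<beta>uhat n)"
proof -
  interpret S: regression_sample "M n" n "X n" "e n" \<mu> \<nu> "\<sigma>\<^sup>2" by (rule sample[OF n])
  have rss: "S.rss (g n) t l u \<omega> = real n * emp_risk n (\<lambda>i. (Y n i \<omega>, X n i \<omega>)) (t, l, u)" for t l u \<omega>
  proof -
    have "S.rss (g n) t l u \<omega> = (\<Sum>i=1..n. m_crit (t, l, u) (Y n i \<omega>, X n i \<omega>))"
      unfolding S.rss_def S.sum_hit sum.distrib[symmetric]
      by (intro sum.cong refl) (auto simp: e_def indicator_def)
    then show ?thesis using n by (simp add: emp_risk_def)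
  qed
  show ?thesis
  proof (intro stump_fit.intro stump_fit_axioms.intro S.regression_sample_axioms g_mono[OF n])
    show "\<theta>hat n \<omega> \<in> {0..1}" if "\<omega> \<in> space (M n)" for \<omega> using est_range[OF n that] .
    show "S.rss (g n) (\<theta>hat n \<omega>) (\<beta>lhat n \<omega>) (\<beta>uhat n \<omega>) \<omega> \<le> S.rss (g n) t l u \<omega>"
      if "\<omega> \<in> space (M n)" "t \<in> {0..1}" for \<omega> t l u
      unfolding rss using est_min[OF n that] by (intro mult_left_mono) auto
  qed
qed

definition step :: "real \<Rightarrow> real \<Rightarrow> real \<Rightarrow> real \<Rightarrow> real" where
  "step t l u x = (if x \<le> t then l else u)"

lemma step_meas [measurable]: "step t l u \<in> borel_measurable borel"
  unfolding step_def[abs_def] by measurable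

lemma bounded_integrable: "h \<in> borel_measurable borel \<Longrightarrow> (\<And>x. \<bar>h x\<bar> \<le> C) \<Longrightarrow> integrable \<mu> (h :: real \<Rightarrow> real)"
  by (rule mu.integrable_const_bound[where B = C]) auto

lemma g_step_bound: "\<bar>g n x - step t l u x\<bar> \<le> \<bar>\<beta>l0\<bar> + \<bar>\<beta>u0\<bar> + \<bar>l\<bar> + \<bar>u\<bar>"
  unfolding step_def using g_between[of n x] by auto

text \<open>Risk and squared $L^2(\mu)$ distance from $g$ differ by a constant, as the mixed term vanishes by
independence.  The population minimiser is thus the best two-valued approximation of $g$.\<close>

lemma pop_risk_bias_variance: "pop_risk (P n) (t, l, u) = (\<integral>x. (g n x - step t l u x)\<^sup>2 \<partial>\<mu>) + \<sigma>\<^sup>2"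
proof -
  define h where "h x = g n x - step t l u x" for x
  have [measurable]: "h \<in> borel_measurable borel" unfolding h_def by measurable
  have hb: "\<bar>h x\<bar> \<le> \<bar>\<beta>l0\<bar> + \<bar>\<beta>u0\<bar> + \<bar>l\<bar> + \<bar>u\<bar>" for x unfolding h_def by (rule g_step_bound)
  have i1: "integrable \<mu> h" by (rule bounded_integrable[OF _ hb]) simp
  have i2: "integrable \<mu> (\<lambda>x. (h x)\<^sup>2)"
    by (rule bounded_integrable[where C = "(\<bar>\<beta>l0\<bar> + \<bar>\<beta>u0\<bar> + \<bar>l\<bar> + \<bar>u\<bar>)\<^sup>2"]) (use power_mono[OF hb, of _ 2] in auto)
  have o: "integrable \<mu> (\<lambda>_. 1 :: real)" "integrable \<nu> (\<lambda>_. 1 :: real)" by auto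
  have o1: "measure \<mu> UNIV = 1" "measure \<nu> UNIV = 1" using mu.prob_space nu.prob_space by simp_all
  have m: "m_crit (t, l, u) (y, x) = (y - step t l u x)\<^sup>2" for x y by (simp add: step_def)
  have mm: "m_crit (t, l, u) = (\<lambda>p. (fst p - step t l u (snd p))\<^sup>2)" using m by auto
  have "pop_risk (P n) (t, l, u) = (\<integral>p. (h (fst p) + snd p)\<^sup>2 \<partial>(\<mu> \<Otimes>\<^sub>M \<nu>))"
    unfolding pop_risk_def P_law mm by (subst integral_distr) (auto simp: h_def algebra_simps)
  also have "\<dots> = (\<integral>p. (h (fst p))\<^sup>2 * 1 + 2 * (h (fst p) * snd p) + 1 * (snd p)\<^sup>2 \<partial>(\<mu> \<Otimes>\<^sub>M \<nu>))"
    by (simp add: power2_eq_square algebra_simps)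
  also have "\<dots> = (\<integral>x. (h x)\<^sup>2 \<partial>\<mu>) + \<sigma>\<^sup>2"
    using pp.product_integral[OF i2 o(2)] pp.product_integral[OF i1 nu_int] pp.product_integral[OF o(1) nu_sq] o1 nu_mean nu_var
    by simp
  finally show ?thesis unfolding h_def .
qed

lemma bias_min:
  assumes "n \<ge> 1" "t \<in> {0..1}"
  shows "(\<integral>x. (g n x - step (\<theta>n n) (\<beta>ln n) (\<beta>un n) x)\<^sup>2 \<partial>\<mu>) \<le> (\<integral>x. (g n x - step t l u x)\<^sup>2 \<partial>\<mu>)"
  using pop_min[OF assms, of l u] unfolding pop_risk_bias_variance by simp

lemma sq_integrable: "integrable \<mu> (\<lambda>x. (g n x - step t l u x)\<^sup>2)"
proof (rule bounded_integrable)
  show "\<bar>(g n x - step t l u x)\<^sup>2\<bar> \<le> (\<bar>\<beta>l0\<bar> + \<bar>\<beta>u0\<bar> + \<bar>l\<bar> + \<bar>u\<bar>)\<^sup>2" for x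
    using power_mono[OF g_step_bound[of n x t l u], of 2] by simp
qed measurable

lemma part_integrable:
  assumes [measurable]: "A \<in> sets borel"
  shows "integrable \<mu> (\<lambda>x. indicator A x * (k * g n x - b))"
proof (rule bounded_integrable)
  fix x
  have "\<bar>k * g n x\<bar> \<le> \<bar>k\<bar> * (\<bar>\<beta>l0\<bar> + \<bar>\<beta>u0\<bar>)"
    unfolding abs_mult using g_between[of n x] by (intro mult_left_mono) auto
  then show "\<bar>indicator A x * (k * g n x - b)\<bar> \<le> \<bar>k\<bar> * (\<bar>\<beta>l0\<bar> + \<bar>\<beta>u0\<bar>) + \<bar>b\<bar>"
    by (auto simp: indicator_def)
qed measurable

lemma normal_equations:
  assumes n: "n \<ge> 1"
  shows "(\<integral>x. indicator {..\<theta>n n} x * (g n x - \<beta>ln n) \<partial>\<mu>) = 0"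
    and "(\<integral>x. indicator {\<theta>n n<..} x * (g n x - \<beta>un n) \<partial>\<mu>) = 0"
proof -
  have I: "integrable \<mu> (\<lambda>x. indicator A x * (g n x - b))" if "A \<in> sets borel" for A b
    using part_integrable[OF that, of 1 n b] by simp
  have J: "integrable \<mu> (indicator A :: real \<Rightarrow> real)" if "A \<in> sets borel" for A
    using that by (auto simp: mu.emeasure_eq_measure mu_sets)
  show "(\<integral>x. indicator {..\<theta>n n} x * (g n x - \<beta>ln n) \<partial>\<mu>) = 0"
  proof (rule quadratic_min_at_0)
    fix h
    have "(\<integral>x. (g n x - step (\<theta>n n) (\<beta>ln n + h) (\<beta>un n) x)\<^sup>2 \<partial>\<mu>)
       = (\<integral>x. (g n x - step (\<theta>n n) (\<beta>ln n) (\<beta>un n) x)\<^sup>2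
           + (h\<^sup>2 * indicator {..\<theta>n n} x - 2 * h * (indicator {..\<theta>n n} x * (g n x - \<beta>ln n))) \<partial>\<mu>)"
      by (intro Bochner_Integration.integral_cong refl) (auto simp: step_def indicator_def power2_eq_square algebra_simps)
    also have "\<dots> = (\<integral>x. (g n x - step (\<theta>n n) (\<beta>ln n) (\<beta>un n) x)\<^sup>2 \<partial>\<mu>)
         + (h\<^sup>2 * (\<integral>x. indicator {..\<theta>n n} x \<partial>\<mu>) - 2 * h * (\<integral>x. indicator {..\<theta>n n} x * (g n x - \<beta>ln n) \<partial>\<mu>))"
      using sq_integrable I J by simp
    finally show "0 \<le> (\<integral>x. indicator {..\<theta>n n} x \<partial>\<mu>) * h\<^sup>2 - 2 * h * (\<integral>x. indicator {..\<theta>n n} x * (g n x - \<beta>ln n) \<partial>\<mu>)"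
      using bias_min[OF n pop_range[OF n], of "\<beta>ln n + h" "\<beta>un n"] by (simp add: mult.commute)
  qed
  show "(\<integral>x. indicator {\<theta>n n<..} x * (g n x - \<beta>un n) \<partial>\<mu>) = 0"
  proof (rule quadratic_min_at_0)
    fix h
    have "(\<integral>x. (g n x - step (\<theta>n n) (\<beta>ln n) (\<beta>un n + h) x)\<^sup>2 \<partial>\<mu>)
       = (\<integral>x. (g n x - step (\<theta>n n) (\<beta>ln n) (\<beta>un n) x)\<^sup>2
           + (h\<^sup>2 * indicator {\<theta>n n<..} x - 2 * h * (indicator {\<theta>n n<..} x * (g n x - \<beta>un n))) \<partial>\<mu>)"
      by (intro Bochner_Integration.integral_cong refl) (auto simp: step_def indicator_def power2_eq_square algebra_simps)
    also have "\<dots> = (\<integral>x. (g n x - step (\<theta>n n) (\<beta>ln n) (\<beta>un n) x)\<^sup>2 \<partial>\<mu>)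
         + (h\<^sup>2 * (\<integral>x. indicator {\<theta>n n<..} x \<partial>\<mu>) - 2 * h * (\<integral>x. indicator {\<theta>n n<..} x * (g n x - \<beta>un n) \<partial>\<mu>))"
      using sq_integrable I J by simp
    finally show "0 \<le> (\<integral>x. indicator {\<theta>n n<..} x \<partial>\<mu>) * h\<^sup>2 - 2 * h * (\<integral>x. indicator {\<theta>n n<..} x * (g n x - \<beta>un n) \<partial>\<mu>)"
      using bias_min[OF n pop_range[OF n], of "\<beta>ln n" "\<beta>un n + h"] by (simp add: mult.commute)
  qed
qed

lemma mass': "\<theta>0 - r \<le> x \<Longrightarrow> x \<le> y \<Longrightarrow> y \<le> \<theta>0 + r \<Longrightarrow>
     pm * (y - x) \<le> measure \<mu> {x<..y} \<and> measure \<mu> {x<..y} \<le> pM * (y - x)"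
  unfolding \<mu>_def by (rule mass)

text \<open>Moving the cut from $t$ to $s$ changes the squared distance by
$(u - l) \int_t^s (2 g - l - u)\, d\mu$.  If $2 g(t) \ne l + u$, continuity gives the integrand a fixed sign near $t$,
and a small move to one of the two sides would be an improvement.\<close>

lemma first_order_condition:
  assumes n: "n \<ge> 1" and near: "\<bar>\<theta>n n - \<theta>0\<bar> < r" "0 < \<theta>n n" "\<theta>n n < 1" and gap: "\<beta>ln n < \<beta>un n"
  shows "g n (\<theta>n n) = (\<beta>ln n + \<beta>un n) / 2"
proof -
  define t l u where "t = \<theta>n n" and "l = \<beta>ln n" and "u = \<beta>un n"
  define h where "h x = 2 * g n x - (l + u)" for x
  have cont: "isCont h t"
  proof -
    have "continuous_on UNIV (g n)" unfolding g_def f_stage_def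
      by (intro continuous_on_compose2[OF f_cont] continuous_intros) auto
    then have "isCont (g n) t" by (simp add: continuous_on_eq_continuous_at)
    then show ?thesis unfolding h_def by (intro continuous_intros)
  qed
  have I: "integrable \<mu> (\<lambda>x. indicator A x * h x)" if "A \<in> sets borel" for A
    unfolding h_def by (rule part_integrable[OF that])
  have J: "integrable \<mu> (indicator A :: real \<Rightarrow> real)" if "A \<in> sets borel" for A
    using that by (auto simp: mu.emeasure_eq_measure mu_sets)
  have min: "(\<integral>x. (g n x - step t l u x)\<^sup>2 \<partial>\<mu>) \<le> (\<integral>x. (g n x - step s l u x)\<^sup>2 \<partial>\<mu>)" if "s \<in> {0..1}" for s
    unfolding t_def l_def u_def by (rule bias_min[OF n that])
  have right: "0 \<le> (\<integral>x. indicator {t<..s} x * h x \<partial>\<mu>)" if s: "t \<le> s" "s \<le> 1" for s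
  proof -
    have "(\<integral>x. (g n x - step s l u x)\<^sup>2 \<partial>\<mu>)
       = (\<integral>x. (g n x - step t l u x)\<^sup>2 + (u - l) * (indicator {t<..s} x * h x) \<partial>\<mu>)"
      using s by (intro Bochner_Integration.integral_cong refl) (auto simp: h_def step_def indicator_def power2_eq_square algebra_simps)
    also have "\<dots> = (\<integral>x. (g n x - step t l u x)\<^sup>2 \<partial>\<mu>) + (u - l) * (\<integral>x. indicator {t<..s} x * h x \<partial>\<mu>)"
      using sq_integrable I by simp
    finally have "0 \<le> (u - l) * (\<integral>x. indicator {t<..s} x * h x \<partial>\<mu>)" using min[of s] s near unfolding t_def by simp
    then show ?thesis using gap by (simp add: zero_le_mult_iff l_def u_def)
  qed
  have left: "(\<integral>x. indicator {s<..t} x * h x \<partial>\<mu>) \<le> 0" if s: "s \<le> t" "0 \<le> s" for s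
  proof -
    have "(\<integral>x. (g n x - step s l u x)\<^sup>2 \<partial>\<mu>)
       = (\<integral>x. (g n x - step t l u x)\<^sup>2 - (u - l) * (indicator {s<..t} x * h x) \<partial>\<mu>)"
      using s by (intro Bochner_Integration.integral_cong refl) (auto simp: h_def step_def indicator_def power2_eq_square algebra_simps)
    also have "\<dots> = (\<integral>x. (g n x - step t l u x)\<^sup>2 \<partial>\<mu>) - (u - l) * (\<integral>x. indicator {s<..t} x * h x \<partial>\<mu>)"
      using sq_integrable I by simp
    finally have "(u - l) * (\<integral>x. indicator {s<..t} x * h x \<partial>\<mu>) \<le> 0" using min[of s] s near unfolding t_def by simp
    then show ?thesis using gap by (simp add: mult_le_0_iff l_def u_def)
  qed
  have "h t = 0"
  proof (rule ccontr)
    assume nz: "h t \<noteq> 0"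
    define k where "k = \<bar>h t\<bar> / 2"
    have k: "0 < k" using nz by (simp add: k_def)
    obtain d where d: "0 < d" "\<And>x. dist x t < d \<Longrightarrow> dist (h x) (h t) < k"
      using cont k unfolding continuous_at_eps_delta by metis
    define w where "w = min (d / 2) (min (min t (1 - t)) (r - \<bar>t - \<theta>0\<bar>))"
    have w: "0 < w" "w < d" "w \<le> t" "w \<le> 1 - t" "w \<le> r - \<bar>t - \<theta>0\<bar>"
      using d near unfolding w_def t_def by auto
    have hx: "\<bar>h x - h t\<bar> < k" if "\<bar>x - t\<bar> \<le> w" for x
      using d(2)[of x] that w by (simp add: dist_real_def)
    have E: "(\<integral>x. indicator A x * k \<partial>\<mu>) = measure \<mu> A * k" if "A \<in> sets borel" for A
      using that by (simp add: mu_sets)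
    show False
    proof (cases "h t < 0")
      case True
      have m: "0 < measure \<mu> {t<..t + w}"
      proof -
        have "pm * w \<le> measure \<mu> {t<..t + w}" using mass'[of t "t + w"] w by auto
        then show ?thesis using pos w by (smt (verit) mult_pos_pos)
      qed
      have "(\<integral>x. indicator {t<..t + w} x * h x \<partial>\<mu>) \<le> (\<integral>x. indicator {t<..t + w} x * (- k) \<partial>\<mu>)"
      proof (rule integral_mono[OF I])
        show "indicator {t<..t + w} x * h x \<le> indicator {t<..t + w} x * (- k)" for x
          using hx[of x] True unfolding k_def by (auto simp: indicator_def abs_if split: if_splits)
      qed (use J in auto)
      also have "\<dots> = - (measure \<mu> {t<..t + w} * k)" using E[of "{t<..t + w}"] by simp
      finally show False using right[of "t + w"] w m k by (smt (verit) mult_pos_pos)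
    next
      case False
      have m: "0 < measure \<mu> {t - w<..t}"
      proof -
        have "pm * w \<le> measure \<mu> {t - w<..t}" using mass'[of "t - w" t] w by auto
        then show ?thesis using pos w by (smt (verit) mult_pos_pos)
      qed
      have "(\<integral>x. indicator {t - w<..t} x * k \<partial>\<mu>) \<le> (\<integral>x. indicator {t - w<..t} x * h x \<partial>\<mu>)"
      proof (rule integral_mono[OF _ I])
        show "indicator {t - w<..t} x * k \<le> indicator {t - w<..t} x * h x" for x
        proof (cases "x \<in> {t - w<..t}")
          case True
          then have "\<bar>h x - h t\<bar> < k" using w by (intro hx) auto
          then have "h t - k < h x" by linarith
          moreover have "h t - k = k" using False by (simp add: k_def)
          ultimately show ?thesis using True by simp
        qed simp
      qed (use J in auto)
      then have "measure \<mu> {t - w<..t} * k \<le> (\<integral>x. indicator {t - w<..t} x * h x \<partial>\<mu>)" using E[of "{t - w<..t}"] by simp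
      then show False using left[of "t - w"] w m k by (smt (verit) mult_pos_pos)
    qed
  qed
  then show ?thesis unfolding h_def t_def l_def u_def by simp
qed

definition "bias n = (\<integral>x. \<bar>g n x - step \<theta>0 \<beta>l0 \<beta>u0 x\<bar> \<partial>\<mu>)"

text \<open>Away from $\theta_0$ the rescaled $f$ tends to its limits, and $\theta_0$ itself carries no mass.\<close>

lemma bias_tendsto_0: "bias \<longlonglongrightarrow> 0"
proof -
  have null: "measure \<mu> {\<theta>0} = 0"
  proof (rule ccontr)
    assume "measure \<mu> {\<theta>0} \<noteq> 0"
    then have p: "0 < measure \<mu> {\<theta>0}" using measure_nonneg[of \<mu> "{\<theta>0}"] by linarith
    define w where "w = min r (measure \<mu> {\<theta>0} / (2 * pM))"
    have w: "0 < w" "w \<le> r" "pM * w < measure \<mu> {\<theta>0}"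
    proof -
      have "pM * w \<le> pM * (measure \<mu> {\<theta>0} / (2 * pM))" using pos unfolding w_def by (intro mult_left_mono) auto
      also have "\<dots> < measure \<mu> {\<theta>0}" using pos p by simp
      finally show "pM * w < measure \<mu> {\<theta>0}" .
    qed (use pos p in \<open>auto simp: w_def\<close>)
    have "measure \<mu> {\<theta>0} \<le> measure \<mu> {\<theta>0 - w<..\<theta>0}" using w by (intro mu.finite_measure_mono) (auto simp: mu_sets)
    then show False using mass'[of "\<theta>0 - w" \<theta>0] w pos by auto
  qed
  have "AE x in \<mu>. x \<noteq> \<theta>0"
    using null by (intro AE_I'[of "{\<theta>0}"]) (auto simp: null_sets_def mu.emeasure_eq_measure mu_sets)
  then have lim: "AE x in \<mu>. (\<lambda>n. \<bar>g n x - step \<theta>0 \<beta>l0 \<beta>u0 x\<bar>) \<longlonglongrightarrow> 0"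
  proof (rule AE_mp, intro AE_I2 impI)
    fix x assume x: "x \<noteq> \<theta>0"
    have "(\<lambda>n. g n x) \<longlonglongrightarrow> step \<theta>0 \<beta>l0 \<beta>u0 x"
    proof (cases "x < \<theta>0")
      case True
      have "filterlim (\<lambda>n. (x - \<theta>0) * \<alpha> n) at_bot sequentially"
        by (rule filterlim_tendsto_neg_mult_at_bot[OF tendsto_const _ \<alpha>(2)]) (use True in auto)
      then have "(\<lambda>n. f ((x - \<theta>0) * \<alpha> n)) \<longlonglongrightarrow> \<beta>l0" by (rule filterlim_compose[OF f_limits(1)])
      then show ?thesis using True by (simp add: g_def f_stage_def step_def mult.commute)
    next
      case False
      have "filterlim (\<lambda>n. (x - \<theta>0) * \<alpha> n) at_top sequentially"
        by (rule filterlim_tendsto_pos_mult_at_top[OF tendsto_const _ \<alpha>(2)]) (use False x in auto)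
      then have "(\<lambda>n. f ((x - \<theta>0) * \<alpha> n)) \<longlonglongrightarrow> \<beta>u0" by (rule filterlim_compose[OF f_limits(2)])
      then show ?thesis using False x by (simp add: g_def f_stage_def step_def mult.commute)
    qed
    then have "(\<lambda>n. \<bar>g n x - step \<theta>0 \<beta>l0 \<beta>u0 x\<bar>) \<longlonglongrightarrow> \<bar>step \<theta>0 \<beta>l0 \<beta>u0 x - step \<theta>0 \<beta>l0 \<beta>u0 x\<bar>"
      by (intro tendsto_intros)
    then show "(\<lambda>n. \<bar>g n x - step \<theta>0 \<beta>l0 \<beta>u0 x\<bar>) \<longlonglongrightarrow> 0" by simp
  qed
  have "(\<lambda>n. \<integral>x. \<bar>g n x - step \<theta>0 \<beta>l0 \<beta>u0 x\<bar> \<partial>\<mu>) \<longlonglongrightarrow> (\<integral>x. 0 \<partial>\<mu>)"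
    by (rule integral_dominated_convergence[where w = "\<lambda>_. \<bar>\<beta>l0\<bar> + \<bar>\<beta>u0\<bar> + \<bar>\<beta>l0\<bar> + \<bar>\<beta>u0\<bar>"])
      (use lim g_step_bound[of _ _ \<theta>0 \<beta>l0 \<beta>u0] in \<open>simp_all add: AE_I2\<close>)
  then show ?thesis unfolding bias_def by simp
qed

lemma theta_close: "n \<ge> 1 \<Longrightarrow> \<bar>\<theta>n n - \<theta>0\<bar> \<le> K0 / \<alpha> n"
  using \<xi>_bounded[of n] \<alpha>(1)[of n] unfolding \<xi> by (simp add: abs_mult pos_le_divide_eq mult.commute)

lemma theta_tendsto: "\<theta>n \<longlonglongrightarrow> \<theta>0"
proof -
  have "(\<lambda>n. K0 / \<alpha> n) \<longlonglongrightarrow> 0"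
    by (rule real_tendsto_divide_at_top[OF tendsto_const \<alpha>(2)])
  moreover have "eventually (\<lambda>n. norm (\<theta>n n - \<theta>0) \<le> K0 / \<alpha> n) sequentially"
    using eventually_ge_at_top[of 1] by eventually_elim (use theta_close in auto)
  ultimately have "(\<lambda>n. \<theta>n n - \<theta>0) \<longlonglongrightarrow> 0" by (rule Lim_null_comparison[rotated])
  then show ?thesis by (simp add: LIM_zero_iff)
qed

end

section \<open>Rates along the sequence of stages\<close>

context growing_jump
begin

definition "\<Delta> = \<beta>u0 - \<beta>l0"

lemma Delta_pos: "0 < \<Delta>" using jump by (simp add: \<Delta>_def)

text \<open>The normal equation turns the level error times the mass of the block into the integral of
$g$ minus the limiting level.  This is controlled by the $L^1$ distance of $g$ from the limiting step and by the
mass between $\theta_0$ and the population cut.\<close>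

lemma level_bias:
  assumes n: "n \<ge> 1" and near: "\<bar>\<theta>n n - \<theta>0\<bar> \<le> r / 2"
  shows "\<bar>\<beta>ln n - \<beta>l0\<bar> \<le> (bias n + \<Delta> * pM * \<bar>\<theta>n n - \<theta>0\<bar>) / (pm * r / 2)"
    and "\<bar>\<beta>un n - \<beta>u0\<bar> \<le> (bias n + \<Delta> * pM * \<bar>\<theta>n n - \<theta>0\<bar>) / (pm * r / 2)"
proof -
  have near': "\<theta>0 - r / 2 \<le> \<theta>n n" "\<theta>n n \<le> \<theta>0 + r / 2" using near by linarith+
  have J: "integrable \<mu> (indicator A :: real \<Rightarrow> real)" if "A \<in> sets borel" for A
    using that by (auto simp: mu.emeasure_eq_measure mu_sets)
  have b: "integrable \<mu> (\<lambda>x. \<bar>g n x - step \<theta>0 \<beta>l0 \<beta>u0 x\<bar>)"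
    by (rule bounded_integrable[where C = "\<bar>\<beta>l0\<bar> + \<bar>\<beta>u0\<bar> + \<bar>\<beta>l0\<bar> + \<bar>\<beta>u0\<bar>"]) (use g_step_bound[of n _ \<theta>0 \<beta>l0 \<beta>u0] in auto)
  have main: "\<bar>v - w\<bar> \<le> (bias n + \<Delta> * pM * \<bar>\<theta>n n - \<theta>0\<bar>) / (pm * r / 2)"
    if A [measurable]: "A \<in> sets borel" and E: "E \<in> sets borel" and z: "(\<integral>x. indicator A x * (g n x - v) \<partial>\<mu>) = 0"
      and pw: "\<And>x. \<bar>indicator A x * (g n x - w)\<bar> \<le> \<bar>g n x - step \<theta>0 \<beta>l0 \<beta>u0 x\<bar> + \<Delta> * indicator E x"
      and mE: "measure \<mu> E \<le> pM * \<bar>\<theta>n n - \<theta>0\<bar>" and mA: "pm * r / 2 \<le> measure \<mu> A" for A E v w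
  proof -
    have I: "integrable \<mu> (\<lambda>x. indicator A x * (g n x - k))" for k
      using part_integrable[OF A, of 1 n k] by simp
    have "(\<integral>x. indicator A x * (g n x - w) \<partial>\<mu>) = (\<integral>x. indicator A x * (g n x - v) + (v - w) * indicator A x \<partial>\<mu>)"
      by (intro Bochner_Integration.integral_cong refl) (simp add: algebra_simps)
    also have "\<dots> = (v - w) * measure \<mu> A" using I J[OF A] z A by (simp add: mu_sets)
    finally have "\<bar>v - w\<bar> * measure \<mu> A = \<bar>\<integral>x. indicator A x * (g n x - w) \<partial>\<mu>\<bar>" by (simp add: abs_mult)
    also have "\<dots> \<le> (\<integral>x. \<bar>indicator A x * (g n x - w)\<bar> \<partial>\<mu>)" by (rule integral_abs_bound)
    also have "\<dots> \<le> (\<integral>x. \<bar>g n x - step \<theta>0 \<beta>l0 \<beta>u0 x\<bar> + \<Delta> * indicator E x \<partial>\<mu>)"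
      by (rule integral_mono) (use I b J[OF E] pw in auto)
    also have "\<dots> = bias n + \<Delta> * measure \<mu> E" unfolding bias_def using b J[OF E] E by (simp add: mu_sets)
    also have "\<dots> \<le> bias n + \<Delta> * (pM * \<bar>\<theta>n n - \<theta>0\<bar>)" using mE Delta_pos by (intro add_left_mono mult_left_mono) auto
    finally have "\<bar>v - w\<bar> * measure \<mu> A \<le> bias n + \<Delta> * pM * \<bar>\<theta>n n - \<theta>0\<bar>" by (simp add: mult.assoc)
    moreover have "\<bar>v - w\<bar> * (pm * r / 2) \<le> \<bar>v - w\<bar> * measure \<mu> A" using mA by (intro mult_left_mono) auto
    ultimately show ?thesis using pos by (subst pos_le_divide_eq) auto
  qed
  show "\<bar>\<beta>ln n - \<beta>l0\<bar> \<le> (bias n + \<Delta> * pM * \<bar>\<theta>n n - \<theta>0\<bar>) / (pm * r / 2)"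
  proof (rule main[of "{..\<theta>n n}" "{\<theta>0<..\<theta>n n}" "\<beta>ln n" \<beta>l0, OF _ _ normal_equations(1)[OF n]])
    show "\<bar>indicator {..\<theta>n n} x * (g n x - \<beta>l0)\<bar> \<le> \<bar>g n x - step \<theta>0 \<beta>l0 \<beta>u0 x\<bar> + \<Delta> * indicator {\<theta>0<..\<theta>n n} x" for x
      using g_between[of n x] by (auto simp: step_def indicator_def \<Delta>_def)
    show "measure \<mu> {\<theta>0<..\<theta>n n} \<le> pM * \<bar>\<theta>n n - \<theta>0\<bar>"
      using mass'[of \<theta>0 "\<theta>n n"] near' pos by (cases "\<theta>0 \<le> \<theta>n n") auto
    have "pm * r / 2 \<le> measure \<mu> {\<theta>0 - r<..\<theta>0 - r / 2}" using mass'[of "\<theta>0 - r" "\<theta>0 - r / 2"] pos by auto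
    also have "\<dots> \<le> measure \<mu> {..\<theta>n n}" using near' by (intro mu.finite_measure_mono) (auto simp: mu_sets)
    finally show "pm * r / 2 \<le> measure \<mu> {..\<theta>n n}" .
  qed auto
  show "\<bar>\<beta>un n - \<beta>u0\<bar> \<le> (bias n + \<Delta> * pM * \<bar>\<theta>n n - \<theta>0\<bar>) / (pm * r / 2)"
  proof (rule main[of "{\<theta>n n<..}" "{\<theta>n n<..\<theta>0}" "\<beta>un n" \<beta>u0, OF _ _ normal_equations(2)[OF n]])
    show "\<bar>indicator {\<theta>n n<..} x * (g n x - \<beta>u0)\<bar> \<le> \<bar>g n x - step \<theta>0 \<beta>l0 \<beta>u0 x\<bar> + \<Delta> * indicator {\<theta>n n<..\<theta>0} x" for x
      using g_between[of n x] by (auto simp: step_def indicator_def \<Delta>_def)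
    show "measure \<mu> {\<theta>n n<..\<theta>0} \<le> pM * \<bar>\<theta>n n - \<theta>0\<bar>"
      using mass'[of "\<theta>n n" \<theta>0] near' pos by (cases "\<theta>n n \<le> \<theta>0") auto
    have "pm * r / 2 \<le> measure \<mu> {\<theta>0 + r / 2<..\<theta>0 + r}" using mass'[of "\<theta>0 + r / 2" "\<theta>0 + r"] pos by auto
    also have "\<dots> \<le> measure \<mu> {\<theta>n n<..}" using near' by (intro mu.finite_measure_mono) (auto simp: mu_sets)
    finally show "pm * r / 2 \<le> measure \<mu> {\<theta>n n<..}" .
  qed auto
qed

lemma eventually_theta_near: "0 < w \<Longrightarrow> eventually (\<lambda>n. \<bar>\<theta>n n - \<theta>0\<bar> < w) sequentially"
  using tendstoD[OF theta_tendsto, of w] by (simp add: dist_real_def)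

lemma eventually_levels_near:
  assumes w: "0 < w"
  shows "eventually (\<lambda>n. \<bar>\<beta>ln n - \<beta>l0\<bar> < w \<and> \<bar>\<beta>un n - \<beta>u0\<bar> < w) sequentially"
proof -
  have "(\<lambda>n. (bias n + \<Delta> * pM * \<bar>\<theta>n n - \<theta>0\<bar>) / (pm * r / 2)) \<longlonglongrightarrow> (0 + \<Delta> * pM * \<bar>\<theta>0 - \<theta>0\<bar>) / (pm * r / 2)"
    using pos by (intro tendsto_intros bias_tendsto_0 theta_tendsto) auto
  then have "eventually (\<lambda>n. (bias n + \<Delta> * pM * \<bar>\<theta>n n - \<theta>0\<bar>) / (pm * r / 2) < w) sequentially"
    using w by (intro order_tendstoD(2)) auto
  moreover have "eventually (\<lambda>n. \<bar>\<theta>n n - \<theta>0\<bar> < r / 2) sequentially" using pos by (intro eventually_theta_near) auto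
  ultimately show ?thesis using eventually_ge_at_top[of 1]
    by eventually_elim (use level_bias in \<open>fastforce intro: le_less_trans\<close>)
qed

text \<open>The constants $\Delta / 2$ and $\Delta + 1$ leave room for population levels that are only close to their
limits.\<close>

lemma eventually_local:
  "eventually (\<lambda>n. n \<ge> 1 \<and> stump_local (M n) n (X n) (e n) \<mu> \<nu> (\<sigma>\<^sup>2) (g n) (\<theta>hat n) (\<beta>lhat n) (\<beta>uhat n)
     (\<theta>n n) (\<beta>ln n) (\<beta>un n) (r / 2) pm pM (\<Delta> + 1) (\<Delta> / 2) c (\<alpha> n)) sequentially"
proof -
  have 1: "eventually (\<lambda>n. \<bar>\<theta>n n - \<theta>0\<bar> < min (r / 2) (min \<theta>0 (1 - \<theta>0))) sequentially"
    using pos \<theta>0 by (intro eventually_theta_near) auto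
  have 2: "eventually (\<lambda>n. \<bar>\<beta>ln n - \<beta>l0\<bar> < min 1 (\<Delta> / 4) \<and> \<bar>\<beta>un n - \<beta>u0\<bar> < min 1 (\<Delta> / 4)) sequentially"
    using Delta_pos by (intro eventually_levels_near) auto
  show ?thesis using 1 2 eventually_ge_at_top[of 1]
  proof eventually_elim
    case (elim n)
    then have n: "n \<ge> 1" and near: "\<bar>\<theta>n n - \<theta>0\<bar> < r / 2" "0 < \<theta>n n" "\<theta>n n < 1" by auto
    have lev: "\<bar>\<beta>ln n - \<beta>l0\<bar> < 1" "\<bar>\<beta>ln n - \<beta>l0\<bar> < \<Delta> / 4" "\<bar>\<beta>un n - \<beta>u0\<bar> < 1" "\<bar>\<beta>un n - \<beta>u0\<bar> < \<Delta> / 4" using elim by auto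
    have gap: "\<Delta> / 2 \<le> \<beta>un n - \<beta>ln n"
    proof -
      have "\<beta>ln n - \<beta>l0 < \<Delta> / 4" by (rule le_less_trans[OF abs_ge_self lev(2)])
      moreover have "- (\<beta>un n - \<beta>u0) < \<Delta> / 4" by (rule le_less_trans[OF abs_ge_minus_self lev(4)])
      moreover have "\<beta>u0 = \<beta>l0 + \<Delta>" by (simp add: \<Delta>_def)
      ultimately show ?thesis by linarith
    qed
    have arg: "\<alpha> n * (\<theta>n n + v - \<theta>0) = \<xi> n + \<alpha> n * v" "\<alpha> n * (\<theta>n n - v - \<theta>0) = \<xi> n - \<alpha> n * v" "\<alpha> n * (\<theta>n n - \<theta>0) = \<xi> n" for v
      unfolding \<xi> by (simp_all add: algebra_simps)
    show ?case
    proof (intro conjI n stump_local.intro stump_local_axioms.intro fit[OF n] pop_range[OF n] normal_equations[OF n] gap)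
      show "g n (\<theta>n n) = (\<beta>ln n + \<beta>un n) / 2"
        by (rule first_order_condition[OF n]) (use near gap Delta_pos pos in auto)
      show "\<bar>g n x - \<beta>ln n\<bar> \<le> \<Delta> + 1" "\<bar>g n x - \<beta>un n\<bar> \<le> \<Delta> + 1" for x
        using g_between[of n x] lev unfolding \<Delta>_def by linarith+
      show "pm * (y - x) \<le> measure \<mu> {x<..y}" "measure \<mu> {x<..y} \<le> pM * (y - x)"
        if "\<theta>n n - r / 2 \<le> x" "x \<le> y" "y \<le> \<theta>n n + r / 2" for x y
        using mass'[of x y] that near by linarith+
      show "c * min (\<alpha> n * v) 1 \<le> g n (\<theta>n n + v) - g n (\<theta>n n)" if "0 \<le> v" for v
        unfolding g_def f_stage_def arg using \<xi>_slope(1)[OF n, of "\<alpha> n * v"] \<alpha>(1)[OF n] that by simp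
      show "c * min (\<alpha> n * v) 1 \<le> g n (\<theta>n n) - g n (\<theta>n n - v)" if "0 \<le> v" for v
        unfolding g_def f_stage_def arg using \<xi>_slope(2)[OF n, of "\<alpha> n * v"] \<alpha>(1)[OF n] that by simp
    qed (use pos Delta_pos \<alpha>(1)[OF n] in auto)
  qed
qed

lemma tail_small:
  assumes "0 < w"
  shows "\<exists>T\<ge>0. (\<integral>y. indicator {y. T < \<bar>y\<bar>} y * y\<^sup>2 \<partial>\<nu>) < w"
proof -
  have "(\<lambda>k. \<integral>y. indicator {y. real k < \<bar>y\<bar>} y * y\<^sup>2 \<partial>\<nu>) \<longlonglongrightarrow> (\<integral>y. 0 \<partial>\<nu>)"
  proof (rule integral_dominated_convergence[where w = "\<lambda>y. y\<^sup>2"])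
    show "AE y in \<nu>. (\<lambda>k. indicator {y. real k < \<bar>y\<bar>} y * y\<^sup>2) \<longlonglongrightarrow> (0 :: real)"
    proof (rule AE_I2)
      fix y :: real
      obtain k0 where "\<bar>y\<bar> \<le> real k0" using real_arch_simple by blast
      then have "eventually (\<lambda>k. indicator {y. real k < \<bar>y\<bar>} y * y\<^sup>2 = (0 :: real)) sequentially"
        by (intro eventually_mono[OF eventually_ge_at_top[of k0]]) (auto simp: indicator_def)
      then show "(\<lambda>k. indicator {y. real k < \<bar>y\<bar>} y * y\<^sup>2) \<longlonglongrightarrow> (0 :: real)" by (rule tendsto_eventually)
    qed
  qed (use nu_sq in \<open>auto simp: indicator_def\<close>)
  then have "eventually (\<lambda>k. (\<integral>y. indicator {y. real k < \<bar>y\<bar>} y * y\<^sup>2 \<partial>\<nu>) < w) sequentially"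
    using assms by (intro order_tendstoD(2)) auto
  then obtain k where "(\<integral>y. indicator {y. real k < \<bar>y\<bar>} y * y\<^sup>2 \<partial>\<nu>) < w"
    using eventually_happens' sequentially_bot by blast
  then show ?thesis by (intro exI[of _ "real k"]) auto
qed

lemma consistent:
  assumes \<eta>: "0 < \<eta>" "\<eta> \<le> r" and p: "0 < p"
  shows "eventually (\<lambda>n. whp (M n) p (\<lambda>\<omega>. \<bar>\<theta>hat n \<omega> - \<theta>0\<bar> \<le> \<eta>)) sequentially"
proof -
  define q where "q = pm * \<eta>"
  have q: "0 < q" using pos \<eta> by (simp add: q_def)
  have qm: "q \<le> measure \<mu> {\<theta>0 - \<eta><..\<theta>0}" "q \<le> measure \<mu> {\<theta>0<..\<theta>0 + \<eta>}"
    using mass'[of "\<theta>0 - \<eta>" \<theta>0] mass'[of \<theta>0 "\<theta>0 + \<eta>"] \<eta> unfolding q_def by auto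
  define W where "W = q * \<Delta>\<^sup>2 / 8"
  have W: "0 < W" using q Delta_pos by (simp add: W_def)
  \<comment> \<open>The budget $W$ is split by choosing first the tail level, then the threshold $T$,
     then the size $\zeta$ of small blocks and last the deviation $\rho$.\<close>
  define \<tau> where "\<tau> = W / 8"
  have \<tau>: "0 < \<tau>" using W by (simp add: \<tau>_def)
  obtain T where T: "0 \<le> T" "(\<integral>y. indicator {y. T < \<bar>y\<bar>} y * y\<^sup>2 \<partial>\<nu>) < p / 4 * \<tau>"
    using tail_small[of "p / 4 * \<tau>"] p \<tau> by auto
  define G where "G = \<Delta>\<^sup>2 + T\<^sup>2"
  have G: "0 \<le> G" by (simp add: G_def)
  define \<zeta> where "\<zeta> = W / (16 * (G + 1))"
  have \<zeta>: "0 < \<zeta>" using W G by (simp add: \<zeta>_def)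
  define S where "S = 8 / q + 1 / \<zeta>"
  have S: "0 < S" using q \<zeta> by (simp add: S_def add_pos_pos)
  define \<rho> where "\<rho> = min 1 (W / (64 * (S + 1)))"
  have \<rho>: "0 < \<rho>" "\<rho> \<le> 1" "\<rho> \<le> W / (64 * (S + 1))" using W S by (auto simp: \<rho>_def)
  have small: "8 * (2 * \<rho>)\<^sup>2 / q + (2 * \<rho>)\<^sup>2 / \<zeta> + (2 * (\<Delta>\<^sup>2 + T\<^sup>2) * \<zeta> + 2 * \<tau>) < q * (\<beta>u0 - \<beta>l0)\<^sup>2 / 8"
  proof -
    have "8 * (2 * \<rho>)\<^sup>2 / q + (2 * \<rho>)\<^sup>2 / \<zeta> = 4 * \<rho>\<^sup>2 * S" unfolding S_def by (simp add: power_mult_distrib algebra_simps)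
    also have "\<dots> \<le> 4 * \<rho> * S" using \<rho> S power_decreasing[of 1 2 \<rho>] by (intro mult_right_mono mult_left_mono) auto
    also have "\<dots> \<le> 4 * (W / (64 * (S + 1))) * S" using \<rho> S by (intro mult_right_mono mult_left_mono) auto
    also have "\<dots> = W / 16 * (S / (S + 1))" using S by (simp add: field_simps)
    also have "\<dots> \<le> W / 16 * 1" using S W by (intro mult_left_mono) auto
    finally have 1: "8 * (2 * \<rho>)\<^sup>2 / q + (2 * \<rho>)\<^sup>2 / \<zeta> \<le> W / 16" by simp
    have "2 * G * \<zeta> = W / 8 * (G / (G + 1))" unfolding \<zeta>_def using G by (simp add: field_simps)
    also have "\<dots> \<le> W / 8 * 1" using G W by (intro mult_left_mono) auto
    finally have 2: "2 * (\<Delta>\<^sup>2 + T\<^sup>2) * \<zeta> \<le> W / 8" unfolding G_def by simp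
    have 3: "2 * \<tau> = W / 4" by (simp add: \<tau>_def)
    have "W / 16 + (W / 8 + W / 4) < W" using W by simp
    then show ?thesis using 1 2 3 unfolding W_def[symmetric] \<Delta>_def[symmetric] by linarith
  qed
  have lim: "(\<lambda>n. 8 / (real n * q) + 4 * \<sigma>\<^sup>2 / (\<rho>\<^sup>2 * real n) + bias n / \<rho> + p / 4) \<longlonglongrightarrow> 0 + 0 + 0 / \<rho> + p / 4"
  proof (intro tendsto_add tendsto_const tendsto_divide bias_tendsto_0)
    show "(\<lambda>n. 8 / (real n * q)) \<longlonglongrightarrow> 0"
      by (rule real_tendsto_divide_at_top[OF tendsto_const])
        (use q in \<open>auto intro!: filterlim_at_top_mult_tendsto_pos[OF tendsto_const] filterlim_real_sequentially\<close>)
    show "(\<lambda>n. 4 * \<sigma>\<^sup>2 / (\<rho>\<^sup>2 * real n)) \<longlonglongrightarrow> 0"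
      by (rule real_tendsto_divide_at_top[OF tendsto_const])
        (use \<rho> in \<open>auto intro!: filterlim_tendsto_pos_mult_at_top[OF tendsto_const] filterlim_real_sequentially\<close>)
  qed (use \<rho> in auto)
  have "eventually (\<lambda>n. 8 / (real n * q) + 4 * \<sigma>\<^sup>2 / (\<rho>\<^sup>2 * real n) + bias n / \<rho> + p / 4 < p) sequentially"
    by (rule order_tendstoD(2)[OF lim]) (use p in simp)
  then show ?thesis using eventually_ge_at_top[of 1]
  proof eventually_elim
    case (elim n)
    interpret F: stump_fit "M n" n "X n" "e n" \<mu> \<nu> "\<sigma>\<^sup>2" "g n" "\<theta>hat n" "\<beta>lhat n" "\<beta>uhat n"
      by (rule fit[OF elim(2)])
    have "whp (M n) (8 / (real n * q) + 4 * \<sigma>\<^sup>2 / (\<rho>\<^sup>2 * real n) + bias n / \<rho> + p / 4 * \<tau> / \<tau>) (\<lambda>\<omega>. \<bar>\<theta>hat n \<omega> - \<theta>0\<bar> \<le> \<eta>)"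
    proof (rule F.fit_consistent[OF _ _ _ q qm _ _ \<rho>(1) \<zeta> \<tau> T(1) _ small])
      show "(\<integral>x. \<bar>g n x - (if x \<le> \<theta>0 then \<beta>l0 else \<beta>u0)\<bar> \<partial>\<mu>) \<le> bias n" by (simp add: bias_def step_def)
      show "\<bar>g n x - \<beta>l0\<bar> \<le> \<Delta>" "\<bar>g n x - \<beta>u0\<bar> \<le> \<Delta>" for x using g_between[of n x] by (auto simp: \<Delta>_def)
    qed (use \<theta>0 T \<eta> in auto)
    then show ?case by (rule whp_mono) (use elim \<tau> in auto)
  qed
qed

text \<open>The hypotheses on $\tau$ say that both terms of fail_bound are of order one at scale $\tau_n$;
at $K \tau_n$ they are of order $1 / K$.  They also imply $\alpha_n \tau_n \sqrt n \ge 1$ once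
$\tau_n \le 1$, so that the part of order $n^{-1/2}$ of the level error stays below the drift from scale $K \tau_n$ on.  The part
proportional to the scale is below the drift because the scale is small and $\alpha_n$ is large.\<close>

theorem rate:
  fixes \<tau> :: "nat \<Rightarrow> real"
  assumes \<tau>: "eventually (\<lambda>n. 0 < \<tau> n \<and> 1 \<le> real n * \<tau> n \<and> 1 \<le> real n * (\<alpha> n)\<^sup>2 * \<tau> n ^ 3) sequentially"
    and \<tau>0: "\<tau> \<longlonglongrightarrow> 0" and p: "0 < p"
  shows "\<exists>K>0. eventually (\<lambda>n. whp (M n) p (\<lambda>\<omega>. \<bar>\<theta>hat n \<omega> - \<theta>n n\<bar> \<le> K * \<tau> n
     \<and> \<bar>\<beta>lhat n \<omega> - \<beta>ln n\<bar> \<le> K * (1 / sqrt (real n) + \<tau> n)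
     \<and> \<bar>\<beta>uhat n \<omega> - \<beta>un n\<bar> \<le> K * (1 / sqrt (real n) + \<tau> n))) sequentially"
proof -
  define R where "R = r / 2"
  define C where "C = \<Delta> + 1"
  define D where "D = \<Delta> / 2"
  have pos': "0 < R" "0 < C" "0 < D" using pos Delta_pos by (auto simp: R_def C_def D_def)
  define c3 where "c3 = c * pm / (32 * pM)"
  define C5 where "C5 = 32 * C * pM / (pm * R)"
  have c35: "0 < c3" "0 < C5" using pos pos' by (auto simp: c3_def C5_def)
  define V where "V = 4 * C\<^sup>2 + 8 * \<sigma>\<^sup>2"
  have V: "0 < V" using pos' by (simp add: V_def add_pos_nonneg)
  define k where "k = sqrt (8 * V / p)"
  have k: "0 < k" "V / k\<^sup>2 = p / 8" using V p by (auto simp: k_def)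
  define k1 where "k1 = 16 * k / (pm * R)"
  have k1: "0 < k1" using k pos pos' by (simp add: k1_def)
  \<comment> \<open>Up to this distance the level error cannot reverse the order of the levels or outweigh a saturated drift.\<close>
  define \<eta> where "\<eta> = min (R / 2) (min (D / (4 * C5)) (c3 / (4 * C5)))"
  have \<eta>: "0 < \<eta>" "\<eta> \<le> R / 2" "C5 * \<eta> \<le> D / 4" "C5 * \<eta> \<le> c3 / 4"
  proof -
    show "0 < \<eta>" "\<eta> \<le> R / 2" using pos' c35 by (auto simp: \<eta>_def)
    have "\<eta> \<le> D / (4 * C5)" "\<eta> \<le> c3 / (4 * C5)" by (auto simp: \<eta>_def)
    then show "C5 * \<eta> \<le> D / 4" "C5 * \<eta> \<le> c3 / 4" using c35 by (auto simp: field_simps)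
  qed
  define A where "A = 20 / pm + 4096 * \<sigma>\<^sup>2 * pM / (c * pm)\<^sup>2"
  define Q where "Q = 4096 * \<sigma>\<^sup>2 * pM / (c * pm)\<^sup>2"
  have AQ: "0 < A" "0 \<le> Q" using pos by (auto simp: A_def Q_def add_pos_nonneg)
  define K where "K = max 1 (max (4 * k1 / c3) (8 * (2 * (A + Q) + 2 / pm) / p))"
  have K: "1 \<le> K" "4 * k1 / c3 \<le> K" "8 * (2 * (A + Q) + 2 / pm) / p \<le> K" by (auto simp: K_def)
  define K' where "K' = K + 8 * k / (pm * R) + 16 * C * pM / (pm * R) * K"
  have K': "K \<le> K'" "8 * k / (pm * R) \<le> K'" "16 * C * pM / (pm * R) * K \<le> K'" "0 < K'"
    using K k pos pos' unfolding K'_def by (auto simp: add_nonneg_nonneg add_pos_nonneg)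
  have cons: "eventually (\<lambda>n. whp (M n) (p / 8) (\<lambda>\<omega>. \<bar>\<theta>hat n \<omega> - \<theta>0\<bar> \<le> \<eta> / 2)) sequentially"
    by (rule consistent) (use \<eta> p pos pos' in \<open>auto simp: R_def\<close>)
  have near: "eventually (\<lambda>n. \<bar>\<theta>n n - \<theta>0\<bar> < \<eta> / 2) sequentially" using \<eta> by (intro eventually_theta_near) simp
  have small\<tau>: "eventually (\<lambda>n. \<tau> n < min 1 (R / (2 * K))) sequentially"
    by (rule order_tendstoD(2)[OF \<tau>0]) (use pos' K in auto)
  have big\<alpha>: "eventually (\<lambda>n. 4 * C5 / c3 < \<alpha> n) sequentially"
    using \<alpha>(2) unfolding filterlim_at_top_dense by blast
  define nb where "nb = Max {16 * 8 / (pm * R * p), (4 * k1 / D)\<^sup>2, (4 * k1 / c3)\<^sup>2}"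
  have bign: "eventually (\<lambda>n. nb < real n) sequentially"
    using filterlim_real_sequentially unfolding filterlim_at_top_dense by blast
  have "eventually (\<lambda>n. whp (M n) p (\<lambda>\<omega>. \<bar>\<theta>hat n \<omega> - \<theta>n n\<bar> \<le> K' * \<tau> n
     \<and> \<bar>\<beta>lhat n \<omega> - \<beta>ln n\<bar> \<le> K' * (1 / sqrt (real n) + \<tau> n)
     \<and> \<bar>\<beta>uhat n \<omega> - \<beta>un n\<bar> \<le> K' * (1 / sqrt (real n) + \<tau> n))) sequentially"
    using cons near small\<tau> big\<alpha> bign \<tau> eventually_local
  proof eventually_elim
    case (elim n)
    define N where "N = real n"
    define a where "a = \<alpha> n"
    define t where "t = \<tau> n"
    have n: "n \<ge> 1" and N: "0 < N" using elim by (auto simp: N_def)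
    have loc: "stump_local (M n) n (X n) (e n) \<mu> \<nu> (\<sigma>\<^sup>2) (g n) (\<theta>hat n) (\<beta>lhat n) (\<beta>uhat n)
     (\<theta>n n) (\<beta>ln n) (\<beta>un n) R pm pM C D c a" using elim unfolding R_def C_def D_def a_def by blast
    interpret L: stump_local "M n" n "X n" "e n" \<mu> \<nu> "\<sigma>\<^sup>2" "g n" "\<theta>hat n" "\<beta>lhat n" "\<beta>uhat n"
       "\<theta>n n" "\<beta>ln n" "\<beta>un n" R pm pM C D c a by (rule loc)
    have t: "0 < t" "1 \<le> N * t" "1 \<le> N * a\<^sup>2 * t ^ 3" "t < 1" "t < R / (2 * K)"
      using elim unfolding t_def N_def a_def by auto
    have a: "0 < a" "4 * C5 / c3 < a" using \<alpha>(1)[OF n] elim unfolding a_def by auto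
    have nbN: "16 * 8 / (pm * R * p) < N" "(4 * k1 / D)\<^sup>2 < N" "(4 * k1 / c3)\<^sup>2 < N"
      using elim(5) unfolding nb_def N_def by auto
    define d where "d = K * t"
    have d: "0 < d" "d \<le> R / 2" using t K by (auto simp: d_def field_simps)
    have c1: "whp (M n) (p / 8) (\<lambda>\<omega>. \<bar>\<theta>hat n \<omega> - \<theta>n n\<bar> \<le> \<eta>)"
      by (rule whp_mono[OF elim(1)]) (use elim(2) in \<open>auto simp: abs_if split: if_splits\<close>)
    have sqN: "0 < sqrt N" "4 * k1 / D < sqrt N" "4 * k1 / c3 < sqrt N"
      using N nbN k1 pos' c35 by (auto intro!: real_less_rsqrt)
    then have kN: "k1 / sqrt N < D / 4" "k1 / sqrt N < c3 / 4"
      using pos' c35 by (auto simp: field_simps)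
    have atN: "1 \<le> a * t * sqrt N"
    proof -
      have "N * a\<^sup>2 * t ^ 3 \<le> N * a\<^sup>2 * t\<^sup>2" using t N by (intro mult_left_mono power_decreasing) auto
      also have "\<dots> = (a * t * sqrt N)\<^sup>2" using N by (simp add: power_mult_distrib)
      finally have "1 \<le> (a * t * sqrt N)\<^sup>2" using t(3) by linarith
      then have "1\<^sup>2 \<le> (a * t * sqrt N)\<^sup>2" by (simp only: one_power2)
      moreover have "0 \<le> a * t * sqrt N" using a t N by (intro mult_nonneg_nonneg) auto
      ultimately show ?thesis by (rule power2_le_imp_le)
    qed
    have small: "16 * k / (pm * R) / sqrt (real n) + 32 * C * pM / (pm * R) * \<delta> < min D (c * pm / (32 * pM) * min (a * \<delta>) 1)"
      if \<delta>: "d \<le> \<delta>" "\<delta> \<le> \<eta>" for \<delta>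
    proof -
      have "C5 * \<delta> \<le> C5 * \<eta>" using \<delta> c35 by (intro mult_left_mono) auto
      then have C5\<delta>: "C5 * \<delta> \<le> D / 4" "C5 * \<delta> \<le> c3 / 4" using \<eta> by linarith+
      have \<delta>0: "0 < \<delta>" using \<delta> d by linarith
      have "k1 / sqrt N * 1 \<le> k1 / sqrt N * (a * t * sqrt N)" using atN k1 sqN(1) by (intro mult_left_mono) auto
      also have "\<dots> = k1 * (a * t)" using sqN(1) by simp
      also have "\<dots> \<le> c3 / 4 * K * (a * t)" using K(2) c35 a t by (intro mult_right_mono) (auto simp: field_simps)
      also have "\<dots> = c3 / 4 * (a * d)" by (simp add: d_def)
      also have "\<dots> \<le> c3 / 4 * (a * \<delta>)" using \<delta> c35 a by (intro mult_left_mono) auto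
      finally have k1\<delta>: "k1 / sqrt N \<le> c3 / 4 * (a * \<delta>)" by simp
      have "C5 \<le> c3 / 4 * a" using a c35 by (simp add: field_simps)
      then have "C5 * \<delta> \<le> c3 / 4 * a * \<delta>" using \<delta>0 by (intro mult_right_mono) auto
      then have "k1 / sqrt N + C5 * \<delta> \<le> c3 / 4 * (a * \<delta>) + c3 / 4 * a * \<delta>" using k1\<delta> by (rule add_mono[rotated])
      also have "\<dots> = c3 * (a * \<delta>) / 2" by simp
      also have "\<dots> < c3 * (a * \<delta>)" using c35 a \<delta>0 by simp
      finally have "k1 / sqrt N + C5 * \<delta> < c3 * min (a * \<delta>) 1" using kN C5\<delta> c35 by (auto simp: min_def)
      moreover have "k1 / sqrt N + C5 * \<delta> < D" using kN C5\<delta> pos' by linarith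
      ultimately show ?thesis unfolding k1_def C5_def c3_def N_def by simp
    qed
    have main: "whp (M n) (p / 8 + ((4 * C\<^sup>2 + 8 * \<sigma>\<^sup>2) / k\<^sup>2 + 16 / (real n * pm * R)) + 2 * L.fail_bound d + 2 / (real n * pm * d))
      (\<lambda>\<omega>. \<bar>\<theta>hat n \<omega> - \<theta>n n\<bar> \<le> d
       \<and> \<bar>\<beta>lhat n \<omega> - \<beta>ln n\<bar> \<le> 8 * k / (pm * R) / sqrt (real n) + 16 * C * pM / (pm * R) * d
       \<and> \<bar>\<beta>uhat n \<omega> - \<beta>un n\<bar> \<le> 8 * k / (pm * R) / sqrt (real n) + 16 * C * pM / (pm * R) * d)"
      by (rule L.local_rate[OF c1 \<eta>(2) d k(1) small])
    show ?case
    proof (rule whp_mono[OF main])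
      have e1: "(4 * C\<^sup>2 + 8 * \<sigma>\<^sup>2) / k\<^sup>2 = p / 8" using k unfolding V_def by simp
      have e2: "16 / (N * pm * R) \<le> p / 8" using nbN(1) N pos pos' p by (simp add: field_simps)
      have Nd: "K \<le> N * d" using t K unfolding d_def by (simp add: mult.left_commute mult_le_cancel_left1)
      have Nd3: "K \<le> N * a\<^sup>2 * d ^ 3"
      proof -
        have "K \<le> K ^ 3 * 1" using K(1) power_increasing[of 1 3 K] by simp
        also have "\<dots> \<le> K ^ 3 * (N * a\<^sup>2 * t ^ 3)" using t K by (intro mult_left_mono) auto
        finally show ?thesis unfolding d_def by (simp add: power_mult_distrib ac_simps)
      qed
      have K0: "0 < K" using K by simp
      have "L.fail_bound d = A / (N * d) + Q / (N * a\<^sup>2 * d ^ 3)" unfolding L.fail_bound_def A_def Q_def N_def ..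
      also have "\<dots> \<le> A / K + Q / K" using Nd Nd3 AQ K0 N d(1) a(1) by (intro add_mono divide_left_mono mult_pos_pos) auto
      finally have fb: "L.fail_bound d \<le> (A + Q) / K" by (simp add: add_divide_distrib)
      have "2 / (N * pm * d) = 2 / pm / (N * d)" by (simp add: field_simps)
      also have "\<dots> \<le> 2 / pm / K" using Nd K0 pos N d(1) by (intro divide_left_mono mult_pos_pos) auto
      finally have f2: "2 / (N * pm * d) \<le> 2 / pm / K" .
      have "(2 * (A + Q) + 2 / pm) / K \<le> p / 8" using K(3) K0 p by (simp add: field_simps)
      then have "2 * ((A + Q) / K) + 2 / pm / K \<le> p / 8" by (simp add: add_divide_distrib)
      then have "2 * L.fail_bound d + 2 / (N * pm * d) \<le> p / 8" using fb f2 by linarith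
      then show "p / 8 + ((4 * C\<^sup>2 + 8 * \<sigma>\<^sup>2) / k\<^sup>2 + 16 / (real n * pm * R)) + 2 * L.fail_bound d + 2 / (real n * pm * d) \<le> p"
        using e1 e2 p unfolding N_def by linarith
      fix \<omega>
      have th: "d \<le> K' * \<tau> n" using K'(1) t unfolding d_def t_def by (intro mult_right_mono) auto
      have lv: "8 * k / (pm * R) / sqrt (real n) + 16 * C * pM / (pm * R) * d \<le> K' * (1 / sqrt (real n) + \<tau> n)"
      proof -
        have "8 * k / (pm * R) * (1 / sqrt (real n)) \<le> K' * (1 / sqrt (real n))" using K' by (intro mult_right_mono) auto
        moreover have "16 * C * pM / (pm * R) * K * \<tau> n \<le> K' * \<tau> n" using K' t unfolding t_def by (intro mult_right_mono) auto
        ultimately show ?thesis unfolding d_def t_def by (simp add: algebra_simps)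
      qed
      assume "\<bar>\<theta>hat n \<omega> - \<theta>n n\<bar> \<le> d
       \<and> \<bar>\<beta>lhat n \<omega> - \<beta>ln n\<bar> \<le> 8 * k / (pm * R) / sqrt (real n) + 16 * C * pM / (pm * R) * d
       \<and> \<bar>\<beta>uhat n \<omega> - \<beta>un n\<bar> \<le> 8 * k / (pm * R) / sqrt (real n) + 16 * C * pM / (pm * R) * d"
      then show "\<bar>\<theta>hat n \<omega> - \<theta>n n\<bar> \<le> K' * \<tau> n
     \<and> \<bar>\<beta>lhat n \<omega> - \<beta>ln n\<bar> \<le> K' * (1 / sqrt (real n) + \<tau> n)
     \<and> \<bar>\<beta>uhat n \<omega> - \<beta>un n\<bar> \<le> K' * (1 / sqrt (real n) + \<tau> n)"
        using th lv by (meson order_trans)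
    qed
  qed
  then show ?thesis using K'(4) by blast
qed

end

section \<open>The three growth regimes\<close>

context growing_jump
begin

lemma bounded_in_prob_scaled:
  fixes \<tau> a b :: "nat \<Rightarrow> real"
  assumes \<tau>: "eventually (\<lambda>n. 0 < \<tau> n \<and> 1 \<le> real n * \<tau> n \<and> 1 \<le> real n * (\<alpha> n)\<^sup>2 * \<tau> n ^ 3) sequentially"
    and \<tau>0: "\<tau> \<longlonglongrightarrow> 0"
    and ab: "eventually (\<lambda>n. 0 \<le> a n \<and> a n * \<tau> n \<le> 1 \<and> 0 \<le> b n \<and> b n * (1 / sqrt (real n) + \<tau> n) \<le> 2) sequentially"
  shows "bounded_in_prob M (\<lambda>n \<omega>. a n * \<bar>\<theta>hat n \<omega> - \<theta>n n\<bar>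
      + b n * \<bar>\<beta>lhat n \<omega> - \<beta>ln n\<bar> + b n * \<bar>\<beta>uhat n \<omega> - \<beta>un n\<bar>)"
  unfolding bounded_in_prob_def
proof (intro allI impI)
  fix p :: real assume p: "0 < p"
  then obtain K where K: "0 < K" and ev: "eventually (\<lambda>n. whp (M n) (p / 2) (\<lambda>\<omega>. \<bar>\<theta>hat n \<omega> - \<theta>n n\<bar> \<le> K * \<tau> n
     \<and> \<bar>\<beta>lhat n \<omega> - \<beta>ln n\<bar> \<le> K * (1 / sqrt (real n) + \<tau> n)
     \<and> \<bar>\<beta>uhat n \<omega> - \<beta>un n\<bar> \<le> K * (1 / sqrt (real n) + \<tau> n))) sequentially"
    using rate[OF \<tau> \<tau>0, of "p / 2"] by auto
  let ?Z = "\<lambda>n \<omega>. a n * \<bar>\<theta>hat n \<omega> - \<theta>n n\<bar>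
      + b n * \<bar>\<beta>lhat n \<omega> - \<beta>ln n\<bar> + b n * \<bar>\<beta>uhat n \<omega> - \<beta>un n\<bar>"
  have "eventually (\<lambda>n. measure (M n) {\<omega> \<in> space (M n). \<bar>?Z n \<omega>\<bar> > 5 * K} < p) sequentially"
    using ev ab eventually_ge_at_top[of 1]
  proof eventually_elim
    case (elim n)
    interpret Mn: prob_space "M n" by (rule M[OF elim(3)])
    have "whp (M n) (p / 2) (\<lambda>\<omega>. \<not> \<bar>?Z n \<omega>\<bar> > 5 * K)"
    proof (rule whp_mono[OF elim(1)])
      fix \<omega>
      assume *: "\<bar>\<theta>hat n \<omega> - \<theta>n n\<bar> \<le> K * \<tau> n
     \<and> \<bar>\<beta>lhat n \<omega> - \<beta>ln n\<bar> \<le> K * (1 / sqrt (real n) + \<tau> n)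
     \<and> \<bar>\<beta>uhat n \<omega> - \<beta>un n\<bar> \<le> K * (1 / sqrt (real n) + \<tau> n)"
      have part: "v * x \<le> K * w" if "0 \<le> v" "v * y \<le> w" "x \<le> K * y" for v x y w :: real
      proof -
        have "v * x \<le> v * (K * y)" using that by (intro mult_left_mono) auto
        also have "\<dots> = K * (v * y)" by simp
        also have "\<dots> \<le> K * w" using that K by (intro mult_left_mono) auto
        finally show ?thesis .
      qed
      have "a n * \<bar>\<theta>hat n \<omega> - \<theta>n n\<bar> \<le> K * 1" using * elim(2) by (intro part) auto
      moreover have "b n * \<bar>\<beta>lhat n \<omega> - \<beta>ln n\<bar> \<le> K * 2" using * elim(2) by (intro part) auto
      moreover have "b n * \<bar>\<beta>uhat n \<omega> - \<beta>un n\<bar> \<le> K * 2" using * elim(2) by (intro part) auto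
      moreover have "0 \<le> ?Z n \<omega>" using elim(2) by (intro add_nonneg_nonneg mult_nonneg_nonneg) auto
      ultimately show "\<not> \<bar>?Z n \<omega>\<bar> > 5 * K" by simp
    qed simp
    then have "measure (M n) {\<omega> \<in> space (M n). \<not> \<not> \<bar>?Z n \<omega>\<bar> > 5 * K} \<le> p / 2" by (rule Mn.whp_prob_le)
    then show ?case using p by simp
  qed
  then show "\<exists>K. eventually (\<lambda>n. measure (M n) {\<omega> \<in> space (M n). \<bar>?Z n \<omega>\<bar> > K} < p) sequentially" by blast
qed

text \<open>With $\tau_n = n^{-1/3} \alpha_n^{-2/3}$ one has $n \alpha_n^2 \tau_n^3 = 1$, and $n \tau_n \ge 1$ because
$\alpha_n \le n$.\<close>

lemma slow_jump_rate:
  assumes "\<alpha> \<in> o(\<lambda>n. real n)"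
  shows "bounded_in_prob M (\<lambda>n \<omega>.
            real n powr (1/3) * \<alpha> n powr (2/3) * \<bar>\<theta>hat n \<omega> - \<theta>n n\<bar>
          + real n powr (1/3) * \<alpha> n powr (1/6) * \<bar>\<beta>lhat n \<omega> - \<beta>ln n\<bar>
          + real n powr (1/3) * \<alpha> n powr (1/6) * \<bar>\<beta>uhat n \<omega> - \<beta>un n\<bar>)"
proof -
  define \<tau> where "\<tau> n = real n powr (-1/3) * \<alpha> n powr (-2/3)" for n
  have "eventually (\<lambda>n. norm (\<alpha> n) \<le> 1 * norm (real n)) sequentially"
    by (rule landau_o.smallD[OF assms]) simp
  moreover have "eventually (\<lambda>n. 1 \<le> \<alpha> n) sequentially" using \<alpha>(2) unfolding filterlim_at_top by blast
  ultimately have ev: "eventually (\<lambda>n. 1 \<le> \<alpha> n \<and> \<alpha> n \<le> real n \<and> 1 \<le> real n) sequentially"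
    using eventually_ge_at_top[of 1] by eventually_elim auto
  have sq: "x / sqrt x = sqrt x" if "0 < x" for x :: real using that by (simp add: real_div_sqrt)
  show ?thesis
  proof (rule bounded_in_prob_scaled[where \<tau> = \<tau>])
    show "eventually (\<lambda>n. 0 < \<tau> n \<and> 1 \<le> real n * \<tau> n \<and> 1 \<le> real n * (\<alpha> n)\<^sup>2 * \<tau> n ^ 3) sequentially"
      using ev
    proof eventually_elim
      case (elim n)
      define x y where "x = real n" and "y = \<alpha> n"
      have xy: "0 < x" "0 < y" "y \<le> x" using elim by (auto simp: x_def y_def)
      have "x * \<tau> n = x powr 1 * (x powr (-1/3) * y powr (-2/3))" using xy by (simp add: \<tau>_def x_def y_def)
      also have "\<dots> = x powr (2/3) * y powr (-2/3)" by (simp only: mult.assoc[symmetric] powr_add[symmetric]) simp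
      also have "\<dots> \<ge> y powr (2/3) * y powr (-2/3)" using xy by (intro mult_right_mono powr_mono2) auto
      finally have 1: "1 \<le> x * \<tau> n" using xy by (simp add: powr_add[symmetric])
      have "\<tau> n ^ 3 = (x powr (-1/3)) ^ 3 * (y powr (-2/3)) ^ 3" by (simp add: \<tau>_def x_def y_def power_mult_distrib)
      also have "\<dots> = x powr (-1) * y powr (-2)" using xy by (simp add: powr_power)
      finally have "x * y\<^sup>2 * \<tau> n ^ 3 = (x powr 1 * x powr (-1)) * (y powr 2 * y powr (-2))"
        using xy by (simp add: powr_numeral)
      also have "\<dots> = 1" using xy by (simp only: powr_add[symmetric]) simp
      finally have 2: "x * y\<^sup>2 * \<tau> n ^ 3 = 1" .
      have "0 < \<tau> n" using xy by (simp add: \<tau>_def x_def y_def)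
      then show ?case using 1 2 unfolding x_def y_def by simp
    qed
    show "\<tau> \<longlonglongrightarrow> 0"
    proof (rule Lim_null_comparison)
      show "eventually (\<lambda>n. norm (\<tau> n) \<le> real n powr (-1/3)) sequentially" using ev
      proof eventually_elim
        case (elim n)
        have "\<alpha> n powr (-2/3) \<le> 1" using elim powr_mono[of "-2/3" 0 "\<alpha> n"] by simp
        then have "real n powr (-1/3) * \<alpha> n powr (-2/3) \<le> real n powr (-1/3) * 1" by (intro mult_left_mono) auto
        then show ?case by (simp add: \<tau>_def)
      qed
      show "(\<lambda>n. real n powr (-1/3)) \<longlonglongrightarrow> 0"
        by (rule tendsto_neg_powr[OF _ filterlim_real_sequentially]) simp
    qed
    show "eventually (\<lambda>n. 0 \<le> real n powr (1/3) * \<alpha> n powr (2/3) \<and> real n powr (1/3) * \<alpha> n powr (2/3) * \<tau> n \<le> 1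
        \<and> 0 \<le> real n powr (1/3) * \<alpha> n powr (1/6)
        \<and> real n powr (1/3) * \<alpha> n powr (1/6) * (1 / sqrt (real n) + \<tau> n) \<le> 2) sequentially"
      using ev
    proof eventually_elim
      case (elim n)
      define x y where "x = real n" and "y = \<alpha> n"
      have xy: "0 < x" "0 < y" "y \<le> x" "1 \<le> x" "1 \<le> y" using elim by (auto simp: x_def y_def)
      have t: "\<tau> n = x powr (-1/3) * y powr (-2/3)" by (simp add: \<tau>_def x_def y_def)
      have "x powr (1/3) * y powr (2/3) * \<tau> n = (x powr (1/3) * x powr (-1/3)) * (y powr (2/3) * y powr (-2/3))"
        unfolding t by (simp add: ac_simps)
      also have "\<dots> = 1" using xy by (simp only: powr_add[symmetric]) simp
      finally have 1: "x powr (1/3) * y powr (2/3) * \<tau> n = 1" .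
      have "x powr (1/3) * y powr (1/6) * \<tau> n = (x powr (1/3) * x powr (-1/3)) * (y powr (1/6) * y powr (-2/3))"
        unfolding t by (simp add: ac_simps)
      also have "\<dots> = y powr (-1/2)" using xy by (simp only: powr_add[symmetric]) simp
      also have "\<dots> \<le> 1" using xy powr_mono[of "-1/2" 0 y] by simp
      finally have 2: "x powr (1/3) * y powr (1/6) * \<tau> n \<le> 1" .
      have "x powr (1/3) * y powr (1/6) * (1 / sqrt x) = y powr (1/6) * (x powr (1/3) * x powr (-1/2))"
        using xy by (simp add: powr_half_sqrt[symmetric] powr_minus_divide)
      also have "\<dots> = y powr (1/6) * x powr (-1/6)" by (simp only: powr_add[symmetric]) simp
      also have "\<dots> \<le> x powr (1/6) * x powr (-1/6)" using xy by (intro mult_right_mono powr_mono2) auto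
      also have "\<dots> = 1" using xy by (simp only: powr_add[symmetric]) simp
      finally have 3: "x powr (1/3) * y powr (1/6) * (1 / sqrt x) \<le> 1" .
      show ?case using 1 2 3 unfolding x_def y_def by (simp add: distrib_left)
    qed
  qed
qed

text \<open>With $\tau_n = 1 / n$ one has $n \tau_n = 1$ and $n \alpha_n^2 \tau_n^3 = (\alpha_n / n)^2 \ge 1$; the cut is
limited by the spacing of the design, as for a true jump.\<close>

lemma fast_jump_rate:
  assumes ev: "eventually (\<lambda>n. real n \<le> \<alpha> n) sequentially"
  shows "bounded_in_prob M (\<lambda>n \<omega>. real n * \<bar>\<theta>hat n \<omega> - \<theta>n n\<bar>
          + sqrt (real n) * \<bar>\<beta>lhat n \<omega> - \<beta>ln n\<bar> + sqrt (real n) * \<bar>\<beta>uhat n \<omega> - \<beta>un n\<bar>)"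
proof (rule bounded_in_prob_scaled[where \<tau> = "\<lambda>n. 1 / real n"])
  show "eventually (\<lambda>n. 0 < 1 / real n \<and> 1 \<le> real n * (1 / real n) \<and> 1 \<le> real n * (\<alpha> n)\<^sup>2 * (1 / real n) ^ 3) sequentially"
    using ev eventually_ge_at_top[of 1]
  proof eventually_elim
    case (elim n)
    have "(real n)\<^sup>2 \<le> (\<alpha> n)\<^sup>2" using elim by (intro power_mono) auto
    moreover have "real n * (\<alpha> n)\<^sup>2 * (1 / real n) ^ 3 = (\<alpha> n)\<^sup>2 / (real n)\<^sup>2"
      using elim by (simp add: power3_eq_cube power2_eq_square)
    ultimately show ?case using elim by simp
  qed
  show "(\<lambda>n. 1 / real n) \<longlonglongrightarrow> 0" by (rule lim_1_over_n)
  show "eventually (\<lambda>n. 0 \<le> real n \<and> real n * (1 / real n) \<le> 1 \<and> 0 \<le> sqrt (real n)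
      \<and> sqrt (real n) * (1 / sqrt (real n) + 1 / real n) \<le> 2) sequentially"
    using eventually_ge_at_top[of 1]
  proof eventually_elim
    case (elim n)
    have "sqrt (real n) \<le> real n" using elim by (intro real_le_lsqrt) (auto simp: power2_eq_square)
    then have "sqrt (real n) / real n \<le> 1" using elim by simp
    then show ?case using elim by (simp add: distrib_left)
  qed
qed

end

theorem theorem3p2:
  fixes f :: "real \<Rightarrow> real" and \<theta>0 \<beta>l0 \<beta>u0 \<xi>0 \<sigma> :: real and \<alpha> :: "nat \<Rightarrow> real"
    and B :: "'b measure" and X0 \<epsilon>0 :: "'b \<Rightarrow> real" and pX :: "real \<Rightarrow> real"
    and P :: "nat \<Rightarrow> (real \<times> real) measure"
    and M :: "nat \<Rightarrow> 'w measure" and Y X :: "nat \<Rightarrow> nat \<Rightarrow> 'w \<Rightarrow> real"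
    and \<theta>n \<beta>ln \<beta>un \<xi> :: "nat \<Rightarrow> real"
    and \<theta>hat \<beta>lhat \<beta>uhat :: "nat \<Rightarrow> 'w \<Rightarrow> real"
  assumes \<theta>0: "0 < \<theta>0" "\<theta>0 < 1"
    and f: "smooth f" "bounded (range f)" "mono f"
    and f_limits: "(f \<longlongrightarrow> \<beta>l0) at_bot" "(f \<longlongrightarrow> \<beta>u0) at_top"
    and \<alpha>: "\<And>n. n \<ge> 1 \<Longrightarrow> \<alpha> n > 0" "filterlim \<alpha> at_top sequentially"
    \<comment> \<open>the generic pair\<close>
    and B: "prob_space B"
    and X0: "distributed B lborel X0 (\<lambda>x. ennreal (pX x))" "\<And>x. pX x \<ge> 0"
            "AE \<omega> in B. X0 \<omega> \<in> {0..1}"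
    and \<epsilon>0: "\<epsilon>0 \<in> borel_measurable B" "integrable B (\<lambda>\<omega>. (\<epsilon>0 \<omega>)\<^sup>2)"
            "prob_space.expectation B \<epsilon>0 = 0" "prob_space.variance B \<epsilon>0 = \<sigma>\<^sup>2"
    and indep: "prob_space.indep_var B borel X0 borel \<epsilon>0"
    and P: "\<And>n. P n = stage_law B X0 \<epsilon>0 (f_stage f \<alpha> \<theta>0 n)"
    \<comment> \<open>the sample of size \<open>n\<close> at stage \<open>n\<close>\<close>
    and M: "\<And>n. n \<ge> 1 \<Longrightarrow> prob_space (M n)"
    and iid_indep: "\<And>n. n \<ge> 1 \<Longrightarrow> prob_space.indep_vars (M n) (\<lambda>_. borel \<Otimes>\<^sub>M borel)
                      (\<lambda>i \<omega>. (Y n i \<omega>, X n i \<omega>)) {1..n}"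
    and iid_law: "\<And>n i. i \<in> {1..n} \<Longrightarrow>
                      distr (M n) (borel \<Otimes>\<^sub>M borel) (\<lambda>\<omega>. (Y n i \<omega>, X n i \<omega>)) = P n"
    \<comment> \<open>the unique population minimizer\<close>
    and pop_min: "\<And>n. n \<ge> 1 \<Longrightarrow>
        {\<psi>. is_arg_min (pop_risk (P n)) (\<lambda>\<psi>. \<psi> \<in> param_space) \<psi>} = {(\<theta>n n, \<beta>ln n, \<beta>un n)}"
    and \<beta>_neq: "\<And>n. n \<ge> 1 \<Longrightarrow> \<beta>ln n \<noteq> \<beta>un n"
    \<comment> \<open>the estimator: an empirical minimizer with smallest first coordinate\<close>
    and est_meas: "\<And>n. n \<ge> 1 \<Longrightarrow> \<theta>hat n \<in> borel_measurable (M n)"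
                  "\<And>n. n \<ge> 1 \<Longrightarrow> \<beta>lhat n \<in> borel_measurable (M n)"
                  "\<And>n. n \<ge> 1 \<Longrightarrow> \<beta>uhat n \<in> borel_measurable (M n)"
    and est_min: "\<And>n \<omega>. n \<ge> 1 \<Longrightarrow> \<omega> \<in> space (M n) \<Longrightarrow>
        is_arg_min (emp_risk n (\<lambda>i. (Y n i \<omega>, X n i \<omega>))) (\<lambda>\<psi>. \<psi> \<in> param_space)
          (\<theta>hat n \<omega>, \<beta>lhat n \<omega>, \<beta>uhat n \<omega>)"
    and est_smallest: "\<And>n \<omega> \<psi>. n \<ge> 1 \<Longrightarrow> \<omega> \<in> space (M n) \<Longrightarrow>
        is_arg_min (emp_risk n (\<lambda>i. (Y n i \<omega>, X n i \<omega>))) (\<lambda>\<psi>. \<psi> \<in> param_space) \<psi> \<Longrightarrow>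
        \<theta>hat n \<omega> \<le> fst \<psi>"
    and \<xi>: "\<And>n. \<xi> n = \<alpha> n * (\<theta>n n - \<theta>0)"
    and \<xi>0: "\<xi>0 = inv f ((\<beta>l0 + \<beta>u0) / 2)"
    and A: "\<exists>U. open U \<and> \<xi>0 \<in> U \<and> f C1_differentiable_on U" "deriv f \<xi>0 > 0"
    and B': "\<exists>V. open V \<and> \<theta>0 \<in> V \<and> (\<forall>x\<in>V. pX x \<noteq> 0) \<and> pX C1_differentiable_on V"
    and C1: "(INF n\<in>{1..}. Liminf at_infinity (\<lambda>h1::real.
               ereal (1 / \<bar>h1\<bar> * (LBINT t=ereal 0..ereal h1. f (t + \<xi> n) - f (\<xi> n))))) > 0"
    and C2: "\<And>K::real. K > 0 \<Longrightarrow>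
               (INF n\<in>{1..}. INF u\<in>{- K + \<xi> n..K + \<xi> n}. ereal (deriv f u)) > 0"
    and C3: "set_integrable lborel {..\<xi>0} (\<lambda>t. f t - \<beta>l0)"
            "set_integrable lborel {\<xi>0..} (\<lambda>t. f t - \<beta>u0)"
  shows
    "(\<alpha> \<in> o(\<lambda>n. real n) \<longrightarrow>
        bounded_in_prob M (\<lambda>n \<omega>.
            real n powr (1/3) * \<alpha> n powr (2/3) * \<bar>\<theta>hat n \<omega> - \<theta>n n\<bar>
          + real n powr (1/3) * \<alpha> n powr (1/6) * \<bar>\<beta>lhat n \<omega> - \<beta>ln n\<bar>
          + real n powr (1/3) * \<alpha> n powr (1/6) * \<bar>\<beta>uhat n \<omega> - \<beta>un n\<bar>))
     \<and> ((\<forall>n\<ge>1. \<alpha> n = real n) \<longrightarrow>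
        bounded_in_prob M (\<lambda>n \<omega>.
            real n * \<bar>\<theta>hat n \<omega> - \<theta>n n\<bar>
          + sqrt (real n) * \<bar>\<beta>lhat n \<omega> - \<beta>ln n\<bar>
          + sqrt (real n) * \<bar>\<beta>uhat n \<omega> - \<beta>un n\<bar>))
     \<and> ((\<lambda>n. real n) \<in> o(\<alpha>) \<longrightarrow>
        bounded_in_prob M (\<lambda>n \<omega>.
            real n * \<bar>\<theta>hat n \<omega> - \<theta>n n\<bar>
          + sqrt (real n) * \<bar>\<beta>lhat n \<omega> - \<beta>ln n\<bar>
          + sqrt (real n) * \<bar>\<beta>uhat n \<omega> - \<beta>un n\<bar>))"
proof -
  have diff: "f differentiable (at x)" for x
    using f(1)[unfolded smooth_def, rule_format, of 0 x] by simp
  then have cont: "continuous_on UNIV f"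
    by (intro continuous_at_imp_continuous_on ballI differentiable_imp_continuous_within)
  note between = mono_limits_bound[OF f(3) f_limits]
  obtain c0 where c0: "0 < c0" "\<And>n. n \<ge> 1 \<Longrightarrow> f (\<xi> n) + c0 \<le> \<beta>u0 \<and> \<beta>l0 + c0 \<le> f (\<xi> n)"
    using separated_from_limits[OF cont between C1] by blast
  have jump: "\<beta>l0 < \<beta>u0" using c0(1) c0(2)[of 1] by simp
  obtain K0 where K0: "0 < K0" "\<And>n. n \<ge> 1 \<Longrightarrow> \<bar>\<xi> n\<bar> \<le> K0"
    using bounded_if_separated[OF f(3) f_limits c0(1), of \<xi>] c0(2) by blast
  obtain c where c: "0 < c" "\<And>n v. n \<ge> 1 \<Longrightarrow> 0 \<le> v \<Longrightarrow> c * min v 1 \<le> f (\<xi> n + v) - f (\<xi> n)"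
      "\<And>n v. n \<ge> 1 \<Longrightarrow> 0 \<le> v \<Longrightarrow> c * min v 1 \<le> f (\<xi> n) - f (\<xi> n - v)"
    using uniform_slope[OF diff f(3) C2[of 1]] by auto
  obtain V where V: "open V" "\<theta>0 \<in> V" "pX \<theta>0 \<noteq> 0" "continuous_on V pX"
    using B' C1_differentiable_imp_continuous_on by blast
  obtain r pm pM where r: "0 < r" "0 < pm" "0 < pM" "\<And>x y. \<theta>0 - r \<le> x \<Longrightarrow> x \<le> y \<Longrightarrow> y \<le> \<theta>0 + r \<Longrightarrow>
     pm * (y - x) \<le> measure (distr B borel X0) {x<..y} \<and> measure (distr B borel X0) {x<..y} \<le> pM * (y - x)"
    using density_interval_mass[OF B X0(1,2) V] by blast
  have pm: "is_arg_min (pop_risk (P n)) (\<lambda>\<psi>. \<psi> \<in> param_space) (\<theta>n n, \<beta>ln n, \<beta>un n)" if "n \<ge> 1" for n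
    using pop_min[OF that] by blast
  interpret growing_jump f \<theta>0 \<beta>l0 \<beta>u0 \<sigma> \<alpha> B X0 \<epsilon>0 P M Y X \<theta>n \<beta>ln \<beta>un \<xi> \<theta>hat \<beta>lhat \<beta>uhat r pm pM K0 c
  proof (rule growing_jump.intro)
    show "X0 \<in> borel_measurable B" using distributed_measurable[OF X0(1)] by simp
    show "\<theta>n n \<in> {0..1}" if "n \<ge> 1" for n
      using pm[OF that] by (auto simp: is_arg_min_def param_space_def)
    show "pop_risk (P n) (\<theta>n n, \<beta>ln n, \<beta>un n) \<le> pop_risk (P n) (t, l, u)" if "n \<ge> 1" "t \<in> {0..1}" for n t l u
      using pm[OF that(1)] that(2) unfolding is_arg_min_def param_space_def by (auto simp: not_less)
    show "\<theta>hat n \<omega> \<in> {0..1}" if "n \<ge> 1" "\<omega> \<in> space (M n)" for n \<omega>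
      using est_min[OF that] by (auto simp: is_arg_min_def param_space_def)
    show "emp_risk n (\<lambda>i. (Y n i \<omega>, X n i \<omega>)) (\<theta>hat n \<omega>, \<beta>lhat n \<omega>, \<beta>uhat n \<omega>)
          \<le> emp_risk n (\<lambda>i. (Y n i \<omega>, X n i \<omega>)) (t, l, u)"
      if "n \<ge> 1" "\<omega> \<in> space (M n)" "t \<in> {0..1}" for n \<omega> t l u
      using est_min[OF that(1,2)] that(3) unfolding is_arg_min_def param_space_def by (auto simp: not_less)
  qed (fact \<theta>0 f(3) cont f_limits jump \<alpha> B \<epsilon>0 indep P M iid_indep iid_law \<xi> r c K0)+
  show ?thesis
  proof (intro conjI impI)
    assume "\<alpha> \<in> o(\<lambda>n. real n)"
    then show "bounded_in_prob M (\<lambda>n \<omega>.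
            real n powr (1/3) * \<alpha> n powr (2/3) * \<bar>\<theta>hat n \<omega> - \<theta>n n\<bar>
          + real n powr (1/3) * \<alpha> n powr (1/6) * \<bar>\<beta>lhat n \<omega> - \<beta>ln n\<bar>
          + real n powr (1/3) * \<alpha> n powr (1/6) * \<bar>\<beta>uhat n \<omega> - \<beta>un n\<bar>)" by (rule slow_jump_rate)
  next
    assume "\<forall>n\<ge>1. \<alpha> n = real n"
    then have "eventually (\<lambda>n. real n \<le> \<alpha> n) sequentially" by (intro eventually_mono[OF eventually_ge_at_top[of 1]]) auto
    then show "bounded_in_prob M (\<lambda>n \<omega>. real n * \<bar>\<theta>hat n \<omega> - \<theta>n n\<bar>
          + sqrt (real n) * \<bar>\<beta>lhat n \<omega> - \<beta>ln n\<bar> + sqrt (real n) * \<bar>\<beta>uhat n \<omega> - \<beta>un n\<bar>)" by (rule fast_jump_rate)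
  next
    assume o: "(\<lambda>n. real n) \<in> o(\<alpha>)"
    have "eventually (\<lambda>n. norm (real n) \<le> 1 * norm (\<alpha> n)) sequentially" by (rule landau_o.smallD[OF o]) simp
    then have "eventually (\<lambda>n. real n \<le> \<alpha> n) sequentially" using eventually_ge_at_top[of 1]
      by eventually_elim (use \<alpha>(1) in \<open>fastforce\<close>)
    then show "bounded_in_prob M (\<lambda>n \<omega>. real n * \<bar>\<theta>hat n \<omega> - \<theta>n n\<bar>
          + sqrt (real n) * \<bar>\<beta>lhat n \<omega> - \<beta>ln n\<bar> + sqrt (real n) * \<bar>\<beta>uhat n \<omega> - \<beta>un n\<bar>)" by (rule fast_jump_rate)
  qed
qed

end
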